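(* Consider either of the following two frameworks. (S) Spherical case: $0<c<1$, and for every integer $n>2$, $\mathbf X=(X_1,\dots,X_n)'$ and $\mathbf Y=(Y_1,\dots,Y_n)'$ are independent random vectors where $\mathbf X$ has an $n$-variate spherical distribution with $P(\mathbf X=(0,\dots,0)')=0$ and $\mathbf Y$ has any distribution with $P(\mathbf Y\in\{k(1,\dots,1)':k\in\mathbb R\})=0$. (G) Gaussian case: $(X_i,Y_i)_{i=1,\dots,n}$ is an i.i.d. sample of an $\mathbb R^2$-valued Gaussian vector $(X,Y)$ with positive variances and correlation coefficient $\rho$, where $0\le\rho<c<1$ and $|\rho|\le\rho_0:=\frac{\sqrt{3+2\sqrt3}}{3}$. Let $r_n$ be the empirical Pearson correlation coefficient. Then there exists a sequence of real numbers $(\delta_{c,k})_{k\ge1}$ such that for every $p\ge1$, as $n\to\infty$, $$P(r_n\ge c)=\frac{e^{-nL^*(c)+R_0(\lambda_c)}}{\lambda_c\,\sigma_c\sqrt{2\pi n}}\left[1+\sum_{k=1}^{p}\frac{\delta_{c,k}}{n^k}+O\!\left(\frac1{n^{p+1}}\right)\right],$$ where $L^*$, $R_0$, $\lambda_c$, $\sigma_c$ are those of the framework considered, as defined in the context.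
   Context: The empirical Pearson correlation coefficient is $$r_n=\frac{\sum_{i=1}^n(X_i-\bar X_n)(Y_i-\bar Y_n)}{\sqrt{\sum_{i=1}^n(X_i-\bar X_n)^2\,\sum_{i=1}^n(Y_i-\bar Y_n)^2}},\qquad \bar X_n=\frac1n\sum_{k=1}^nX_k,\quad \bar Y_n=\frac1n\sum_{k=1}^nY_k .$$ A random vector in $\mathbb R^n$ has a spherical distribution if its law is invariant under all orthogonal transformations. Framework (S): $h(r)=\lambda r+\frac12\log(1-r^2)$; $r_0(\lambda)=\frac{-1+\sqrt{1+4\lambda^2}}{2\lambda}$ ($r_0(0)=0$) is the unique root of $h'(r)=0$ in $]-1,1[$; $g(r)=(1-r^2)^{-2}$; $L(\lambda)=h(r_0(\lambda))$; $L^*(y)=-\frac12\log(1-y^2)$; $R_0(\lambda)=\log g(r_0(\lambda))-\frac12\log|h''(r_0(\lambda))|$. Framework (G): $\overline h(r)=\lambda r-\log(1-\rho r)+\frac12\log(1-r^2)$; $r_0(\lambda)$ is the unique real root of $\overline h'(r)=0$ in $]-1,1[$; $\overline g_\rho(r)=(1-\rho^2)^{-1/2}(1-\rho r)^{3/2}(1-r^2)^{-2}$; $L(\lambda)=\overline h(r_0(\lambda))+\frac12\log(1-\rho^2)$; $L^*(y)=\log\frac{1-\rho y}{\sqrt{1-\rho^2}\sqrt{1-y^2}}$; $R_0(\lambda)=\log\overline g_\rho(r_0(\lambda))-\frac12\log|\overline h''(r_0(\lambda))|$. In both frameworks $\lambda_c$ is the unique $\lambda$ with $L'(\lambda)=c$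 and $\sigma_c>0$ is given by $\sigma_c^2=L''(\lambda_c)$. *)

theory Defs
  imports "HOL-Probability.Probability" "HOL-Library.Landau_Symbols"
begin

(* A vector of R^n is a function nat => real of which only the entries with index in {1..n}
   matter; as a measurable space, R^n is the product PiM {1..n} (\<lambda>_. borel), whose points are the
   functions that are undefined outside {1..n}. *)

section \<open>Empirical correlation coefficient\<close>

definition sample_mean :: "nat \<Rightarrow> (nat \<Rightarrow> real) \<Rightarrow> real" where
  "sample_mean n x = (\<Sum>k=1..n. x k) / real n"

definition pearson :: "nat \<Rightarrow> (nat \<Rightarrow> real) \<Rightarrow> (nat \<Rightarrow> real) \<Rightarrow> real" where
  "pearson n x y =
     (\<Sum>i=1..n. (x i - sample_mean n x) * (y i - sample_mean n y)) /
     sqrt ((\<Sum>i=1..n. (x i - sample_mean n x)\<^sup>2) * (\<Sum>i=1..n. (y i - sample_mean n y)\<^sup>2))"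

definition pearson_tail ::
    "(nat \<Rightarrow> 'a measure) \<Rightarrow> (nat \<Rightarrow> 'a \<Rightarrow> nat \<Rightarrow> real) \<Rightarrow> (nat \<Rightarrow> 'a \<Rightarrow> nat \<Rightarrow> real) \<Rightarrow> real \<Rightarrow> nat \<Rightarrow> real"
  where
  "pearson_tail M X Y c n = measure (M n) {\<omega> \<in> space (M n). pearson n (X n \<omega>) (Y n \<omega>) \<ge> c}"

section \<open>Spherical model\<close>

abbreviation Rn :: "nat \<Rightarrow> (nat \<Rightarrow> real) measure" where
  "Rn n \<equiv> Pi\<^sub>M {1..n} (\<lambda>_. borel)"

definition mat_apply :: "nat \<Rightarrow> (nat \<Rightarrow> nat \<Rightarrow> real) \<Rightarrow> (nat \<Rightarrow> real) \<Rightarrow> nat \<Rightarrow> real" where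
  "mat_apply n A x = (\<lambda>i\<in>{1..n}. \<Sum>j=1..n. A i j * x j)"

definition orthogonal_mat :: "nat \<Rightarrow> (nat \<Rightarrow> nat \<Rightarrow> real) \<Rightarrow> bool" where
  "orthogonal_mat n A \<longleftrightarrow>
     (\<forall>i\<in>{1..n}. \<forall>j\<in>{1..n}. (\<Sum>k=1..n. A k i * A k j) = (if i = j then 1 else 0))"

definition spherical :: "nat \<Rightarrow> (nat \<Rightarrow> real) measure \<Rightarrow> bool" where
  "spherical n \<mu> \<longleftrightarrow> (\<forall>A. orthogonal_mat n A \<longrightarrow> distr \<mu> (Rn n) (mat_apply n A) = \<mu>)"

definition spherical_model ::
    "nat \<Rightarrow> 'a measure \<Rightarrow> ('a \<Rightarrow> nat \<Rightarrow> real) \<Rightarrow> ('a \<Rightarrow> nat \<Rightarrow> real) \<Rightarrow> bool" where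
  "spherical_model n M X Y \<longleftrightarrow>
     prob_space M \<and>
     prob_space.indep_var M (Rn n) X (Rn n) Y \<and>
     spherical n (distr M (Rn n) X) \<and>
     measure M {\<omega> \<in> space M. \<forall>i\<in>{1..n}. X \<omega> i = 0} = 0 \<and>
     measure M {\<omega> \<in> space M. \<exists>k. \<forall>i\<in>{1..n}. Y \<omega> i = k} = 0"

section \<open>Gaussian model\<close>

definition std_normal :: "real measure" where
  "std_normal = density lborel std_normal_density"

(* Gaussian laws on the plane, degenerate ones included, as the affine images of the law of two
   independent standard normal variables. *)
definition gaussian2 :: "(real \<times> real) measure \<Rightarrow> bool" where
  "gaussian2 N \<longleftrightarrow>
     (\<exists>m1 m2 a11 a12 a21 a22.
        N = distr (std_normal \<Otimes>\<^sub>M std_normal) borel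
              (\<lambda>(z, w). (m1 + a11 * z + a12 * w, m2 + a21 * z + a22 * w)))"

definition covariance :: "'a measure \<Rightarrow> ('a \<Rightarrow> real) \<Rightarrow> ('a \<Rightarrow> real) \<Rightarrow> real" where
  "covariance M U V =
     prob_space.expectation M
       (\<lambda>\<omega>. (U \<omega> - prob_space.expectation M U) * (V \<omega> - prob_space.expectation M V))"

definition correlation :: "'a measure \<Rightarrow> ('a \<Rightarrow> real) \<Rightarrow> ('a \<Rightarrow> real) \<Rightarrow> real" where
  "correlation M U V =
     covariance M U V / sqrt (prob_space.variance M U * prob_space.variance M V)"

definition gaussian_law :: "real \<Rightarrow> (real \<times> real) measure \<Rightarrow> bool" where
  "gaussian_law \<rho> N \<longleftrightarrow>
     gaussian2 N \<and> prob_space.variance N fst > 0 \<and> prob_space.variance N snd > 0 \<and>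
     correlation N fst snd = \<rho>"

definition iid_sample ::
    "(real \<times> real) measure \<Rightarrow> nat \<Rightarrow> 'a measure \<Rightarrow> ('a \<Rightarrow> nat \<Rightarrow> real) \<Rightarrow> ('a \<Rightarrow> nat \<Rightarrow> real) \<Rightarrow> bool"
  where
  "iid_sample N n M X Y \<longleftrightarrow>
     prob_space M \<and>
     prob_space.indep_vars M (\<lambda>_. borel) (\<lambda>i \<omega>. (X \<omega> i, Y \<omega> i)) {1..n} \<and>
     (\<forall>i\<in>{1..n}. distr M borel (\<lambda>\<omega>. (X \<omega> i, Y \<omega> i)) = N)"

section \<open>Functions of the spherical framework\<close>

definition h_S :: "real \<Rightarrow> real \<Rightarrow> real" where
  "h_S l r = l * r + 1 / 2 * ln (1 - r\<^sup>2)"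

definition r0_S :: "real \<Rightarrow> real" where
  "r0_S l = (if l = 0 then 0 else (- 1 + sqrt (1 + 4 * l\<^sup>2)) / (2 * l))"

definition g_S :: "real \<Rightarrow> real" where
  "g_S r = (1 - r\<^sup>2) powr (- 2)"

definition L_S :: "real \<Rightarrow> real" where
  "L_S l = h_S l (r0_S l)"

definition Lstar_S :: "real \<Rightarrow> real" where
  "Lstar_S y = - 1 / 2 * ln (1 - y\<^sup>2)"

definition R0_S :: "real \<Rightarrow> real" where
  "R0_S l = ln (g_S (r0_S l)) - 1 / 2 * ln \<bar>deriv (deriv (h_S l)) (r0_S l)\<bar>"

section \<open>Functions of the Gaussian framework\<close>

definition h_G :: "real \<Rightarrow> real \<Rightarrow> real \<Rightarrow> real" where
  "h_G \<rho> l r = l * r - ln (1 - \<rho> * r) + 1 / 2 * ln (1 - r\<^sup>2)"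

definition r0_G :: "real \<Rightarrow> real \<Rightarrow> real" where
  "r0_G \<rho> l = (THE r. - 1 < r \<and> r < 1 \<and> (h_G \<rho> l has_real_derivative 0) (at r))"

definition g_G :: "real \<Rightarrow> real \<Rightarrow> real" where
  "g_G \<rho> r = (1 - \<rho>\<^sup>2) powr (- 1 / 2) * (1 - \<rho> * r) powr (3 / 2) * (1 - r\<^sup>2) powr (- 2)"

definition L_G :: "real \<Rightarrow> real \<Rightarrow> real" where
  "L_G \<rho> l = h_G \<rho> l (r0_G \<rho> l) + 1 / 2 * ln (1 - \<rho>\<^sup>2)"

definition Lstar_G :: "real \<Rightarrow> real \<Rightarrow> real" where
  "Lstar_G \<rho> y = ln ((1 - \<rho> * y) / (sqrt (1 - \<rho>\<^sup>2) * sqrt (1 - y\<^sup>2)))"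

definition R0_G :: "real \<Rightarrow> real \<Rightarrow> real" where
  "R0_G \<rho> l =
     ln (g_G \<rho> (r0_G \<rho> l)) - 1 / 2 * ln \<bar>deriv (deriv (h_G \<rho> l)) (r0_G \<rho> l)\<bar>"

section \<open>Sharp large deviation expansion\<close>

definition lambda_c :: "(real \<Rightarrow> real) \<Rightarrow> real \<Rightarrow> real" where
  "lambda_c L c = (THE l. (L has_real_derivative c) (at l))"

definition sigma_c :: "(real \<Rightarrow> real) \<Rightarrow> real \<Rightarrow> real" where
  "sigma_c L c = sqrt (deriv (deriv L) (lambda_c L c))"

definition sharp_expansion ::
    "(real \<Rightarrow> real) \<Rightarrow> (real \<Rightarrow> real) \<Rightarrow> (real \<Rightarrow> real) \<Rightarrow> real \<Rightarrow> (nat \<Rightarrow> real) \<Rightarrow> (nat \<Rightarrow> real) \<Rightarrow> bool"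
  where
  "sharp_expansion L Lstar R0 c P \<delta> \<longleftrightarrow>
     (\<forall>p\<ge>1. \<exists>\<epsilon> \<in> O(\<lambda>n. 1 / real n ^ (p + 1)). \<forall>\<^sub>F n in sequentially.
        P n = exp (- real n * Lstar c + R0 (lambda_c L c)) /
                (lambda_c L c * sigma_c L c * sqrt (2 * pi * real n)) *
              (1 + (\<Sum>k=1..p. \<delta> k / real n ^ k) + \<epsilon> n))"

end

(* The spherical case reduces to the Gaussian case with \<rho> = 0: reflections that fix the constant
   vectors show that P(r_n \<ge> c | Y = y) does not depend on the direction of y, and exchanging the
   roles of X and Y replaces the spherical law by the Gaussian one.

   In the Gaussian case write X = p U + q V, Y = p U - q V up to affine maps, with U, V independent
   normal vectors, p^2 = (1 + \<rho>)/2 and q^2 = (1 - \<rho>)/2, and let s = |U|, z = <U,V>/s and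
   z^2 + t^2 = |V|^2 after centring. Then s, t are independent chi variables, z is normal, and
   r_n \<ge> c is a homogeneous condition on (s, t, z). Integrating the radius out leaves an integral over the half-plane with coordinates v = s/t, x = z/t. With
   u = (1 + v^2 + x^2)/(2v) and the polar angle \<alpha> on the circle of centre u and radius sqrt(u^2 - 1) the
   density becomes proportional to u^(1-n) du d\<alpha>, and the event is an arc of the circle, of length
   proportional to arccos of an explicit algebraic function. An integration by parts gives
     P(r_n \<ge> c) = (1/\<pi>) \<integral> u^(2-n) (a u - b) / ((u^2 - 1) sqrt((u - u0)(u + u1))) du   over u > u0,
   with log u0 = L*(c), and Watson's lemma in the variable log(u/u0) yields the expansion. *)

theory Submission
  imports Defs "HOL-Complex_Analysis.Complex_Analysis"
begin

section \<open>The saddle-point equation\<close>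

text \<open>The tail formula is exact for every n > 2, so no Laplace transform of r_n and no change
  of probability occurs. The functions L, R0, the point \<open>lambda_c\<close> and
  \<open>sigma_c\<close> only have to be evaluated at c and matched with the leading term of the
  integral.

  Evaluating them requires a unique saddle point. \<open>saddle_eq\<close> is chosen so that
  \<open>h_G \<rho> l\<close> has derivative l - \<open>saddle_eq \<rho>\<close>. Its own derivative
  has the sign of a cubic, which touches zero inside ]-1,1[ when \<rho> reaches the critical value;
  this is the origin of the bound on \<rho>. At the critical value \<open>r0_G\<close> is continuous
  but not differentiable everywhere, so L' comes from an envelope argument, and L'' is computed only
  at \<open>lambda_c\<close>, where c > \<rho> keeps the derivative of \<open>saddle_eq\<close>
  positive.

  The sum and difference coordinates U, V are taken because the event then becomes a linear
  inequality in (u, v). The angle of the arc opens like a square root at u0. Its derivative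
  therefore has an inverse square root singularity there, which gives the factor n^(-1/2) and, after
  division by the leading term, only integer powers of 1/n.\<close>

definition saddle_eq :: "real \<Rightarrow> real \<Rightarrow> real" where
  "saddle_eq \<rho> r = r / (1 - r\<^sup>2) - \<rho> / (1 - \<rho> * r)"

definition saddle_eq_deriv :: "real \<Rightarrow> real \<Rightarrow> real" where
  "saddle_eq_deriv \<rho> r = (1 + r\<^sup>2) / (1 - r\<^sup>2)\<^sup>2 - \<rho>\<^sup>2 / (1 - \<rho> * r)\<^sup>2"

lemma one_minus_square_pos: "0 < 1 - r\<^sup>2" if "- 1 < r" "r < 1" for r :: real
  using that abs_square_less_1[of r] by (simp add: abs_less_iff)

lemma one_minus_mult_pos: "0 < 1 - \<rho> * r" if "0 \<le> \<rho>" "\<rho> < 1" "- 1 < r" "r < 1" for \<rho> r :: real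
proof -
  have "\<bar>\<rho> * r\<bar> < 1"
    using that mult_strict_mono'[of "\<bar>\<rho>\<bar>" 1 "\<bar>r\<bar>" 1] by (auto simp: abs_mult)
  then show ?thesis by auto
qed

lemma saddle_eq_has_deriv:
  assumes "0 \<le> \<rho>" "\<rho> < 1" "- 1 < r" "r < 1"
  shows "(saddle_eq \<rho> has_real_derivative saddle_eq_deriv \<rho> r) (at r)"
proof -
  have a: "1 - r\<^sup>2 \<noteq> 0" "1 - \<rho> * r \<noteq> 0"
    using one_minus_square_pos[OF assms(3,4)] one_minus_mult_pos[OF assms] by auto
  show ?thesis unfolding saddle_eq_def[abs_def] saddle_eq_deriv_def
    by (rule derivative_eq_intros | (use a in \<open>simp; fail\<close>))+
      (use a in \<open>simp add: field_simps power2_eq_square\<close>)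
qed

lemma h_G_has_deriv:
  assumes "0 \<le> \<rho>" "\<rho> < 1" "- 1 < r" "r < 1"
  shows "(h_G \<rho> l has_real_derivative (l - saddle_eq \<rho> r)) (at r)"
proof -
  have a: "1 - r\<^sup>2 > 0" "1 - \<rho> * r > 0"
    using one_minus_square_pos[OF assms(3,4)] one_minus_mult_pos[OF assms] by auto
  have i: "2 * inverse (2 - r\<^sup>2 * 2) = inverse (1 - r\<^sup>2)"
    using a(1) by (simp add: divide_simps)
  show ?thesis unfolding h_G_def[abs_def] saddle_eq_def
    by (rule derivative_eq_intros | (use a in \<open>simp; fail\<close>))+ (simp add: divide_inverse i)
qed

lemma rho0_square: "(sqrt (3 + 2 * sqrt 3) / 3)\<^sup>2 = (3 + 2 * sqrt 3) / 9"
  by (simp add: power_divide)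

text \<open>At the critical value \<open>\<rho>\<^sub>0\<close> of the correlation the cubic below acquires a double root, at
  \<open>(2 * sqrt 3 - 3) * \<rho>\<^sub>0\<close>; the third root is larger than 1.\<close>

lemma saddle_cubic_nonneg_critical:
  fixes x k :: real
  assumes k: "k = sqrt (3 + 2 * sqrt 3) / 3" and x: "x < 1"
  shows "0 \<le> (1 + x\<^sup>2) * (1 - k * x)\<^sup>2 - k\<^sup>2 * (1 - x\<^sup>2)\<^sup>2"
proof -
  define w where "w = sqrt (3::real)"
  have w2: "w * w = 3" and w0: "w > 0" by (auto simp: w_def)
  have k2: "k\<^sup>2 = (3 + 2 * w) / 9" by (simp only: k rho0_square w_def)
  have k0: "k > 0" unfolding k by (intro divide_pos_pos) (auto intro: add_pos_nonneg)
  define x0 where "x0 = (2 * w - 3) * k"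
  \<comment> \<open>The cubic is to be (x - x0)^2 (y - 2 k x); comparing the coefficients of x^2
    determines y.\<close>
  define y where "y = (1 + 3 * k\<^sup>2) - 2 * k * (2 * x0)"
  have kk: "k * k = (3 + 2 * w) / 9" using k2 by (simp add: power2_eq_square)
  have x0k: "x0 * k = 1 / 3"
  proof -
    have "x0 * k = (2 * w - 3) * (k * k)" by (simp add: x0_def)
    also have "\<dots> = (4 * (w * w) - 9) / 9" by (simp add: kk algebra_simps)
    also have "\<dots> = 1 / 3" using w2 by simp
    finally show ?thesis .
  qed
  have x02: "x0\<^sup>2 = (2 * w - 3) / 3"
  proof -
    have "x0\<^sup>2 = (2 * w - 3) * (x0 * k)" by (simp add: x0_def power2_eq_square)
    then show ?thesis by (simp add: x0k)
  qed
  have y_eq: "y = 2 * w / 3 + 2 / 3"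
  proof -
    have "y = 1 + 3 * k\<^sup>2 - 4 * (x0 * k)" by (simp add: y_def)
    then show ?thesis unfolding x0k k2 by (simp add: field_simps)
  qed
  \<comment> \<open>Both products contain k^2 x^4, so the difference is only a cubic.\<close>
  have e: "(1 + x\<^sup>2) * (1 - k * x)\<^sup>2 - k\<^sup>2 * (1 - x\<^sup>2)\<^sup>2
     = (1 - k\<^sup>2) - 2 * k * x + (1 + 3 * k\<^sup>2) * x\<^sup>2 - 2 * k * x ^ 3"
    by (simp add: algebra_simps power2_eq_square power3_eq_cube)
  have c0: "1 - k\<^sup>2 = x0\<^sup>2 * y"
    using w2 by (simp add: k2 x02 y_eq field_simps)
  have x0k1: "2 * x0 * y + 2 * k * x0\<^sup>2 = 2 * k"
  proof -
    have "2 * x0 * y + 2 * k * x0\<^sup>2 = 2 * k * ((2 * w - 3) * y + x0\<^sup>2)"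
      by (simp add: x0_def algebra_simps)
    also have "(2 * w - 3) * y + x0\<^sup>2 = 1"
      using w2 by (simp add: x02 y_eq field_simps)
    finally show ?thesis by simp
  qed
  have f: "(1 - k\<^sup>2) - 2 * k * x + (1 + 3 * k\<^sup>2) * x\<^sup>2 - 2 * k * x ^ 3 = (x - x0)\<^sup>2 * (y - 2 * k * x)"
  proof -
    have "(x - x0)\<^sup>2 * (y - 2 * k * x) = x0\<^sup>2 * y - (2 * x0 * y + 2 * k * x0\<^sup>2) * x
        + (y + 4 * k * x0) * x\<^sup>2 - 2 * k * x ^ 3"
      by (simp add: algebra_simps power2_eq_square power3_eq_cube)
    also have "y + 4 * k * x0 = 1 + 3 * k\<^sup>2" by (simp add: y_def)
    finally show ?thesis using c0 x0k1 by simp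
  qed
  have "2 * k \<le> y"
  proof (rule power2_le_imp_le)
    show "(2 * k)\<^sup>2 \<le> y\<^sup>2"
      unfolding power_mult_distrib k2 y_eq using w2 w0 by (simp add: power2_eq_square field_simps)
    show "0 \<le> y" using w0 by (simp add: y_eq)
  qed
  moreover have "2 * k * x \<le> 2 * k * 1" using x k0 by (intro mult_left_mono) auto
  ultimately have "0 \<le> y - 2 * k * x" by simp
  then show ?thesis unfolding e f by simp
qed

text \<open>The quotient \<rho> / (1 - \<rho> x) increases with \<rho>, so the critical value k is
  the worst case. The comparison is made without denominators, and the positive factor (1 - k x)^2
  is cancelled at the end.\<close>

lemma saddle_cubic_nonneg:
  fixes x \<rho> :: real
  assumes r: "0 \<le> \<rho>" "\<rho> < 1" "\<rho> \<le> sqrt (3 + 2 * sqrt 3) / 3" and x: "- 1 < x" "x < 1"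
  shows "0 \<le> (1 + x\<^sup>2) * (1 - \<rho> * x)\<^sup>2 - \<rho>\<^sup>2 * (1 - x\<^sup>2)\<^sup>2"
proof -
  define k where "k = sqrt (3 + 2 * sqrt 3) / 3"
  have "sqrt 3 < (3::real)" by (rule real_less_lsqrt) auto
  then have k1: "k < 1" unfolding k_def by (simp add: real_sqrt_less_iff) (rule real_less_lsqrt; simp)
  have k0: "0 \<le> k" "\<rho> \<le> k" using r by (auto simp: k_def)
  have p: "0 < 1 - k * x" "0 < 1 - \<rho> * x" using one_minus_mult_pos x k0 k1 r by auto
  have s: "0 < 1 - x\<^sup>2" using one_minus_square_pos x by auto
  have "\<rho> * (1 - k * x) \<le> k * (1 - \<rho> * x)" using k0 by (simp add: algebra_simps)
  then have "(\<rho> * (1 - x\<^sup>2) * (1 - k * x))\<^sup>2 \<le> (k * (1 - x\<^sup>2) * (1 - \<rho> * x))\<^sup>2"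
    using r(1) p(1) s by (intro power_mono mult_nonneg_nonneg) (auto simp: mult.commute mult.left_commute intro: mult_left_mono)
  also have "\<dots> = k\<^sup>2 * (1 - x\<^sup>2)\<^sup>2 * (1 - \<rho> * x)\<^sup>2" by (simp add: power_mult_distrib)
  also have "\<dots> \<le> (1 + x\<^sup>2) * (1 - k * x)\<^sup>2 * (1 - \<rho> * x)\<^sup>2"
    using saddle_cubic_nonneg_critical[OF k_def x(2)] by (intro mult_right_mono) auto
  finally have "(\<rho>\<^sup>2 * (1 - x\<^sup>2)\<^sup>2) * (1 - k * x)\<^sup>2 \<le> ((1 + x\<^sup>2) * (1 - \<rho> * x)\<^sup>2) * (1 - k * x)\<^sup>2"
    by (simp add: power_mult_distrib mult_ac)
  then show ?thesis using p(1) by simp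
qed

section \<open>The saddle point and the function L for an admissible correlation\<close>

locale corr_param =
  fixes \<rho> :: real
  assumes rho: "0 \<le> \<rho>" "\<rho> < 1" "\<rho> \<le> sqrt (3 + 2 * sqrt 3) / 3"
begin

lemma saddle_eq_deriv_alt:
  assumes "- 1 < r" "r < 1"
  shows "saddle_eq_deriv \<rho> r =
    ((1 + r\<^sup>2) * (1 - \<rho> * r)\<^sup>2 - \<rho>\<^sup>2 * (1 - r\<^sup>2)\<^sup>2) / ((1 - r\<^sup>2)\<^sup>2 * (1 - \<rho> * r)\<^sup>2)"
  using one_minus_square_pos[OF assms] one_minus_mult_pos[OF rho(1,2) assms]
  by (simp add: saddle_eq_deriv_def diff_frac_eq)

lemma saddle_eq_mono:
  assumes "- 1 < r" "r \<le> s" "s < 1"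
  shows "saddle_eq \<rho> r \<le> saddle_eq \<rho> s"
proof (rule DERIV_nonneg_imp_nondecreasing[OF assms(2)])
  fix x assume "r \<le> x" "x \<le> s"
  then have x: "- 1 < x" "x < 1" using assms by auto
  show "\<exists>y. (saddle_eq \<rho> has_real_derivative y) (at x) \<and> 0 \<le> y"
    using saddle_eq_has_deriv[OF rho(1,2) x] saddle_cubic_nonneg[OF rho x]
    unfolding saddle_eq_deriv_alt[OF x] by (intro exI conjI) auto
qed

text \<open>The derivative may vanish (for the critical \<open>\<rho>\<close>), but only at the roots of a polynomial.\<close>

lemma saddle_eq_strict_mono:
  assumes "- 1 < r" "r < s" "s < 1"
  shows "saddle_eq \<rho> r < saddle_eq \<rho> s"
proof (rule ccontr)
  assume "\<not> saddle_eq \<rho> r < saddle_eq \<rho> s"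
  then have eq: "saddle_eq \<rho> r = saddle_eq \<rho> s"
    using saddle_eq_mono[of r s] assms by simp
  \<comment> \<open>The expanded numerator of \<open>saddle_eq_deriv_alt\<close>. Its constant
    coefficient is positive, so it is not the zero polynomial and cannot vanish on an
    interval.\<close>
  define q where "q = [:1 - \<rho>\<^sup>2, - 2 * \<rho>, 1 + 3 * \<rho>\<^sup>2, - 2 * \<rho>:]"
  have "poly q x = 0" if x: "x \<in> {r<..<s}" for x
  proof -
    have x1: "- 1 < x" "x < 1" using x assms by auto
    have const: "saddle_eq \<rho> y = saddle_eq \<rho> r" if "y \<in> {r<..<s}" for y
      using saddle_eq_mono[of r y] saddle_eq_mono[of y s] that assms eq by auto
    have "((\<lambda>_. saddle_eq \<rho> r) has_real_derivative saddle_eq_deriv \<rho> x) (at x)"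
      by (rule has_field_derivative_transform_within_open[OF saddle_eq_has_deriv[OF rho(1,2) x1], of "{r<..<s}"])
        (use x const in auto)
    then have "saddle_eq_deriv \<rho> x = 0" by (metis DERIV_unique DERIV_const)
    then have "(1 + x\<^sup>2) * (1 - \<rho> * x)\<^sup>2 - \<rho>\<^sup>2 * (1 - x\<^sup>2)\<^sup>2 = 0"
      unfolding saddle_eq_deriv_alt[OF x1]
      using one_minus_square_pos[OF x1] one_minus_mult_pos[OF rho(1,2) x1] by simp
    then show ?thesis by (simp add: q_def algebra_simps power2_eq_square)
  qed
  then have "{r<..<s} \<subseteq> {x. poly q x = 0}" by auto
  moreover have "infinite {r<..<s}" using assms by simp
  moreover have "q \<noteq> 0" using one_minus_square_pos[of \<rho>] rho by (simp add: q_def)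
  ultimately show False using poly_roots_finite[of q] finite_subset by blast
qed

lemma saddle_eq_surj: "\<exists>r. - 1 < r \<and> r < 1 \<and> saddle_eq \<rho> r = l"
proof -
  \<comment> \<open>This is l - \<open>saddle_eq \<rho> r\<close> times the common denominator. It
    stays continuous at the end points, with values 1 + \<rho> > 0 at -1 and \<rho> - 1 < 0 at
    1.\<close>
  define Q where "Q r = l * (1 - r\<^sup>2) * (1 - \<rho> * r) - r * (1 - \<rho> * r) + \<rho> * (1 - r\<^sup>2)" for r
  have "\<exists>r\<ge>- 1. r \<le> 1 \<and> Q r = 0"
    by (rule IVT2) (use rho in \<open>auto simp: Q_def intro!: continuous_intros\<close>)
  then obtain r where r: "- 1 \<le> r" "r \<le> 1" "Q r = 0" by auto
  moreover have "r \<noteq> 1" "r \<noteq> - 1" using r(3) rho by (auto simp: Q_def)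
  ultimately have r1: "- 1 < r" "r < 1" by auto
  have "saddle_eq \<rho> r = l"
  proof -
    have "r * (1 - \<rho> * r) - \<rho> * (1 - r\<^sup>2) = l * ((1 - r\<^sup>2) * (1 - \<rho> * r))"
      using r(3) by (simp add: Q_def)
    then show ?thesis
      using one_minus_square_pos[OF r1] one_minus_mult_pos[OF rho(1,2) r1]
      by (simp add: saddle_eq_def diff_frac_eq)
  qed
  then show ?thesis using r1 by blast
qed

lemma r0_G_unique:
  assumes "- 1 < r" "r < 1" "saddle_eq \<rho> r = l"
  shows "r0_G \<rho> l = r"
  unfolding r0_G_def
proof (rule the_equality)
  show "- 1 < r \<and> r < 1 \<and> (h_G \<rho> l has_real_derivative 0) (at r)"
    using h_G_has_deriv[OF rho(1,2) assms(1,2), of l] assms by simp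
  fix s assume s: "- 1 < s \<and> s < 1 \<and> (h_G \<rho> l has_real_derivative 0) (at s)"
  then have "saddle_eq \<rho> s = l"
    using DERIV_unique h_G_has_deriv[OF rho(1,2), of s l] by fastforce
  then show "s = r"
    using saddle_eq_strict_mono[of s r] saddle_eq_strict_mono[of r s] s assms by (cases s r rule: linorder_cases) auto
qed

lemma r0_G_props: "- 1 < r0_G \<rho> l" "r0_G \<rho> l < 1" "saddle_eq \<rho> (r0_G \<rho> l) = l"
  using saddle_eq_surj[of l] r0_G_unique by auto

lemma r0_G_saddle_eq: "- 1 < r \<Longrightarrow> r < 1 \<Longrightarrow> r0_G \<rho> (saddle_eq \<rho> r) = r"
  using r0_G_unique by blast

text \<open>\<open>r0_G \<rho>\<close> inverts the continuous injective function
  \<open>saddle_eq \<rho>\<close>. The argument uses continuity only, so it also covers points where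
  the derivative of \<open>saddle_eq\<close> vanishes.\<close>

lemma isCont_r0_G: "isCont (r0_G \<rho>) l"
proof -
  define r where "r = r0_G \<rho> l"
  have r: "- 1 < r" "r < 1" "saddle_eq \<rho> r = l" using r0_G_props[of l] by (auto simp: r_def)
  define d where "d = min (1 - r) (r + 1) / 2"
  have dd: "- 1 < z \<and> z < 1" if "\<bar>z - r\<bar> \<le> d" for z proof -
    have "d \<le> (1 - r) / 2" "d \<le> (r + 1) / 2" by (auto simp: d_def)
    then show ?thesis using that r(1,2) unfolding abs_le_iff by (auto simp: field_simps)
  qed
  have d: "0 < d" using r by (auto simp: d_def)
  have "isCont (r0_G \<rho>) (saddle_eq \<rho> r)"
  proof (rule isCont_inverse_function[where f = "saddle_eq \<rho>" and x = r, OF d])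
    fix z assume "\<bar>z - r\<bar> \<le> d"
    then have z: "- 1 < z" "z < 1" using dd by auto
    show "r0_G \<rho> (saddle_eq \<rho> z) = z" using z by (rule r0_G_saddle_eq)
    show "isCont (saddle_eq \<rho>) z" using saddle_eq_has_deriv[OF rho(1,2) z] by (rule DERIV_isCont)
  qed
  then show ?thesis by (simp add: r)
qed

text \<open>The derivative l - \<open>saddle_eq \<rho>\<close> is nonnegative to the left of the
  saddle point and nonpositive to its right, by monotonicity of \<open>saddle_eq\<close>.\<close>

lemma h_G_le:
  assumes "- 1 < r" "r < 1"
  shows "h_G \<rho> l r \<le> h_G \<rho> l (r0_G \<rho> l)"
proof -
  define t where "t = r0_G \<rho> l"
  have t: "- 1 < t" "t < 1" "saddle_eq \<rho> t = l" using r0_G_props[of l] by (auto simp: t_def)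
  have "h_G \<rho> l r \<le> h_G \<rho> l t"
  proof (cases "r \<le> t")
    case True
    show ?thesis
    proof (rule DERIV_nonneg_imp_nondecreasing[OF True])
      fix x assume x: "r \<le> x" "x \<le> t"
      then show "\<exists>y. (h_G \<rho> l has_real_derivative y) (at x) \<and> 0 \<le> y"
        using h_G_has_deriv[OF rho(1,2), of x l] saddle_eq_mono[of x t] assms t by (intro exI[of _ "l - saddle_eq \<rho> x"]) auto
    qed
  next
    case False
    then have tr: "t \<le> r" by simp
    show ?thesis
    proof (rule DERIV_nonpos_imp_nonincreasing[OF tr])
      fix x assume x: "t \<le> x" "x \<le> r"
      then show "\<exists>y. (h_G \<rho> l has_real_derivative y) (at x) \<and> y \<le> 0"
        using h_G_has_deriv[OF rho(1,2), of x l] saddle_eq_mono[of t x] assms t by (intro exI[of _ "l - saddle_eq \<rho> x"]) auto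
    qed
  qed
  then show ?thesis by (simp add: t_def)
qed

text \<open>Envelope argument: \<open>L_G \<rho>\<close> is a supremum of affine functions, attained at \<open>r0_G \<rho> l\<close>.\<close>

lemma L_G_increment: "(\<mu> - l) * r0_G \<rho> l \<le> L_G \<rho> \<mu> - L_G \<rho> l"
  using h_G_le[OF r0_G_props(1,2)[of l], of \<mu>] by (simp add: L_G_def h_G_def algebra_simps)

text \<open>The increment bound, used also with l and \<mu> exchanged, traps the difference quotient
  between \<open>r0_G \<rho> l\<close> and \<open>r0_G \<rho> \<mu>\<close>. Continuity of
  \<open>r0_G\<close> then suffices; its differentiability is never asked for.\<close>

lemma L_G_has_deriv: "(L_G \<rho> has_real_derivative r0_G \<rho> l) (at l)"
  unfolding has_field_derivative_iff
proof (rule LIM_zero_cancel, rule Lim_null_comparison)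
  show "\<forall>\<^sub>F \<mu> in at l. norm ((L_G \<rho> \<mu> - L_G \<rho> l) / (\<mu> - l) - r0_G \<rho> l) \<le> norm (r0_G \<rho> \<mu> - r0_G \<rho> l)"
  proof (rule eventually_at_topological[THEN iffD2], intro exI conjI ballI impI)
    show "open (UNIV :: real set)" "l \<in> UNIV" by auto
    fix \<mu> assume ne: "\<mu> \<noteq> l"
    define D where "D = (L_G \<rho> \<mu> - L_G \<rho> l) / (\<mu> - l)"
    have a: "(\<mu> - l) * r0_G \<rho> l \<le> D * (\<mu> - l)" "D * (\<mu> - l) \<le> (\<mu> - l) * r0_G \<rho> \<mu>"
    proof -
      have "D * (\<mu> - l) = L_G \<rho> \<mu> - L_G \<rho> l" using ne by (simp add: D_def)
      then show "(\<mu> - l) * r0_G \<rho> l \<le> D * (\<mu> - l)" "D * (\<mu> - l) \<le> (\<mu> - l) * r0_G \<rho> \<mu>"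
        using L_G_increment[of \<mu> l] L_G_increment[of l \<mu>] by (auto simp: algebra_simps)
    qed
    have "r0_G \<rho> l \<le> D \<and> D \<le> r0_G \<rho> \<mu> \<or> r0_G \<rho> \<mu> \<le> D \<and> D \<le> r0_G \<rho> l"
    proof (cases "l < \<mu>")
      case True
      then show ?thesis using a by (simp add: mult.commute)
    next
      case False
      then have "\<mu> - l < 0" using ne by simp
      then show ?thesis using a by (simp add: mult.commute mult_le_cancel_left_neg)
    qed
    then show "norm (D - r0_G \<rho> l) \<le> norm (r0_G \<rho> \<mu> - r0_G \<rho> l)" by auto
  qed
  show "((\<lambda>\<mu>. norm (r0_G \<rho> \<mu> - r0_G \<rho> l)) \<longlongrightarrow> 0) (at l)"
    using isCont_r0_G[of l] by (intro tendsto_norm_zero) (simp add: isCont_def LIM_zero_iff)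
qed

lemma deriv_L_G: "deriv (L_G \<rho>) = r0_G \<rho>"
  using L_G_has_deriv by (auto intro!: ext DERIV_imp_deriv)

section \<open>The constants of the expansion at a level c above the correlation\<close>

context
  fixes c :: real
  assumes c: "\<rho> < c" "c < 1"
begin

lemma lambda_c_L_G: "lambda_c (L_G \<rho>) c = saddle_eq \<rho> c"
  unfolding lambda_c_def
proof (rule the_equality)
  show "(L_G \<rho> has_real_derivative c) (at (saddle_eq \<rho> c))"
    using L_G_has_deriv[of "saddle_eq \<rho> c"] r0_G_saddle_eq[of c] c rho by simp
  fix l assume "(L_G \<rho> has_real_derivative c) (at l)"
  then have "r0_G \<rho> l = c" using L_G_has_deriv DERIV_unique by blast
  then show "l = saddle_eq \<rho> c" using r0_G_props(3)[of l] by simp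
qed

text \<open>From c > \<rho> one gets 1 - c^2 < 1 - \<rho> c, and \<rho>^2 < 1 + c^2 always. Hence
  the derivative is strictly positive at c even for the critical correlation, where it vanishes
  elsewhere.\<close>

lemma saddle_eq_deriv_pos: "0 < saddle_eq_deriv \<rho> c"
proof -
  have c1: "- 1 < c" "0 < c" using c rho by auto
  have "\<rho> * c < c * c" using c c1 by (intro mult_strict_right_mono) auto
  then have "1 - c\<^sup>2 < 1 - \<rho> * c" by (simp add: power2_eq_square)
  then have "(1 - c\<^sup>2)\<^sup>2 < (1 - \<rho> * c)\<^sup>2"
    using one_minus_square_pos[OF c1(1) c(2)] by (intro power_strict_mono) auto
  moreover have "\<rho>\<^sup>2 < 1 + c\<^sup>2" using one_minus_square_pos[of \<rho>] rho zero_le_power2[of c] by linarith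
  ultimately have "\<rho>\<^sup>2 * (1 - c\<^sup>2)\<^sup>2 < (1 + c\<^sup>2) * (1 - \<rho> * c)\<^sup>2"
    by (intro mult_less_le_imp_less) (use c1 one_minus_square_pos[OF c1(1) c(2)] in \<open>auto simp: add_pos_nonneg\<close>)
  then show ?thesis
    unfolding saddle_eq_deriv_alt[OF c1(1) c(2)]
    using one_minus_square_pos[OF c1(1) c(2)] one_minus_mult_pos[OF rho(1,2) c1(1) c(2)] by simp
qed

lemma sigma_c_L_G: "sigma_c (L_G \<rho>) c = sqrt (1 / saddle_eq_deriv \<rho> c)"
proof -
  have c1: "- 1 < c" using c rho by auto
  have "(r0_G \<rho> has_real_derivative inverse (saddle_eq_deriv \<rho> c)) (at (saddle_eq \<rho> c))"
  proof (rule DERIV_inverse_function)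
    show "(saddle_eq \<rho> has_real_derivative saddle_eq_deriv \<rho> c) (at (r0_G \<rho> (saddle_eq \<rho> c)))"
      using saddle_eq_has_deriv[OF rho(1,2) c1 c(2)] r0_G_saddle_eq[OF c1 c(2)] by simp
    show "saddle_eq_deriv \<rho> c \<noteq> 0" using saddle_eq_deriv_pos by simp
    show "saddle_eq \<rho> c - 1 < saddle_eq \<rho> c" "saddle_eq \<rho> c < saddle_eq \<rho> c + 1" by auto
  qed (use r0_G_props isCont_r0_G in auto)
  then have "deriv (r0_G \<rho>) (saddle_eq \<rho> c) = 1 / saddle_eq_deriv \<rho> c"
    by (simp add: DERIV_imp_deriv inverse_eq_divide)
  then show ?thesis by (simp add: sigma_c_def deriv_L_G lambda_c_L_G)
qed

lemma deriv2_h_G: "deriv (deriv (h_G \<rho> l)) c = - saddle_eq_deriv \<rho> c"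
proof -
  have c1: "- 1 < c" using c rho by auto
  have "((\<lambda>r. l - saddle_eq \<rho> r) has_real_derivative - saddle_eq_deriv \<rho> c) (at c)"
    using DERIV_diff[OF DERIV_const saddle_eq_has_deriv[OF rho(1,2) c1 c(2)]] by simp
  then have "(deriv (h_G \<rho> l) has_real_derivative - saddle_eq_deriv \<rho> c) (at c)"
    by (rule has_field_derivative_transform_within_open[of _ _ _ "{-1<..<1}"])
      (use c c1 DERIV_imp_deriv[OF h_G_has_deriv[OF rho(1,2)]] in auto)
  then show ?thesis by (rule DERIV_imp_deriv)
qed

lemma exp_R0_G:
  "exp (R0_G \<rho> (saddle_eq \<rho> c)) = g_G \<rho> c / sqrt (saddle_eq_deriv \<rho> c)"
proof -
  have c1: "- 1 < c" using c rho by auto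
  have "g_G \<rho> c > 0"
    using one_minus_square_pos[OF c1 c(2)] one_minus_mult_pos[OF rho(1,2) c1 c(2)] one_minus_square_pos[of \<rho>] rho
    by (simp add: g_G_def)
  then show ?thesis
    using saddle_eq_deriv_pos
    by (simp add: R0_G_def r0_G_saddle_eq[OF c1 c(2)] deriv2_h_G exp_diff)
       (simp add: powr_half_sqrt[symmetric] powr_def)
qed

lemma exp_Lstar_G:
  "exp (- real n * Lstar_G \<rho> c) = ((1 - \<rho> * c) / (sqrt (1 - \<rho>\<^sup>2) * sqrt (1 - c\<^sup>2))) powr (- real n)"
proof -
  have c1: "- 1 < c" using c rho by auto
  have "(1 - \<rho> * c) / (sqrt (1 - \<rho>\<^sup>2) * sqrt (1 - c\<^sup>2)) > 0"
    using one_minus_square_pos[OF c1 c(2)] one_minus_mult_pos[OF rho(1,2) c1 c(2)] one_minus_square_pos[of \<rho>] rho by simp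
  then show ?thesis by (simp only: Lstar_G_def powr_def less_imp_neq[symmetric] if_False)
qed

text \<open>The second derivative enters exp(R0) as an inverse square root and
  \<open>sigma_c\<close> in the same way, so it cancels from the quotient.\<close>

lemma expansion_prefactor:
  "exp (- real n * Lstar_G \<rho> c + R0_G \<rho> (lambda_c (L_G \<rho>) c)) /
     (lambda_c (L_G \<rho>) c * sigma_c (L_G \<rho>) c * sqrt (2 * pi * real n)) =
   ((1 - \<rho> * c) / (sqrt (1 - \<rho>\<^sup>2) * sqrt (1 - c\<^sup>2))) powr (- real n) *
     (g_G \<rho> c / (saddle_eq \<rho> c * sqrt (2 * pi * real n)))"
  using saddle_eq_deriv_pos
  unfolding exp_add exp_Lstar_G lambda_c_L_G exp_R0_G sigma_c_L_G
  by (simp add: real_sqrt_divide)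

end

end

section \<open>The spherical functions as the Gaussian ones with \<rho> = 0\<close>

lemma corr_param_0: "corr_param 0"
  by standard auto

lemma h_S_eq: "h_S = h_G 0"
  by (auto simp: h_S_def h_G_def fun_eq_iff)

lemma r0_S_eq: "r0_S = r0_G 0"
proof
  fix l
  interpret corr_param 0 by (rule corr_param_0)
  define s where "s = sqrt (1 + 4 * l\<^sup>2)"
  have s: "s\<^sup>2 = 1 + 4 * l\<^sup>2" "s \<ge> 1" by (auto simp: s_def)
  show "r0_S l = r0_G 0 l"
  proof (cases "l = 0")
    case True
    then show ?thesis using r0_G_unique[of 0 0] by (simp add: r0_S_def saddle_eq_def)
  next
    case False
    define r where "r = r0_S l"
    have r: "r * (2 * l) = s - 1" using False by (simp add: r_def r0_S_def s_def)
    have "s > 1" using s False by (smt (verit) power2_less_eq_zero_iff zero_less_power2 power_one one_power2)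
    \<comment> \<open>For s > 1 one has (s - 1)^2 < s^2 - 1 = 4 l^2; this selects the root of the
      quadratic equation that lies in ]-1,1[.\<close>
    have "(r * (2 * l))\<^sup>2 < (2 * l)\<^sup>2"
      unfolding r using s(1) \<open>s > 1\<close> by (simp add: power2_eq_square algebra_simps)
    then have "r\<^sup>2 < 1" by (simp add: power_mult_distrib False)
    then have r1: "- 1 < r" "r < 1" by (auto simp: abs_square_less_1 abs_less_iff)
    have "l * (l * (1 - r\<^sup>2)) = l * r"
    proof -
      have "4 * (l * (l * (1 - r\<^sup>2))) = 4 * l\<^sup>2 - (r * (2 * l))\<^sup>2" by (simp add: power2_eq_square algebra_simps)
      also have "\<dots> = 2 * (r * (2 * l))" unfolding r using s(1) by (simp add: power2_eq_square algebra_simps)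
      finally show ?thesis by simp
    qed
    then have "saddle_eq 0 r = l"
      using one_minus_square_pos[OF r1] False by (simp add: saddle_eq_def divide_eq_eq)
    then show ?thesis using r0_G_unique[OF r1] by (simp add: r_def)
  qed
qed

lemma L_S_eq: "L_S = L_G 0"
  by (auto simp: L_S_def L_G_def r0_S_eq h_S_eq fun_eq_iff)

lemma R0_S_eq: "R0_S = R0_G 0"
  by (auto simp: R0_S_def R0_G_def r0_S_eq h_S_eq fun_eq_iff g_S_def g_G_def)

lemma Lstar_S_eq:
  assumes "- 1 < c" "c < 1"
  shows "Lstar_S c = Lstar_G 0 c"
  using one_minus_square_pos[OF assms]
  by (simp add: Lstar_S_def Lstar_G_def ln_div ln_sqrt)

section \<open>Watson's lemma\<close>

text \<open>Euler's integral for Gamma after rescaling the variable by x.\<close>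

lemma has_bochner_integral_Gamma_scaled:
  fixes s x :: real
  assumes s: "0 < s" and x: "0 < x"
  shows "has_bochner_integral lborel
    (\<lambda>t. indicator {0<..} t * (t powr (s - 1) * exp (- x * t))) (Gamma s * x powr (- s))"
proof (rule has_bochner_integral_nn_integral)
  have "ennreal (Gamma s) = (\<integral>\<^sup>+t. ennreal (indicator {0..} t * t powr (s - 1) / exp t) \<partial>lborel)"
    by (rule Gamma_conv_nn_integral_real[OF s])
  also have "\<dots> = ennreal \<bar>x\<bar> * (\<integral>\<^sup>+t. ennreal (indicator {0..} (0 + x * t) * (0 + x * t) powr (s - 1) / exp (0 + x * t)) \<partial>lborel)"
    by (rule nn_integral_real_affine) (use x in auto)
  also have "\<dots> = ennreal x * (\<integral>\<^sup>+t. ennreal (x powr (s - 1)) * ennreal (indicator {0<..} t * (t powr (s - 1) * exp (- x * t))) \<partial>lborel)"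
    using x by (intro arg_cong2[where f = "(*)"] nn_integral_cong)
      (auto simp: indicator_def powr_mult exp_minus divide_inverse zero_le_mult_iff ennreal_mult'[symmetric] mult_ac)
  also have "\<dots> = ennreal (x powr s) * (\<integral>\<^sup>+t. ennreal (indicator {0<..} t * (t powr (s - 1) * exp (- x * t))) \<partial>lborel)"
    using x by (subst nn_integral_cmult)
      (auto simp: mult.assoc[symmetric] ennreal_mult'[symmetric] powr_mult_base)
  finally have "ennreal (x powr (- s)) * ennreal (Gamma s) =
      ennreal (x powr (- s)) * ennreal (x powr s) * (\<integral>\<^sup>+t. ennreal (indicator {0<..} t * (t powr (s - 1) * exp (- x * t))) \<partial>lborel)"
    by (simp add: mult.assoc)
  then show "(\<integral>\<^sup>+t. ennreal (indicator {0<..} t * (t powr (s - 1) * exp (- x * t))) \<partial>lborel) = ennreal (Gamma s * x powr (- s))"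
    using x s by (simp add: ennreal_mult'[symmetric] powr_add[symmetric] mult.commute)
qed (use s x Gamma_real_pos[of s] in \<open>auto simp: less_imp_le\<close>)

text \<open>The Taylor polynomial is integrated term by term and exactly. The remainder is assumed
  to be bounded on the whole half-line, with an exponential weight exp(M \<tau>), so one further
  Gamma integral, at x - M, bounds the error explicitly and the range of integration need not be
  split.\<close>

lemma watson_lemma:
  fixes F :: "real \<Rightarrow> real" and g :: "nat \<Rightarrow> real"
  assumes M: "0 \<le> M" and F[measurable]: "F \<in> borel_measurable borel"
    and bound: "\<And>\<tau>. 0 < \<tau> \<Longrightarrow> \<bar>F \<tau> - (\<Sum>k\<le>p. g k * \<tau> ^ k)\<bar> \<le> C * \<tau> ^ (p + 1) * exp (M * \<tau>)"
    and x: "M < x"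
  shows "\<bar>(LINT \<tau>|lborel. indicator {0<..} \<tau> * (\<tau> powr (- 1 / 2) * exp (- x * \<tau>) * F \<tau>))
      - (\<Sum>k\<le>p. g k * Gamma (real k + 1 / 2) * x powr (- (real k + 1 / 2)))\<bar>
    \<le> C * Gamma (real p + 3 / 2) * (x - M) powr (- (real p + 3 / 2))"
proof -
  define S where "S \<tau> = (\<Sum>k\<le>p. g k * \<tau> ^ k)" for \<tau>
  have pw: "\<tau> powr (- 1 / 2) * \<tau> ^ k = \<tau> powr (real k + 1 / 2 - 1)" if "0 < \<tau>" for \<tau> :: real and k
    using that by (simp add: powr_realpow[symmetric] powr_add[symmetric])
  have I1: "has_bochner_integral lborel
     (\<lambda>\<tau>. indicator {0<..} \<tau> * (\<tau> powr (- 1 / 2) * exp (- x * \<tau>) * S \<tau>))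
     (\<Sum>k\<le>p. g k * (Gamma (real k + 1 / 2) * x powr (- (real k + 1 / 2))))"
  proof -
    have "has_bochner_integral lborel
     (\<lambda>\<tau>. \<Sum>k\<le>p. g k * (indicator {0<..} \<tau> * (\<tau> powr (real k + 1 / 2 - 1) * exp (- x * \<tau>))))
     (\<Sum>k\<le>p. g k * (Gamma (real k + 1 / 2) * x powr (- (real k + 1 / 2))))"
      using x M by (intro has_bochner_integral_sum has_bochner_integral_mult_right has_bochner_integral_Gamma_scaled) auto
    also have "(\<lambda>\<tau>. \<Sum>k\<le>p. g k * (indicator {0<..} \<tau> * (\<tau> powr (real k + 1 / 2 - 1) * exp (- x * \<tau>))))
       = (\<lambda>\<tau>. indicator {0<..} \<tau> * (\<tau> powr (- 1 / 2) * exp (- x * \<tau>) * S \<tau>))"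
    proof
      fix \<tau> :: real
      show "(\<Sum>k\<le>p. g k * (indicator {0<..} \<tau> * (\<tau> powr (real k + 1 / 2 - 1) * exp (- x * \<tau>))))
         = indicator {0<..} \<tau> * (\<tau> powr (- 1 / 2) * exp (- x * \<tau>) * S \<tau>)"
      proof (cases "0 < \<tau>")
        case True
        show ?thesis
          unfolding S_def sum_distrib_left
          by (intro sum.cong) (simp_all add: pw[OF True, simplified, symmetric] mult_ac)
      qed simp
    qed
    finally show ?thesis .
  qed
  have I2: "has_bochner_integral lborel
     (\<lambda>\<tau>. C * (indicator {0<..} \<tau> * (\<tau> powr (real p + 3 / 2 - 1) * exp (- (x - M) * \<tau>))))
     (C * (Gamma (real p + 3 / 2) * (x - M) powr (- (real p + 3 / 2))))"
    using x by (intro has_bochner_integral_mult_right has_bochner_integral_Gamma_scaled) auto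
  define R where "R \<tau> = indicator {0<..} \<tau> * (\<tau> powr (- 1 / 2) * exp (- x * \<tau>) * (F \<tau> - S \<tau>))" for \<tau> :: real
  have [measurable]: "S \<in> borel_measurable borel" unfolding S_def[abs_def] by measurable
  have R_le: "norm (R \<tau>) \<le> C * (indicator {0<..} \<tau> * (\<tau> powr (real p + 3 / 2 - 1) * exp (- (x - M) * \<tau>)))" for \<tau>
  proof (cases "0 < \<tau>")
    case True
    have "norm (R \<tau>) = \<tau> powr (- 1 / 2) * exp (- x * \<tau>) * \<bar>F \<tau> - S \<tau>\<bar>"
      using True by (simp add: R_def abs_mult)
    also have "\<dots> \<le> \<tau> powr (- 1 / 2) * exp (- x * \<tau>) * (C * \<tau> ^ (p + 1) * exp (M * \<tau>))"
      using bound[OF True] by (intro mult_left_mono) (auto simp: S_def)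
    also have "\<dots> = C * ((\<tau> powr (- 1 / 2) * \<tau> ^ (p + 1)) * (exp (- x * \<tau>) * exp (M * \<tau>)))"
      by (simp only: mult_ac)
    also have "\<tau> powr (- 1 / 2) * \<tau> ^ (p + 1) = \<tau> powr (real p + 3 / 2 - 1)"
      unfolding pw[OF True] by simp
    also have "exp (- x * \<tau>) * exp (M * \<tau>) = exp (- (x - M) * \<tau>)"
      by (simp add: exp_add[symmetric] algebra_simps)
    finally show ?thesis using True by simp
  qed (simp add: R_def)
  have [measurable]: "R \<in> borel_measurable borel" unfolding R_def[abs_def] by measurable
  have R_int: "integrable lborel R"
  proof (rule Bochner_Integration.integrable_bound[OF integrable.intros[OF I2]])
    show "AE \<tau> in lborel. norm (R \<tau>) \<le> norm (C * (indicator {0<..} \<tau> * (\<tau> powr (real p + 3 / 2 - 1) * exp (- (x - M) * \<tau>))))"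
      using order.trans[OF R_le abs_ge_self] unfolding real_norm_def by (rule AE_I2)
  qed simp
  have "norm (integral\<^sup>L lborel R) \<le> C * (Gamma (real p + 3 / 2) * (x - M) powr (- (real p + 3 / 2)))"
    unfolding has_bochner_integral_integral_eq[OF I2, symmetric]
    by (rule order.trans[OF integral_norm_bound integral_mono])
      (use R_int integrable.intros[OF I2] R_le in auto)
  also have "integral\<^sup>L lborel R =
     (LINT \<tau>|lborel. indicator {0<..} \<tau> * (\<tau> powr (- 1 / 2) * exp (- x * \<tau>) * F \<tau>)) -
     (\<Sum>k\<le>p. g k * (Gamma (real k + 1 / 2) * x powr (- (real k + 1 / 2))))"
  proof -
    have e: "indicator {0<..} \<tau> * (\<tau> powr (- 1 / 2) * exp (- x * \<tau>) * F \<tau>)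
      = R \<tau> + indicator {0<..} \<tau> * (\<tau> powr (- 1 / 2) * exp (- x * \<tau>) * S \<tau>)" for \<tau>
      by (simp add: R_def algebra_simps)
    show ?thesis
      unfolding e using R_int I1
      by (subst Bochner_Integration.integral_add) (auto simp: has_bochner_integral_iff)
  qed
  finally show ?thesis by (simp add: mult.assoc)
qed

section \<open>Taylor remainders bounded on the whole half-line\<close>

lemma fps_remainder_bound:
  fixes f :: "complex \<Rightarrow> complex"
  assumes f: "f has_fps_expansion G"
  obtains d C where "0 < d" "0 \<le> C"
    "\<And>z. z \<noteq> 0 \<Longrightarrow> norm z < d \<Longrightarrow> norm (f z - (\<Sum>k\<le>p. fps_nth G k * z ^ k)) \<le> C * norm z ^ (p + 1)"
proof -
  define q where "q = (\<Sum>k\<le>p. fps_const (fps_nth G k) * fps_X ^ k)"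
  define r where "r z = f z - (\<Sum>k\<le>p. fps_nth G k * z ^ k)" for z
  have q_nth: "fps_nth q j = (if j \<le> p then fps_nth G j else 0)" for j
    by (simp add: q_def fps_sum_nth fps_X_power_nth if_distrib cong: if_cong)
  have r: "r has_fps_expansion (G - q)"
    unfolding r_def[abs_def] q_def by (intro fps_expansion_intros f)
  have s: "p + 1 \<le> subdegree (G - q)" if "G - q \<noteq> 0"
    using that by (intro subdegree_geI) (auto simp: q_nth)
  show ?thesis
  proof (cases "G - q = 0")
    \<comment> \<open>The zero series is treated apart because its \<open>subdegree\<close> is 0 and
      not at least p + 1.\<close>
    case True
    then have "eventually (\<lambda>z. r z = 0) (nhds 0)"
      using r has_fps_expansion_0_iff[of r] by simp
    then obtain d where "0 < d" "\<And>z. norm z < d \<Longrightarrow> r z = 0"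
      by (auto simp: eventually_nhds_metric)
    then show ?thesis by (intro that[of d 0]) (auto simp: r_def)
  next
    case False
    \<comment> \<open>The remainder divided by z^(p+1) has the shifted series as its expansion,
      hence is continuous at 0 and bounded near it.\<close>
    define h where "h = (\<lambda>z. if z = 0 then fps_nth (G - q) (p + 1) else r z / z ^ (p + 1))"
    have "h has_fps_expansion fps_shift (p + 1) (G - q)"
      unfolding h_def by (rule has_fps_expansion_shift[OF r s[OF False] refl])
    then have "isCont h 0" using has_fps_expansion_imp_continuous continuous_at by blast
    then have "((\<lambda>z. norm (h z)) \<longlongrightarrow> norm (h 0)) (nhds 0)"
      by (intro tendsto_norm) (simp add: continuous_at tendsto_at_iff_tendsto_nhds)
    then have "eventually (\<lambda>z. norm (h z) < norm (h 0) + 1) (nhds 0)"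
      by (rule order_tendstoD) simp
    then obtain d where d: "0 < d" "\<And>z. norm z < d \<Longrightarrow> norm (h z) < norm (h 0) + 1"
      by (auto simp: eventually_nhds_metric)
    show ?thesis
    proof (rule that[of d "norm (h 0) + 1"])
      fix z :: complex assume z: "z \<noteq> 0" "norm z < d"
      have "norm (r z) = norm (h z) * norm z ^ (p + 1)"
        using z by (simp add: h_def norm_divide norm_power norm_mult)
      also have "\<dots> \<le> (norm (h 0) + 1) * norm z ^ (p + 1)"
        using d(2)[OF z(2)] by (intro mult_right_mono) auto
      finally show "norm (f z - (\<Sum>k\<le>p. fps_nth G k * z ^ k)) \<le> (norm (h 0) + 1) * norm z ^ (p + 1)"
        by (simp add: r_def)
    qed (use d in auto)
  qed
qed

text \<open>Near 0 the bound is the Taylor remainder of the complex extension f. For \<tau> \<ge> d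
  each power \<tau>^j with j \<le> p + 1 is at most \<tau>^(p+1) / d^(p+1-j), which absorbs the
  polynomial and, because of the factor \<tau> in \<open>far\<close>, also F itself. The
  coefficients g come from one power series, so they do not change with p.\<close>

lemma expansion_bound_global:
  fixes F :: "real \<Rightarrow> real" and f :: "complex \<Rightarrow> complex"
  assumes f: "f analytic_on {0}" and fF: "\<And>\<tau>. 0 < \<tau> \<Longrightarrow> f (of_real \<tau>) = of_real (F \<tau>)"
    and M: "0 \<le> M"
    and far: "\<And>d. 0 < d \<Longrightarrow> \<exists>B. \<forall>\<tau>\<ge>d. \<bar>F \<tau>\<bar> \<le> B * \<tau> * exp (M * \<tau>)"
  shows "\<exists>g. g 0 = Re (f 0) \<and>
    (\<forall>p. \<exists>C. \<forall>\<tau>>0. \<bar>F \<tau> - (\<Sum>k\<le>p. g k * \<tau> ^ k)\<bar> \<le> C * \<tau> ^ (p + 1) * exp (M * \<tau>))"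
proof -
  define G where "G = fps_expansion f 0"
  have G: "f has_fps_expansion G"
    unfolding G_def by (rule analytic_at_imp_has_fps_expansion_0[OF f])
  define g where "g k = Re (fps_nth G k)" for k
  have "\<exists>C. \<forall>\<tau>>0. \<bar>F \<tau> - (\<Sum>k\<le>p. g k * \<tau> ^ k)\<bar> \<le> C * \<tau> ^ (p + 1) * exp (M * \<tau>)" for p
  proof -
    obtain d C where d: "0 < d" "0 \<le> C"
      "\<And>z. z \<noteq> 0 \<Longrightarrow> norm z < d \<Longrightarrow> norm (f z - (\<Sum>k\<le>p. fps_nth G k * z ^ k)) \<le> C * norm z ^ (p + 1)"
      using fps_remainder_bound[OF G] by blast
    obtain B where B: "\<And>\<tau>. d \<le> \<tau> \<Longrightarrow> \<bar>F \<tau>\<bar> \<le> B * \<tau> * exp (M * \<tau>)" using far[OF d(1)] by blast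
    have B0: "0 \<le> B"
    proof -
      have "0 \<le> B * (d * exp (M * d))" using B[of d] abs_ge_zero[of "F d"] by (simp add: mult.assoc)
      then show ?thesis using d(1) mult_pos_pos[OF d(1) exp_gt_zero[of "M * d"]] by (simp add: zero_le_mult_iff del: mult_pos_pos)
    qed
    define E where "E = B / d ^ p + (\<Sum>k\<le>p. \<bar>g k\<bar> / d ^ (p + 1 - k))"
    have E0: "0 \<le> E" using B0 d(1) by (auto simp: E_def intro!: add_nonneg_nonneg sum_nonneg divide_nonneg_nonneg)
    have "\<bar>F \<tau> - (\<Sum>k\<le>p. g k * \<tau> ^ k)\<bar> \<le> (C + E) * \<tau> ^ (p + 1) * exp (M * \<tau>)" if t: "0 < \<tau>" for \<tau>
    proof (cases "\<tau> < d")
      case True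
      have "F \<tau> - (\<Sum>k\<le>p. g k * \<tau> ^ k) = Re (f (of_real \<tau>) - (\<Sum>k\<le>p. fps_nth G k * of_real \<tau> ^ k))"
        by (simp add: fF[OF t] g_def of_real_power[symmetric] del: of_real_power)
      also have "\<bar>\<dots>\<bar> \<le> norm (f (of_real \<tau>) - (\<Sum>k\<le>p. fps_nth G k * of_real \<tau> ^ k))"
        by (rule abs_Re_le_cmod)
      also have "\<dots> \<le> C * \<tau> ^ (p + 1)" using d(3)[of "of_real \<tau>"] True t by simp
      also have "\<dots> \<le> (C + E) * \<tau> ^ (p + 1) * 1" using E0 t by (simp add: mult_right_mono)
      also have "\<dots> \<le> (C + E) * \<tau> ^ (p + 1) * exp (M * \<tau>)"
        using E0 d(2) t M by (intro mult_left_mono) auto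
      finally show ?thesis .
    next
      case False
      have p1: "\<tau> ^ j \<le> \<tau> ^ (p + 1) / d ^ (p + 1 - j)" if "j \<le> p + 1" for j
      proof -
        have "\<tau> ^ j * d ^ (p + 1 - j) \<le> \<tau> ^ j * \<tau> ^ (p + 1 - j)"
          using False t d(1) by (intro mult_left_mono power_mono) auto
        also have "\<dots> = \<tau> ^ (p + 1)" using that by (simp add: power_add[symmetric])
        finally show ?thesis using d(1) by (simp add: field_simps)
      qed
      have e1: "1 \<le> exp (M * \<tau>)" using M t by simp
      have "\<bar>F \<tau> - (\<Sum>k\<le>p. g k * \<tau> ^ k)\<bar> \<le> \<bar>F \<tau>\<bar> + (\<Sum>k\<le>p. \<bar>g k * \<tau> ^ k\<bar>)"
        using sum_abs[of "\<lambda>k. g k * \<tau> ^ k" "{..p}"] by linarith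
      also have "\<bar>F \<tau>\<bar> \<le> B * \<tau> ^ 1 * exp (M * \<tau>)" using B[of \<tau>] False by simp
      also have "\<dots> \<le> B * (\<tau> ^ (p + 1) / d ^ p) * exp (M * \<tau>)"
        using p1[of 1] B0 by (intro mult_right_mono mult_left_mono) auto
      also have "(\<Sum>k\<le>p. \<bar>g k * \<tau> ^ k\<bar>) \<le> (\<Sum>k\<le>p. \<bar>g k\<bar> / d ^ (p + 1 - k) * \<tau> ^ (p + 1) * exp (M * \<tau>))"
      proof (rule sum_mono)
        fix k assume "k \<in> {..p}"
        then have "\<bar>g k * \<tau> ^ k\<bar> \<le> \<bar>g k\<bar> * (\<tau> ^ (p + 1) / d ^ (p + 1 - k))"
          using t mult_left_mono[OF p1[of k], of "\<bar>g k\<bar>"] by (auto simp: abs_mult)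
        also have "\<dots> \<le> \<bar>g k\<bar> * (\<tau> ^ (p + 1) / d ^ (p + 1 - k)) * exp (M * \<tau>)"
          using mult_left_mono[OF e1, of "\<bar>g k\<bar> * (\<tau> ^ (p + 1) / d ^ (p + 1 - k))"] t d(1) by simp
        finally show "\<bar>g k * \<tau> ^ k\<bar> \<le> \<bar>g k\<bar> / d ^ (p + 1 - k) * \<tau> ^ (p + 1) * exp (M * \<tau>)" by simp
      qed
      also have "B * (\<tau> ^ (p + 1) / d ^ p) * exp (M * \<tau>) +
          (\<Sum>k\<le>p. \<bar>g k\<bar> / d ^ (p + 1 - k) * \<tau> ^ (p + 1) * exp (M * \<tau>)) = E * \<tau> ^ (p + 1) * exp (M * \<tau>)"
        by (simp add: E_def distrib_right sum_distrib_right)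
      also have "\<dots> \<le> (C + E) * \<tau> ^ (p + 1) * exp (M * \<tau>)"
        using d(2) t by (intro mult_right_mono) auto
      finally show ?thesis by simp
    qed
    then show ?thesis by blast
  qed
  moreover have "g 0 = Re (f 0)"
    using has_fps_expansion_imp_0_eq_fps_nth_0[OF G] by (simp add: g_def)
  ultimately show ?thesis by blast
qed

text \<open>Needed because u - u0 = u0 (exp \<tau> - 1) for u = u0 exp \<tau>: dividing by \<tau>
  removes the zero at \<tau> = 0.\<close>

lemma exp_minus_one_quotient_analytic:
  "(\<lambda>z::complex. if z = 0 then 1 else (exp z - 1) / z) analytic_on {0}"
proof -
  have e: "(\<lambda>z::complex. exp z - 1) has_fps_expansion (fps_exp 1 - 1)"
    by (intro fps_expansion_intros)
  have "subdegree (fps_exp 1 - 1 :: complex fps) = 1"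
    by (intro subdegreeI) auto
  then have "(\<lambda>z::complex. if z = 0 then 1 else (exp z - 1) / z ^ 1) has_fps_expansion fps_shift 1 (fps_exp 1 - 1)"
    by (intro has_fps_expansion_shift[OF e]) auto
  from has_fps_expansion_imp_analytic_0[OF this] show ?thesis unfolding power_one_right .
qed

text \<open>For the parameters of the locale \<open>corr_level\<close> this is the derivative in u
  of the angle of the arc cut out of the circle with centre u. It is defined here because the
  expansion only uses its algebraic form.\<close>

definition angle_deriv :: "real \<Rightarrow> real \<Rightarrow> real \<Rightarrow> real \<Rightarrow> real \<Rightarrow> real" where
  "angle_deriv a b u0 u1 u = (a * u - b) / ((u\<^sup>2 - 1) * sqrt ((u - u0) * (u + u1)))"

text \<open>With u = u0 exp \<tau> the factor u0 exp \<tau> is du/d\<tau>, and sqrt \<tau> cancels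
  the inverse square root singularity at u0, leaving an analytic function. The factor exp(2 \<tau>)
  is there because the tail formula has the exponent n - 2 while the expansion is in powers of
  n.\<close>

lemma angle_deriv_expansion:
  fixes a b u0 u1 :: real
  assumes a: "0 < a" "0 \<le> b" "b < a * u0" and u: "1 < u0" "0 < u1"
  defines "F \<equiv> \<lambda>\<tau>. exp (2 * \<tau>) * (sqrt \<tau> * (u0 * exp \<tau> * angle_deriv a b u0 u1 (u0 * exp \<tau>)))"
  shows "\<exists>g. g 0 = u0 * (a * u0 - b) / ((u0\<^sup>2 - 1) * sqrt (u0 * (u0 + u1))) \<and>
    (\<forall>p. \<exists>C. \<forall>\<tau>>0. \<bar>F \<tau> - (\<Sum>k\<le>p. g k * \<tau> ^ k)\<bar> \<le> C * \<tau> ^ (p + 1) * exp (2 * \<tau>))"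
proof -
  define e where "e = (\<lambda>z::complex. if z = 0 then 1 else (exp z - 1) / z)"
  define U where "U z = of_real u0 * exp z" for z :: complex
  \<comment> \<open>At z = 0 the argument of the root is u0 (u0 + u1) > 0, so the principal branch
    is analytic there.\<close>
  define f where "f z = exp (2 * z) * (U z * ((of_real a * U z - of_real b) /
     (((U z)\<^sup>2 - 1) * csqrt (of_real u0 * e z * (U z + of_real u1)))))" for z
  have e_an: "e analytic_on {0}" unfolding e_def by (rule exp_minus_one_quotient_analytic)
  have e0: "e 0 = 1" by (simp add: e_def)
  have U0: "U 0 = of_real u0" by (simp add: U_def)
  have sq: "1 < u0\<^sup>2" using u by simp
  have f0: "f 0 = of_real (u0 * (a * u0 - b) / ((u0\<^sup>2 - 1) * sqrt (u0 * (u0 + u1))))"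
  proof -
    have "csqrt (of_real u0 * (of_real u0 + of_real u1)) = of_real (sqrt (u0 * (u0 + u1)))"
      using u csqrt_of_real_nonneg[of "u0 * (u0 + u1)"] by simp
    then show ?thesis by (simp add: f_def U0 e0)
  qed
  have f_an: "f analytic_on {0}"
    unfolding f_def[abs_def] U_def[abs_def]
  proof (intro analytic_intros e_an)
    fix z :: complex assume "z \<in> {0}"
    then have z: "z = 0" by simp
    have "complex_of_real u0 * e z * (complex_of_real u0 * exp z + complex_of_real u1) = of_real (u0 * (u0 + u1))"
      by (simp add: z e0)
    moreover have "0 < u0 * (u0 + u1)" using u by simp
    ultimately show *: "complex_of_real u0 * e z * (complex_of_real u0 * exp z + complex_of_real u1) \<notin> \<real>\<^sub>\<le>\<^sub>0"
      by (simp del: of_real_mult of_real_add add: complex_nonpos_Reals_iff)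
    show "((complex_of_real u0 * exp z)\<^sup>2 - 1) * csqrt (complex_of_real u0 * e z * (complex_of_real u0 * exp z + complex_of_real u1)) \<noteq> 0"
    proof -
      have "(complex_of_real u0)\<^sup>2 \<noteq> 1"
        using sq by (metis less_irrefl of_real_eq_1_iff of_real_power)
      then show ?thesis using * by (auto simp: z)
    qed
  qed
  have "f (of_real \<tau>) = of_real (F \<tau>)" if t: "0 < \<tau>" for \<tau>
  proof -
    define v where "v = u0 * exp \<tau>"
    have v: "u0 < v" using t u by (simp add: v_def)
    have E: "e (of_real \<tau>) = of_real ((exp \<tau> - 1) / \<tau>)" using t by (simp add: e_def exp_of_real)
    have Uv: "U (of_real \<tau>) = of_real v" by (simp add: U_def v_def exp_of_real)
    have "u0 * ((exp \<tau> - 1) / \<tau>) * (v + u1) = (v - u0) * (v + u1) / \<tau>"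
      by (simp add: v_def algebra_simps)
    then have "csqrt (of_real u0 * e (of_real \<tau>) * (U (of_real \<tau>) + of_real u1)) = csqrt (of_real ((v - u0) * (v + u1) / \<tau>))"
      by (simp only: E Uv of_real_mult[symmetric] of_real_add[symmetric])
    also have "\<dots> = of_real (sqrt ((v - u0) * (v + u1) / \<tau>))"
      using v u t by (subst csqrt_of_real_nonneg) auto
    finally have "f (of_real \<tau>) = of_real (exp (2 * \<tau>) * (v * ((a * v - b) / ((v\<^sup>2 - 1) * sqrt ((v - u0) * (v + u1) / \<tau>)))))"
      by (simp add: f_def Uv exp_of_real[symmetric])
    also have "exp (2 * \<tau>) * (v * ((a * v - b) / ((v\<^sup>2 - 1) * sqrt ((v - u0) * (v + u1) / \<tau>)))) = F \<tau>"
      using t by (simp add: F_def v_def[symmetric] angle_deriv_def real_sqrt_divide)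
    finally show ?thesis .
  qed
  \<comment> \<open>Away from u0 the product of u and \<open>angle_deriv\<close> is bounded, since
    u^2 / (u^2 - 1) decreases and the root increases; the remaining sqrt \<tau> is at most \<tau> /
    sqrt d.\<close>
  moreover have "\<exists>B. \<forall>\<tau>\<ge>d. \<bar>F \<tau>\<bar> \<le> B * \<tau> * exp (2 * \<tau>)" if d: "0 < d" for d
  proof -
    define w where "w = u0 * exp d"
    have w: "u0 < w" using d u by (simp add: w_def)
    have w2: "1 < w\<^sup>2" using w u by simp
    define s where "s = sqrt ((w - u0) * (w + u1))"
    have s: "0 < s" using w u by (simp add: s_def)
    define K where "K = a * (w\<^sup>2 / (w\<^sup>2 - 1)) / s"
    have "\<bar>F \<tau>\<bar> \<le> K / sqrt d * \<tau> * exp (2 * \<tau>)" if t: "d \<le> \<tau>" for \<tau>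
    proof -
      define v where "v = u0 * exp \<tau>"
      have v: "w \<le> v" using t u by (simp add: v_def w_def)
      have v1: "1 < v" "0 < v" using v w u by auto
      have v2: "w\<^sup>2 \<le> v\<^sup>2" using v w u by (intro power_mono) auto
      have sv: "s \<le> sqrt ((v - u0) * (v + u1))"
        unfolding s_def using v w u by (intro real_sqrt_le_mono mult_mono) auto
      have ab: "0 \<le> a * v - b" "a * v - b \<le> a * v"
      proof -
        have "a * u0 \<le> a * v" using v w a by (intro mult_left_mono) auto
        then show "0 \<le> a * v - b" "a * v - b \<le> a * v" using a by linarith+
      qed
      have "v * angle_deriv a b u0 u1 v \<le> v * (a * v) / ((v\<^sup>2 - 1) * s)"
        unfolding angle_deriv_def times_divide_eq_right
        using ab v1 v2 w2 sv s a by (intro frac_le mult_left_mono mult_nonneg_nonneg mult_pos_pos) auto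
      also have "\<dots> = a * (v\<^sup>2 / (v\<^sup>2 - 1)) / s" by (simp add: power2_eq_square)
      also have "\<dots> \<le> K"
      proof -
        have "v\<^sup>2 * (w\<^sup>2 - 1) \<le> w\<^sup>2 * (v\<^sup>2 - 1)" using v2 by (simp add: algebra_simps)
        then have "v\<^sup>2 / (v\<^sup>2 - 1) \<le> w\<^sup>2 / (w\<^sup>2 - 1)" using v2 w2 by (simp add: divide_simps mult.commute)
        then show ?thesis unfolding K_def using a s by (intro divide_right_mono mult_left_mono) auto
      qed
      finally have 1: "v * angle_deriv a b u0 u1 v \<le> K" .
      have 0: "0 \<le> v * angle_deriv a b u0 u1 v"
        using ab v1 v2 w2 v w u by (auto simp: angle_deriv_def intro!: mult_nonneg_nonneg divide_nonneg_nonneg)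
      have K0: "0 \<le> K" using 0 1 by linarith
      have "sqrt \<tau> = \<tau> / sqrt \<tau>" using t d by (simp add: real_div_sqrt)
      also have "\<dots> \<le> \<tau> / sqrt d" using t d by (intro divide_left_mono) auto
      finally have 2: "sqrt \<tau> \<le> \<tau> / sqrt d" .
      have "\<bar>F \<tau>\<bar> = exp (2 * \<tau>) * (sqrt \<tau> * (v * angle_deriv a b u0 u1 v))"
        unfolding F_def v_def[symmetric] using t d by (intro abs_of_nonneg mult_nonneg_nonneg[OF exp_ge_zero] mult_nonneg_nonneg[OF _ 0]) auto
      also have "\<dots> \<le> exp (2 * \<tau>) * (\<tau> / sqrt d * K)"
        using 0 1 2 t d by (intro mult_left_mono mult_mono) auto
      finally show ?thesis by (simp add: mult_ac)
    qed
    then show ?thesis by blast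
  qed
  ultimately have "\<exists>g. g 0 = Re (f 0) \<and>
    (\<forall>p. \<exists>C. \<forall>\<tau>>0. \<bar>F \<tau> - (\<Sum>k\<le>p. g k * \<tau> ^ k)\<bar> \<le> C * \<tau> ^ (p + 1) * exp (2 * \<tau>))"
    by (intro expansion_bound_global[OF f_an]) auto
  then show ?thesis by (simp add: f0)
qed

section \<open>A planar integral in polar coordinates\<close>

lemma nn_integral_indicator_SUP:
  fixes f :: "real \<Rightarrow> ennreal"
  assumes [measurable]: "f \<in> borel_measurable borel" "\<And>n. A n \<in> sets borel" and A: "incseq A"
  shows "(\<integral>\<^sup>+x. f x * indicator (\<Union>n. A n) x \<partial>lborel) = (SUP n. \<integral>\<^sup>+x. f x * indicator (A n) x \<partial>lborel)"
  using SUP_emeasure_incseq[of A "density lborel f", OF _ A]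
  by (simp add: emeasure_density image_subset_iff)

lemma ennreal_mult_indicator_right: "ennreal (c * indicator A x) = ennreal c * indicator A x"
  by (simp add: indicator_def)

text \<open>The half-line is exhausted by compact intervals; the rule for intervals passes to the
  limit by monotone convergence, and \<open>lim\<close> makes the images exhaust the target.\<close>

lemma nn_integral_substitution_atLeast:
  fixes f g g' :: "real \<Rightarrow> real"
  assumes f[measurable]: "f \<in> borel_measurable borel"
    and g: "\<And>x. a \<le> x \<Longrightarrow> (g has_real_derivative g' x) (at x)"
    and g'[measurable]: "g' \<in> borel_measurable borel" "g \<in> borel_measurable borel"
    and cont: "continuous_on {a..} g'" and nonneg: "\<And>x. a \<le> x \<Longrightarrow> 0 \<le> g' x"
    and lim: "filterlim g at_top at_top"
  shows "(\<integral>\<^sup>+x. ennreal (f x) * indicator {g a..} x \<partial>lborel) =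
    (\<integral>\<^sup>+x. ennreal (f (g x) * g' x) * indicator {a..} x \<partial>lborel)"
proof -
  have mono: "g x \<le> g y" if "a \<le> x" "x \<le> y" for x y
    using that g nonneg by (intro DERIV_nonneg_imp_nondecreasing[OF that(2)]) (metis order.trans)
  have U1: "(\<Union>n. {a..a + real n}) = {a..}"
    by (auto, metis add.commute diff_le_eq less_imp_le reals_Archimedean2)
  have U2: "(\<Union>n. {g a..g (a + real n)}) = {g a..}"
  proof (intro equalityI subsetI)
    fix y assume y: "y \<in> {g a..}"
    obtain X where X: "\<And>x. X \<le> x \<Longrightarrow> y \<le> g x"
      using lim by (auto simp: filterlim_at_top eventually_at_top_linorder)
    obtain n :: nat where "X - a < real n" using reals_Archimedean2 by blast
    then show "y \<in> (\<Union>n. {g a..g (a + real n)})" using X[of "a + real n"] y by auto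
  qed auto
  have "(\<integral>\<^sup>+x. ennreal (f x) * indicator (\<Union>n. {g a..g (a + real n)}) x \<partial>lborel)
     = (SUP n. \<integral>\<^sup>+x. ennreal (f x) * indicator {g a..g (a + real n)} x \<partial>lborel)"
    by (rule nn_integral_indicator_SUP) (auto simp: incseq_def intro: order.trans mono)
  also have "\<dots> = (SUP n. \<integral>\<^sup>+x. ennreal (f (g x) * g' x) * indicator {a..a + real n} x \<partial>lborel)"
  proof (rule SUP_cong[OF refl])
    fix n :: nat
    have "(\<integral>\<^sup>+x. ennreal (f x * indicator {g a..g (a + real n)} x) \<partial>lborel)
      = (\<integral>\<^sup>+x. ennreal (f (g x) * g' x * indicator {a..a + real n} x) \<partial>lborel)"
      by (rule nn_integral_substitution)
        (auto simp: set_borel_measurable_def intro: g nonneg continuous_on_subset[OF cont])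
    then show "(\<integral>\<^sup>+x. ennreal (f x) * indicator {g a..g (a + real n)} x \<partial>lborel)
      = (\<integral>\<^sup>+x. ennreal (f (g x) * g' x) * indicator {a..a + real n} x \<partial>lborel)"
      unfolding ennreal_mult_indicator_right .
  qed
  also have "\<dots> = (\<integral>\<^sup>+x. ennreal (f (g x) * g' x) * indicator (\<Union>n. {a..a + real n}) x \<partial>lborel)"
    by (rule nn_integral_indicator_SUP[symmetric]) (auto simp: incseq_def)
  finally show ?thesis unfolding U1 U2 .
qed

lemma nn_integral_even:
  fixes f :: "real \<Rightarrow> ennreal"
  assumes [measurable]: "f \<in> borel_measurable borel" and even: "\<And>x. f (- x) = f x"
  shows "(\<integral>\<^sup>+x. f x \<partial>lborel) = 2 * (\<integral>\<^sup>+x. f x * indicator {0..} x \<partial>lborel)"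
proof -
  have "(\<integral>\<^sup>+x. f x \<partial>lborel) = (\<integral>\<^sup>+x. f x * indicator {0..} x + f x * indicator {..<0} x \<partial>lborel)"
    by (intro nn_integral_cong) (auto simp: indicator_def)
  also have "\<dots> = (\<integral>\<^sup>+x. f x * indicator {0..} x \<partial>lborel) + (\<integral>\<^sup>+x. f x * indicator {..<0} x \<partial>lborel)"
    by (rule nn_integral_add) auto
  also have "(\<integral>\<^sup>+x. f x * indicator {..<0} x \<partial>lborel) = (\<integral>\<^sup>+x. f x * indicator {..0} x \<partial>lborel)"
    by (intro nn_integral_cong_AE) (use AE_lborel_singleton[of 0] in \<open>auto simp: indicator_def elim!: eventually_mono\<close>)
  also have "\<dots> = ennreal \<bar>- 1\<bar> * (\<integral>\<^sup>+x. f (0 + (- 1) * x) * indicator {..0} (0 + (- 1) * x) \<partial>lborel)"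
    by (rule nn_integral_real_affine) auto
  also have "\<dots> = (\<integral>\<^sup>+x. f x * indicator {0..} x \<partial>lborel)"
    by (auto simp: even indicator_def intro!: nn_integral_cong)
  finally show ?thesis by (simp add: mult_2)
qed

text \<open>At fixed v, put u = (1 + v^2 + x^2) / (2 v) on x \<ge> 0: then du = (x / v) dx and x =
  sqrt(2 u v - 1 - v^2). The two signs of x give the factor 2.\<close>

lemma nn_integral_horizontal:
  fixes k :: "real \<Rightarrow> real"
  assumes [measurable]: "k \<in> borel_measurable borel" and v: "0 < v"
  shows "(\<integral>\<^sup>+x. ennreal (k ((1 + v\<^sup>2 + x\<^sup>2) / (2 * v))) \<partial>lborel) =
    2 * (\<integral>\<^sup>+u. ennreal (k u * (v / sqrt (2 * u * v - 1 - v\<^sup>2))) * indicator {(1 + v\<^sup>2) / (2 * v)..} u \<partial>lborel)"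
proof -
  define g where "g x = (1 + v\<^sup>2 + x\<^sup>2) / (2 * v)" for x
  define f where "f u = k u * (v / sqrt (2 * u * v - 1 - v\<^sup>2))" for u
  have [measurable]: "f \<in> borel_measurable borel" "g \<in> borel_measurable borel"
    unfolding f_def[abs_def] g_def[abs_def] by measurable
  have "(\<integral>\<^sup>+u. ennreal (f u) * indicator {g 0..} u \<partial>lborel) =
      (\<integral>\<^sup>+x. ennreal (f (g x) * (x / v)) * indicator {0..} x \<partial>lborel)"
  proof (rule nn_integral_substitution_atLeast)
    show "(g has_real_derivative x / v) (at x)" for x
      unfolding g_def[abs_def] using v by (auto intro!: derivative_eq_intros simp: field_simps)
    show "filterlim g at_top at_top"
    proof (rule filterlim_at_top_mono)
      show "filterlim (\<lambda>x::real. x * (1 / (2 * v))) at_top at_top"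
        using v by (intro filterlim_at_top_mult_tendsto_pos[OF tendsto_const] filterlim_ident) auto
      show "\<forall>\<^sub>F x in at_top. x * (1 / (2 * v)) \<le> g x"
        using eventually_ge_at_top[of 1]
      proof eventually_elim
        case (elim x)
        have "x \<le> x\<^sup>2" using elim by (simp add: power2_eq_square)
        then have "x \<le> 1 + v\<^sup>2 + x\<^sup>2" using zero_le_power2[of v] by linarith
        then show ?case using v by (simp add: g_def divide_right_mono)
      qed
    qed
    show "continuous_on {0..} (\<lambda>x. x / v)" using v by (intro continuous_intros) auto
  qed (use v in auto)
  also have "\<dots> = (\<integral>\<^sup>+x. ennreal (k (g x)) * indicator {0..} x \<partial>lborel)"
  proof (intro nn_integral_cong_AE)
    show "AE x in lborel. ennreal (f (g x) * (x / v)) * indicator {0..} x = ennreal (k (g x)) * indicator {0..} x"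
      using AE_lborel_singleton[of 0]
    proof eventually_elim
      case (elim x)
      have "f (g x) * (x / v) = k (g x)" if "0 < x"
      proof -
        have "2 * g x * v - 1 - v\<^sup>2 = x\<^sup>2" using v by (simp add: g_def field_simps)
        then show ?thesis using that v by (simp add: f_def)
      qed
      then show ?case using elim by (auto simp: indicator_def)
    qed
  qed
  finally show ?thesis
    using nn_integral_even[of "\<lambda>x. ennreal (k (g x))"] by (simp add: g_def f_def)
qed

text \<open>At fixed u one has 2 u v - 1 - v^2 = R^2 - (v - u)^2 with R^2 = u^2 - 1, so v = u - R
  cos \<alpha> turns dv divided by the root into d\<alpha>.\<close>

lemma nn_integral_vertical:
  fixes h :: "real \<Rightarrow> real"
  assumes [measurable]: "h \<in> borel_measurable borel" and u: "1 < u"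
  shows "(\<integral>\<^sup>+v. ennreal (h v / sqrt (2 * u * v - 1 - v\<^sup>2)) * indicator {v. 0 < v \<and> 1 + v\<^sup>2 < 2 * u * v} v \<partial>lborel) =
    (\<integral>\<^sup>+\<alpha>. ennreal (h (u - sqrt (u\<^sup>2 - 1) * cos \<alpha>)) * indicator {0..pi} \<alpha> \<partial>lborel)"
proof -
  define R where "R = sqrt (u\<^sup>2 - 1)"
  have u2: "1 < u\<^sup>2" using u by simp
  have R: "0 < R" "R\<^sup>2 = u\<^sup>2 - 1" "R < u"
    using u2 u by (auto simp: R_def intro!: real_less_lsqrt)
  define f where "f v = h v / sqrt (2 * u * v - 1 - v\<^sup>2)" for v
  define g where "g \<alpha> = u - R * cos \<alpha>" for \<alpha>
  have [measurable]: "f \<in> borel_measurable borel" "g \<in> borel_measurable borel"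
    unfolding f_def[abs_def] g_def[abs_def] by measurable
  have "(\<integral>\<^sup>+v. ennreal (f v * indicator {g 0..g pi} v) \<partial>lborel) =
      (\<integral>\<^sup>+\<alpha>. ennreal (f (g \<alpha>) * (R * sin \<alpha>) * indicator {0..pi} \<alpha>) \<partial>lborel)"
  proof (rule nn_integral_substitution)
    show "(g has_real_derivative R * sin \<alpha>) (at \<alpha>)" for \<alpha>
      unfolding g_def[abs_def] by (auto intro!: derivative_eq_intros)
  qed (use R in \<open>auto simp: set_borel_measurable_def sin_ge_zero intro!: continuous_intros\<close>)
  also have "\<dots> = (\<integral>\<^sup>+\<alpha>. ennreal (h (g \<alpha>)) * indicator {0..pi} \<alpha> \<partial>lborel)"
  proof (intro nn_integral_cong_AE)
    show "AE \<alpha> in lborel. ennreal (f (g \<alpha>) * (R * sin \<alpha>) * indicator {0..pi} \<alpha>) = ennreal (h (g \<alpha>)) * indicator {0..pi} \<alpha>"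
      using AE_lborel_singleton[of 0] AE_lborel_singleton[of pi]
    proof eventually_elim
      case (elim \<alpha>)
      have "f (g \<alpha>) * (R * sin \<alpha>) = h (g \<alpha>)" if a: "0 < \<alpha>" "\<alpha> < pi"
      proof -
        have "2 * u * g \<alpha> - 1 - (g \<alpha>)\<^sup>2 = u\<^sup>2 - 1 - R\<^sup>2 * (cos \<alpha>)\<^sup>2"
          by (simp add: g_def power2_eq_square algebra_simps)
        also have "\<dots> = (R * sin \<alpha>)\<^sup>2"
          unfolding power_mult_distrib sin_squared_eq R(2)[symmetric] by (simp add: algebra_simps)
        finally show ?thesis using a R sin_gt_zero[OF a] by (simp add: f_def)
      qed
      then show ?case using elim by (auto simp: indicator_def)
    qed
  qed
  also have "(\<integral>\<^sup>+v. ennreal (f v * indicator {g 0..g pi} v) \<partial>lborel) =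
     (\<integral>\<^sup>+v. ennreal (f v) * indicator {v. 0 < v \<and> 1 + v\<^sup>2 < 2 * u * v} v \<partial>lborel)"
  proof (intro nn_integral_cong)
    fix v :: real
    have eq: "2 * u * v - 1 - v\<^sup>2 = (v - (u - R)) * ((u + R) - v)"
      using R(2) by (simp add: power2_eq_square algebra_simps)
    consider "v = u - R \<or> v = u + R" | "v < u - R \<or> u + R < v" | "u - R < v" "v < u + R" by linarith
    then show "ennreal (f v * indicator {g 0..g pi} v) = ennreal (f v) * indicator {v. 0 < v \<and> 1 + v\<^sup>2 < 2 * u * v} v"
    proof cases
      \<comment> \<open>At the two end points the root is 0 and division by zero gives 0, so strict
        and weak inequalities describe the same integrand.\<close>
      case 1
      then have "f v = 0" by (auto simp: f_def eq)
      then show ?thesis by simp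
    next
      case 2
      then have "2 * u * v - 1 - v\<^sup>2 < 0" unfolding eq using R by (auto simp: mult_less_0_iff)
      then show ?thesis using 2 by (auto simp: g_def)
    next
      case 3
      then have "0 < 2 * u * v - 1 - v\<^sup>2" unfolding eq by simp
      then show ?thesis using 3 R by (auto simp: g_def)
    qed
  qed
  finally show ?thesis by (simp add: f_def g_def R_def)
qed

text \<open>The two substitutions are applied one variable at a time: x is replaced by u at fixed v,
  Tonelli exchanges v and u, and v is replaced by \<alpha> at fixed u. The weight is a power of 1/u
  = 2 v / (1 + v^2 + x^2).\<close>

lemma planar_integral:
  fixes B :: "(real \<times> real) set"
  assumes B[measurable]: "B \<in> sets (borel \<Otimes>\<^sub>M borel)"
  shows "(\<integral>\<^sup>+v. \<integral>\<^sup>+x. ennreal (indicator {0<..} v * ((2 * v / (1 + v\<^sup>2 + x\<^sup>2)) ^ m / v) *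
      indicator B ((1 + v\<^sup>2 + x\<^sup>2) / (2 * v), v)) \<partial>lborel \<partial>lborel) =
    2 * (\<integral>\<^sup>+u. \<integral>\<^sup>+\<alpha>. ennreal (indicator {1<..} u * (1 / u) ^ m * indicator B (u, u - sqrt (u\<^sup>2 - 1) * cos \<alpha>)) *
      indicator {0..pi} \<alpha> \<partial>lborel \<partial>lborel)"
proof -
  define h where "h u v = (1 / u) ^ m * (indicator B (u, v) :: real)" for u v :: real
  define D where "D = {p :: real \<times> real. 0 < snd p \<and> 1 + (snd p)\<^sup>2 < 2 * fst p * snd p}"
  have [measurable]: "D \<in> sets (borel \<Otimes>\<^sub>M borel)" 
  proof -
    have "D = {p \<in> space (borel \<Otimes>\<^sub>M borel). 0 < snd p \<and> 1 + (snd p)\<^sup>2 < 2 * fst p * snd p}"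
      by (simp add: D_def space_pair_measure)
    then show ?thesis by simp
  qed
  have h_m[measurable]: "(\<lambda>p. h (fst p) (snd p)) \<in> borel_measurable (borel \<Otimes>\<^sub>M borel)"
    unfolding h_def by measurable
  have [measurable]: "h u \<in> borel_measurable borel" for u unfolding h_def[abs_def] by measurable
  have [measurable]: "(\<lambda>u. h u v) \<in> borel_measurable borel" for v unfolding h_def[abs_def] by measurable
  have "(\<integral>\<^sup>+x. ennreal (indicator {0<..} v * ((2 * v / (1 + v\<^sup>2 + x\<^sup>2)) ^ m / v) *
      indicator B ((1 + v\<^sup>2 + x\<^sup>2) / (2 * v), v)) \<partial>lborel) =
    2 * (\<integral>\<^sup>+u. ennreal (h u v / sqrt (2 * u * v - 1 - v\<^sup>2)) * indicator D (u, v) \<partial>lborel)" for v :: real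
  proof (cases "0 < v")
    case True
    have "(\<integral>\<^sup>+x. ennreal (indicator {0<..} v * ((2 * v / (1 + v\<^sup>2 + x\<^sup>2)) ^ m / v) *
        indicator B ((1 + v\<^sup>2 + x\<^sup>2) / (2 * v), v)) \<partial>lborel) =
      (\<integral>\<^sup>+x. ennreal ((\<lambda>u. h u v / v) ((1 + v\<^sup>2 + x\<^sup>2) / (2 * v))) \<partial>lborel)"
      using True by (simp add: h_def)
    also have "\<dots> = 2 * (\<integral>\<^sup>+u. ennreal ((\<lambda>u. h u v / v) u * (v / sqrt (2 * u * v - 1 - v\<^sup>2))) *
        indicator {(1 + v\<^sup>2) / (2 * v)..} u \<partial>lborel)"
      by (rule nn_integral_horizontal) (use True in auto)
    also have "(\<integral>\<^sup>+u. ennreal ((\<lambda>u. h u v / v) u * (v / sqrt (2 * u * v - 1 - v\<^sup>2))) *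
        indicator {(1 + v\<^sup>2) / (2 * v)..} u \<partial>lborel) =
      (\<integral>\<^sup>+u. ennreal (h u v / sqrt (2 * u * v - 1 - v\<^sup>2)) * indicator D (u, v) \<partial>lborel)"
    proof (intro nn_integral_cong)
      fix u :: real
      consider "1 + v\<^sup>2 = 2 * u * v" | "1 + v\<^sup>2 < 2 * u * v" | "2 * u * v < 1 + v\<^sup>2" by linarith
      then show "ennreal ((\<lambda>u. h u v / v) u * (v / sqrt (2 * u * v - 1 - v\<^sup>2))) * indicator {(1 + v\<^sup>2) / (2 * v)..} u =
        ennreal (h u v / sqrt (2 * u * v - 1 - v\<^sup>2)) * indicator D (u, v)"
        using True by cases (auto simp: D_def indicator_def field_simps)
    qed
    finally show ?thesis .
  next
    case False
    then have "\<And>u. (u, v) \<notin> D" by (auto simp: D_def)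
    then show ?thesis using False by simp
  qed
  then have "(\<integral>\<^sup>+v. \<integral>\<^sup>+x. ennreal (indicator {0<..} v * ((2 * v / (1 + v\<^sup>2 + x\<^sup>2)) ^ m / v) *
      indicator B ((1 + v\<^sup>2 + x\<^sup>2) / (2 * v), v)) \<partial>lborel \<partial>lborel) =
    (\<integral>\<^sup>+v. 2 * (\<integral>\<^sup>+u. ennreal (h u v / sqrt (2 * u * v - 1 - v\<^sup>2)) * indicator D (u, v) \<partial>lborel) \<partial>lborel)"
    by simp
  also have "\<dots> = 2 * (\<integral>\<^sup>+v. \<integral>\<^sup>+u. ennreal (h u v / sqrt (2 * u * v - 1 - v\<^sup>2)) * indicator D (u, v) \<partial>lborel \<partial>lborel)"
    unfolding h_def by (rule nn_integral_cmult) measurable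
  also have "(\<integral>\<^sup>+v. \<integral>\<^sup>+u. ennreal (h u v / sqrt (2 * u * v - 1 - v\<^sup>2)) * indicator D (u, v) \<partial>lborel \<partial>lborel) =
    (\<integral>\<^sup>+u. \<integral>\<^sup>+v. ennreal (h u v / sqrt (2 * u * v - 1 - v\<^sup>2)) * indicator D (u, v) \<partial>lborel \<partial>lborel)"
    unfolding h_def by (rule lborel_pair.Fubini') measurable
  also have "\<dots> = (\<integral>\<^sup>+u. \<integral>\<^sup>+\<alpha>. ennreal (indicator {1<..} u * (1 / u) ^ m * indicator B (u, u - sqrt (u\<^sup>2 - 1) * cos \<alpha>)) *
      indicator {0..pi} \<alpha> \<partial>lborel \<partial>lborel)"
  proof (rule nn_integral_cong)
    fix u :: real
    show "(\<integral>\<^sup>+v. ennreal (h u v / sqrt (2 * u * v - 1 - v\<^sup>2)) * indicator D (u, v) \<partial>lborel) =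
      (\<integral>\<^sup>+\<alpha>. ennreal (indicator {1<..} u * (1 / u) ^ m * indicator B (u, u - sqrt (u\<^sup>2 - 1) * cos \<alpha>)) *
      indicator {0..pi} \<alpha> \<partial>lborel)"
    proof (cases "1 < u")
      case True
      have "indicator D (u, v) = (indicator {v. 0 < v \<and> 1 + v\<^sup>2 < 2 * u * v} v :: ennreal)" for v
        by (simp add: D_def indicator_def)
      then show ?thesis using nn_integral_vertical[of "h u" u] True by (simp add: h_def)
    next
      case False
      \<comment> \<open>From 1 + v^2 \<ge> 2 v, every point of the half-plane has u \<ge> 1.\<close>
      have "(u, v) \<notin> D" for v
      proof
        assume "(u, v) \<in> D"
        then have v: "0 < v" "1 + v\<^sup>2 < 2 * u * v" by (auto simp: D_def)
        have "u * v \<le> 1 * v" using v(1) False by (intro mult_right_mono) auto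
        moreover have "0 \<le> 1 + v\<^sup>2 - 2 * v" using zero_le_power2[of "v - 1"] by (simp add: power2_diff)
        ultimately show False using v(2) by simp
      qed
      then show ?thesis using False by simp
    qed
  qed
  finally show ?thesis .
qed

section \<open>Integrating out the radius\<close>

lemma nn_integral_scale:
  fixes f :: "real \<Rightarrow> ennreal"
  assumes [measurable]: "f \<in> borel_measurable borel" and c: "0 < c"
  shows "(\<integral>\<^sup>+x. f x \<partial>lborel) = ennreal c * (\<integral>\<^sup>+x. f (c * x) \<partial>lborel)"
  using nn_integral_real_affine[of f c 0] c by simp

lemma radial_integral:
  fixes q :: real
  assumes q: "0 < q"
  shows "(\<integral>\<^sup>+t. ennreal (indicator {0<..} t * (t ^ k * exp (- (t\<^sup>2 * q\<^sup>2) / 2))) \<partial>lborel) =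
    ennreal ((1 / q) ^ (k + 1)) * (\<integral>\<^sup>+t. ennreal (indicator {0<..} t * (t ^ k * exp (- t\<^sup>2 / 2))) \<partial>lborel)"
proof -
  have "(\<integral>\<^sup>+t. ennreal (indicator {0<..} t * (t ^ k * exp (- (t\<^sup>2 * q\<^sup>2) / 2))) \<partial>lborel) =
    ennreal (1 / q) * (\<integral>\<^sup>+t. ennreal (indicator {0<..} (1 / q * t) * ((1 / q * t) ^ k * exp (- ((1 / q * t)\<^sup>2 * q\<^sup>2) / 2))) \<partial>lborel)"
    by (rule nn_integral_scale) (use q in auto)
  also have "(\<integral>\<^sup>+t. ennreal (indicator {0<..} (1 / q * t) * ((1 / q * t) ^ k * exp (- ((1 / q * t)\<^sup>2 * q\<^sup>2) / 2))) \<partial>lborel)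
    = (\<integral>\<^sup>+t. ennreal ((1 / q) ^ k) * ennreal (indicator {0<..} t * (t ^ k * exp (- t\<^sup>2 / 2))) \<partial>lborel)"
    using q by (intro nn_integral_cong) (auto simp: indicator_def ennreal_mult'[symmetric] power_divide zero_less_divide_iff)
  also have "\<dots> = ennreal ((1 / q) ^ k) * (\<integral>\<^sup>+t. ennreal (indicator {0<..} t * (t ^ k * exp (- t\<^sup>2 / 2))) \<partial>lborel)"
    by (rule nn_integral_cmult) auto
  finally show ?thesis using q by (simp add: mult.assoc[symmetric] ennreal_mult'[symmetric])
qed

text \<open>In the integral over \<open>s\<close> (of law \<open>chi\<close> with \<open>N + 1\<close> degrees of freedom), \<open>t\<close> (\<open>chi\<close> with \<open>N\<close>
  degrees of freedom) and \<open>z\<close> (normal), the radius is integrated out, which leaves the plane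
  coordinates \<open>v = s / t\<close> and \<open>x = z / t\<close>.\<close>

lemma homogeneous_integral:
  fixes B :: "(real \<times> real) set"
  assumes B[measurable]: "B \<in> sets (borel \<Otimes>\<^sub>M borel)" and N: "0 < N"
  shows "(\<integral>\<^sup>+t. \<integral>\<^sup>+s. \<integral>\<^sup>+z. ennreal (indicator {0<..} t * (t ^ (N - 1) * exp (- t\<^sup>2 / 2))) *
      (ennreal (indicator {0<..} s * (s ^ N * exp (- s\<^sup>2 / 2))) *
      (ennreal (exp (- z\<^sup>2 / 2)) * indicator B ((s\<^sup>2 + z\<^sup>2 + t\<^sup>2) / (2 * s * t), s / t))) \<partial>lborel \<partial>lborel \<partial>lborel) =
    (\<integral>\<^sup>+t. ennreal (indicator {0<..} t * (t ^ (2 * N + 1) * exp (- t\<^sup>2 / 2))) \<partial>lborel) * ennreal ((1 / 2) ^ N) *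
    (\<integral>\<^sup>+u. \<integral>\<^sup>+\<alpha>. ennreal (indicator {1<..} u * (1 / u) ^ (N + 1) * indicator B (u, u - sqrt (u\<^sup>2 - 1) * cos \<alpha>)) *
      indicator {0..pi} \<alpha> \<partial>lborel \<partial>lborel)" (is "?L = ?C * _ * ?J")
proof -
  define b where "b v x = (indicator B ((1 + v\<^sup>2 + x\<^sup>2) / (2 * v), v) :: real)" for v x :: real
  have b_m[measurable]: "(\<lambda>p. b (fst p) (snd p)) \<in> borel_measurable (borel \<Otimes>\<^sub>M borel)"
    unfolding b_def by measurable
  have "?L = (\<integral>\<^sup>+t. \<integral>\<^sup>+v. \<integral>\<^sup>+x. ennreal (indicator {0<..} v * (v ^ N * b v x)) *
      ennreal (indicator {0<..} t * (t ^ (2 * N + 1) * exp (- (t\<^sup>2 * (1 + v\<^sup>2 + x\<^sup>2)) / 2))) \<partial>lborel \<partial>lborel \<partial>lborel)"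
  proof (rule nn_integral_cong)
    fix t :: real
    define w where "w s z = ennreal (indicator {0<..} t * (t ^ (N - 1) * exp (- t\<^sup>2 / 2))) *
      (ennreal (indicator {0<..} s * (s ^ N * exp (- s\<^sup>2 / 2))) *
      (ennreal (exp (- z\<^sup>2 / 2)) * indicator B ((s\<^sup>2 + z\<^sup>2 + t\<^sup>2) / (2 * s * t), s / t)))" for s z :: real
    show "(\<integral>\<^sup>+s. \<integral>\<^sup>+z. w s z \<partial>lborel \<partial>lborel) =
      (\<integral>\<^sup>+v. \<integral>\<^sup>+x. ennreal (indicator {0<..} v * (v ^ N * b v x)) *
      ennreal (indicator {0<..} t * (t ^ (2 * N + 1) * exp (- (t\<^sup>2 * (1 + v\<^sup>2 + x\<^sup>2)) / 2))) \<partial>lborel \<partial>lborel)"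
    proof (cases "0 < t")
      case t: True
      have "(\<integral>\<^sup>+s. \<integral>\<^sup>+z. w s z \<partial>lborel \<partial>lborel) = ennreal t * (\<integral>\<^sup>+v. \<integral>\<^sup>+z. w (t * v) z \<partial>lborel \<partial>lborel)"
        unfolding w_def by (rule nn_integral_scale[OF _ t]) measurable
      also have "\<dots> = ennreal t * (\<integral>\<^sup>+v. ennreal t * (\<integral>\<^sup>+x. w (t * v) (t * x) \<partial>lborel) \<partial>lborel)"
        unfolding w_def by (intro arg_cong2[where f = "(*)"] refl nn_integral_cong nn_integral_scale t) measurable
      also have "\<dots> = (\<integral>\<^sup>+v. \<integral>\<^sup>+x. ennreal t * (ennreal t * w (t * v) (t * x)) \<partial>lborel \<partial>lborel)"
        unfolding w_def by (simp add: nn_integral_cmult[symmetric])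
      also have "\<dots> = (\<integral>\<^sup>+v. \<integral>\<^sup>+x. ennreal (indicator {0<..} v * (v ^ N * b v x)) *
        ennreal (indicator {0<..} t * (t ^ (2 * N + 1) * exp (- (t\<^sup>2 * (1 + v\<^sup>2 + x\<^sup>2)) / 2))) \<partial>lborel \<partial>lborel)"
      proof (intro nn_integral_cong)
        fix v x :: real
        show "ennreal t * (ennreal t * w (t * v) (t * x)) = ennreal (indicator {0<..} v * (v ^ N * b v x)) *
          ennreal (indicator {0<..} t * (t ^ (2 * N + 1) * exp (- (t\<^sup>2 * (1 + v\<^sup>2 + x\<^sup>2)) / 2)))"
        proof (cases "0 < v")
          case v: True
          have i: "indicator B (((t * v)\<^sup>2 + (t * x)\<^sup>2 + t\<^sup>2) / (2 * (t * v) * t), t * v / t) = ennreal (b v x)"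
          proof -
            have "((t * v)\<^sup>2 + (t * x)\<^sup>2 + t\<^sup>2) / (2 * (t * v) * t) = (t\<^sup>2 * (1 + v\<^sup>2 + x\<^sup>2)) / (t\<^sup>2 * (2 * v))"
              by (simp add: power2_eq_square algebra_simps)
            also have "\<dots> = (1 + v\<^sup>2 + x\<^sup>2) / (2 * v)" using t by simp
            finally show ?thesis using t by (simp add: b_def indicator_def)
          qed
          have "t * (t * (t ^ (N - 1) * exp (- t\<^sup>2 / 2) * ((t * v) ^ N * exp (- (t * v)\<^sup>2 / 2) * (exp (- (t * x)\<^sup>2 / 2) * b v x))))
            = v ^ N * b v x * ((t * (t * (t ^ (N - 1) * t ^ N))) * (exp (- t\<^sup>2 / 2) * exp (- (t * v)\<^sup>2 / 2) * exp (- (t * x)\<^sup>2 / 2)))"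
            by (simp only: power_mult_distrib mult_ac)
          \<comment> \<open>The powers of t: N - 1 from the density of t, N from that of s, and one
            each from ds = t dv and dz = t dx.\<close>
          also have "t * (t * (t ^ (N - 1) * t ^ N)) = t ^ (2 * N + 1)"
            using N by (cases N) (simp_all add: power_add[symmetric] mult_2 flip: power_Suc)
          also have "exp (- t\<^sup>2 / 2) * exp (- (t * v)\<^sup>2 / 2) * exp (- (t * x)\<^sup>2 / 2) = exp (- (t\<^sup>2 * (1 + v\<^sup>2 + x\<^sup>2)) / 2)"
            by (simp add: exp_add[symmetric] power_mult_distrib algebra_simps add_divide_distrib diff_divide_distrib)
          finally show ?thesis
            unfolding w_def i using t v by (simp add: ennreal_mult'[symmetric] b_def)
        next
          case False
          then show ?thesis using t by (simp add: w_def zero_less_mult_iff)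
        qed
      qed
      finally show ?thesis .
    qed (simp add: w_def)
  qed
  also have "\<dots> = (\<integral>\<^sup>+v. \<integral>\<^sup>+t. \<integral>\<^sup>+x. ennreal (indicator {0<..} v * (v ^ N * b v x)) *
      ennreal (indicator {0<..} t * (t ^ (2 * N + 1) * exp (- (t\<^sup>2 * (1 + v\<^sup>2 + x\<^sup>2)) / 2))) \<partial>lborel \<partial>lborel \<partial>lborel)"
    unfolding b_def by (rule lborel_pair.Fubini') measurable
  also have "\<dots> = (\<integral>\<^sup>+v. \<integral>\<^sup>+x. \<integral>\<^sup>+t. ennreal (indicator {0<..} v * (v ^ N * b v x)) *
      ennreal (indicator {0<..} t * (t ^ (2 * N + 1) * exp (- (t\<^sup>2 * (1 + v\<^sup>2 + x\<^sup>2)) / 2))) \<partial>lborel \<partial>lborel \<partial>lborel)"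
    unfolding b_def by (intro nn_integral_cong lborel_pair.Fubini') measurable
  also have "\<dots> = (\<integral>\<^sup>+v. \<integral>\<^sup>+x. ?C * ennreal ((1 / 2) ^ (N + 1)) *
      ennreal (indicator {0<..} v * ((2 * v / (1 + v\<^sup>2 + x\<^sup>2)) ^ (N + 1) / v) *
      indicator B ((1 + v\<^sup>2 + x\<^sup>2) / (2 * v), v)) \<partial>lborel \<partial>lborel)"
  proof (intro nn_integral_cong)
    fix v x :: real
    define q where "q = sqrt (1 + v\<^sup>2 + x\<^sup>2)"
    have q2: "q\<^sup>2 = 1 + v\<^sup>2 + x\<^sup>2" and q0: "0 < q" by (auto simp: q_def add_nonneg_nonneg add_pos_nonneg)
    have em: "ennreal ((1 / 2) ^ (N + 1) * y) = ennreal ((1 / 2) ^ (N + 1)) * ennreal y" for y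
      by (rule ennreal_mult') simp
    have q_pow: "(1 / q) ^ (2 * N + 1 + 1) = (1 / (1 + v\<^sup>2 + x\<^sup>2)) ^ (N + 1)"
    proof -
      have "(1 / q) ^ (2 * (N + 1)) = ((1 / q)\<^sup>2) ^ (N + 1)" by (rule power_mult)
      then show ?thesis unfolding q2[symmetric] by (simp add: power_one_over)
    qed
    have "(\<integral>\<^sup>+t. ennreal (indicator {0<..} v * (v ^ N * b v x)) *
        ennreal (indicator {0<..} t * (t ^ (2 * N + 1) * exp (- (t\<^sup>2 * (1 + v\<^sup>2 + x\<^sup>2)) / 2))) \<partial>lborel)
      = ennreal (indicator {0<..} v * (v ^ N * b v x)) * (ennreal ((1 / (1 + v\<^sup>2 + x\<^sup>2)) ^ (N + 1)) * ?C)"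
      unfolding q2[symmetric] q_pow[unfolded q2[symmetric], symmetric] radial_integral[OF q0, symmetric]
      by (rule nn_integral_cmult) auto
    also have "\<dots> = ?C * ennreal (indicator {0<..} v * (v ^ N * b v x) * (1 / (1 + v\<^sup>2 + x\<^sup>2)) ^ (N + 1))"
      by (subst ennreal_mult) (auto simp: b_def mult_ac indicator_def)
    \<comment> \<open>One spare factor 1/v completes v^N to the power N + 1 of 1/u; this is the 1/v
      in \<open>planar_integral\<close>.\<close>
    also have "indicator {0<..} v * (v ^ N * b v x) * (1 / (1 + v\<^sup>2 + x\<^sup>2)) ^ (N + 1) =
      (1 / 2) ^ (N + 1) * (indicator {0<..} v * ((2 * v / (1 + v\<^sup>2 + x\<^sup>2)) ^ (N + 1) / v) *
        indicator B ((1 + v\<^sup>2 + x\<^sup>2) / (2 * v), v))"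
      by (cases "0 < v") (simp_all add: b_def power_divide power_mult_distrib)
    finally show "(\<integral>\<^sup>+t. ennreal (indicator {0<..} v * (v ^ N * b v x)) *
        ennreal (indicator {0<..} t * (t ^ (2 * N + 1) * exp (- (t\<^sup>2 * (1 + v\<^sup>2 + x\<^sup>2)) / 2))) \<partial>lborel)
      = ?C * ennreal ((1 / 2) ^ (N + 1)) * ennreal (indicator {0<..} v * ((2 * v / (1 + v\<^sup>2 + x\<^sup>2)) ^ (N + 1) / v) *
        indicator B ((1 + v\<^sup>2 + x\<^sup>2) / (2 * v), v))"
      by (simp only: em mult.assoc)
  qed
  also have "\<dots> = ?C * ennreal ((1 / 2) ^ (N + 1)) * (2 * ?J)"
  proof -
    define K where "K = ?C * ennreal ((1 / 2) ^ (N + 1))"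
    define F where "F v x = ennreal (indicator {0<..} v * ((2 * v / (1 + v\<^sup>2 + x\<^sup>2)) ^ (N + 1) / v) *
      indicator B ((1 + v\<^sup>2 + x\<^sup>2) / (2 * v), v))" for v x :: real
    have F[measurable]: "(\<lambda>p. F (fst p) (snd p)) \<in> borel_measurable (borel \<Otimes>\<^sub>M borel)"
      unfolding F_def by measurable
    have "(\<integral>\<^sup>+v. \<integral>\<^sup>+x. K * F v x \<partial>lborel \<partial>lborel) = (\<integral>\<^sup>+v. K * (\<integral>\<^sup>+x. F v x \<partial>lborel) \<partial>lborel)"
      unfolding F_def by (rule nn_integral_cong, rule nn_integral_cmult) measurable
    also have "\<dots> = K * (\<integral>\<^sup>+v. \<integral>\<^sup>+x. F v x \<partial>lborel \<partial>lborel)"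
      unfolding F_def by (rule nn_integral_cmult) measurable
    finally show ?thesis unfolding F_def K_def planar_integral[OF B, of "N + 1"] .
  qed
  also have "\<dots> = ?C * (ennreal ((1 / 2) ^ (N + 1)) * ennreal 2) * ?J" by (simp add: mult_ac)
  \<comment> \<open>The 2 is the factor from the two signs of x.\<close>
  also have "ennreal ((1 / 2) ^ (N + 1)) * ennreal 2 = ennreal ((1 / 2) ^ N)"
    by (subst ennreal_mult[symmetric]) auto
  finally show ?thesis .
qed

section \<open>The angle function\<close>

lemma nn_integral_power_tail:
  assumes w: "0 < w" and N: "0 < N"
  shows "(\<integral>\<^sup>+u. ennreal ((1 / u) ^ (N + 1)) * indicator {w..} u \<partial>lborel) = ennreal ((1 / w) ^ N / real N)"
proof -
  have "(\<integral>\<^sup>+u. ennreal ((1 / u) ^ (N + 1)) * indicator {w..} u \<partial>lborel) = 0 - (- ((1 / w) ^ N / real N))"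
  proof (rule nn_integral_FTC_atLeast)
    show "((\<lambda>u. - ((1 / u) ^ N / real N)) has_real_derivative (1 / u) ^ (N + 1)) (at u)" if "w \<le> u" for u
    proof -
      have "((\<lambda>u. - ((1 / u) ^ N / real N)) has_real_derivative - (real N * ((- 1 / (u * u)) * (1 / u) ^ (N - 1)) / real N)) (at u)"
        using w that by (auto intro!: derivative_eq_intros)
      also have "- (real N * ((- 1 / (u * u)) * (1 / u) ^ (N - 1)) / real N) = (1 / u) * ((1 / u) * (1 / u) ^ (N - 1))"
        using N w that by simp
      also have "\<dots> = (1 / u) ^ (N + 1)" using N by (cases N) simp_all
      finally show ?thesis .
    qed
    have "((\<lambda>u. - ((1 / u) ^ N / real N)) \<longlongrightarrow> - (0 ^ N / real N)) at_top"
      by (intro tendsto_intros tendsto_divide_0[OF tendsto_const] filterlim_at_top_imp_at_infinity filterlim_ident) (use N in auto)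
    then show "((\<lambda>u. - ((1 / u) ^ N / real N)) \<longlongrightarrow> 0) at_top"
      unfolding power_0_left using N by (simp only: if_False less_imp_neq[symmetric] div_0 minus_zero not_False_eq_True)
  qed (use w in auto)
  then show ?thesis by simp
qed

locale corr_level =
  fixes \<rho> c :: real
  assumes rho_c: "0 \<le> \<rho>" "\<rho> < c" "c < 1"
begin

text \<open>With c = tanh a and \<rho> = tanh b, the four constants \<open>slope\<close>,
  \<open>offset\<close>, \<open>u0\<close>, \<open>u1\<close> are sinh a, sinh b, cosh(a - b),
  cosh(a + b). The identities below are the corresponding hyperbolic ones; for instance
  \<open>u0_square\<close> is cosh^2 - 1 = sinh^2.\<close>

definition slope :: real where "slope = c / sqrt (1 - c\<^sup>2)"
definition offset :: real where "offset = \<rho> / sqrt (1 - \<rho>\<^sup>2)"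
definition u0 :: real where "u0 = (1 - \<rho> * c) / (sqrt (1 - \<rho>\<^sup>2) * sqrt (1 - c\<^sup>2))"
definition u1 :: real where "u1 = (1 + \<rho> * c) / (sqrt (1 - \<rho>\<^sup>2) * sqrt (1 - c\<^sup>2))"
text \<open>Inserting v = u - sqrt(u^2 - 1) cos \<alpha> into the inequality of
  \<open>tail_set\<close> turns it into \<open>angle_cos u\<close> \<le> - cos \<alpha>. Hence
  \<open>angle_cos u\<close> is the cosine of the angle of the arc, when it lies in [-1,1].\<close>

definition angle_cos :: "real \<Rightarrow> real" where
  "angle_cos u = (slope * sqrt (1 - \<rho>\<^sup>2) - \<rho> * u) / sqrt (u\<^sup>2 - 1)"

lemma sc: "0 < sqrt (1 - c\<^sup>2)" "(sqrt (1 - c\<^sup>2))\<^sup>2 = 1 - c\<^sup>2"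
  using one_minus_square_pos[of c] rho_c by auto

lemma sr: "0 < sqrt (1 - \<rho>\<^sup>2)" "(sqrt (1 - \<rho>\<^sup>2))\<^sup>2 = 1 - \<rho>\<^sup>2"
  using one_minus_square_pos[of \<rho>] rho_c by auto

lemma rho_c_mult: "0 \<le> \<rho> * c" "\<rho> * c < 1"
  using one_minus_mult_pos[of \<rho> c] rho_c by auto

lemma u0_square: "u0\<^sup>2 - 1 = ((c - \<rho>) / (sqrt (1 - \<rho>\<^sup>2) * sqrt (1 - c\<^sup>2)))\<^sup>2"
proof -
  have ne: "(1 - \<rho>\<^sup>2) * (1 - c\<^sup>2) \<noteq> 0" using sc sr by auto
  have "u0\<^sup>2 - 1 = ((1 - \<rho> * c)\<^sup>2 - (1 - \<rho>\<^sup>2) * (1 - c\<^sup>2)) / ((1 - \<rho>\<^sup>2) * (1 - c\<^sup>2))"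
    unfolding u0_def power_divide power_mult_distrib sc(2) sr(2) using divide_diff_eq_iff[OF ne] by simp
  also have "(1 - \<rho> * c)\<^sup>2 - (1 - \<rho>\<^sup>2) * (1 - c\<^sup>2) = (c - \<rho>)\<^sup>2"
    by (simp add: power2_eq_square algebra_simps)
  finally show ?thesis unfolding power_divide power_mult_distrib sc(2) sr(2) .
qed

lemma u0_gt_1: "1 < u0"
proof -
  have "0 < u0\<^sup>2 - 1" unfolding u0_square using rho_c sc sr by simp
  moreover have "0 < u0" using rho_c_mult sc sr by (simp add: u0_def)
  ultimately show ?thesis using power2_le_imp_le[of u0 1] by (smt (verit) power_one_right one_power2 power_mono)
qed

lemma u1_pos: "0 < u1"
  using rho_c_mult sc sr by (simp add: u1_def add_pos_nonneg)

lemma slope_pos: "0 < slope" and offset_nonneg: "0 \<le> offset"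
  using rho_c sc sr by (auto simp: slope_def offset_def)

lemma slope_u0: "slope * u0 - offset = (c - \<rho>) / ((1 - c\<^sup>2) * sqrt (1 - \<rho>\<^sup>2))"
proof -
  have "slope * u0 - offset = (c * (1 - \<rho> * c)) / ((sqrt (1 - c\<^sup>2))\<^sup>2 * sqrt (1 - \<rho>\<^sup>2)) - \<rho> / sqrt (1 - \<rho>\<^sup>2)"
    by (simp add: slope_def u0_def offset_def power2_eq_square)
  also have "\<dots> = (c * (1 - \<rho> * c) - \<rho> * (1 - c\<^sup>2)) / ((1 - c\<^sup>2) * sqrt (1 - \<rho>\<^sup>2))"
    unfolding sc(2) using sc sr by (simp add: diff_divide_distrib)
  also have "c * (1 - \<rho> * c) - \<rho> * (1 - c\<^sup>2) = c - \<rho>"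
    by (simp add: power2_eq_square algebra_simps)
  finally show ?thesis .
qed

lemma offset_less: "offset < slope * u0"
proof -
  have "0 < slope * u0 - offset" unfolding slope_u0 using sc sr rho_c by auto
  then show ?thesis by simp
qed

text \<open>The left side is (u^2 - 1) (1 - \<open>angle_cos u\<close>^2). Its roots u0 and -u1 are
  the values where the line bounding \<open>tail_set\<close> meets the circle on the axis, so u0 is
  where the arc begins to open.\<close>

lemma quadratic_factor:
  "u\<^sup>2 - 1 - (slope * sqrt (1 - \<rho>\<^sup>2) - \<rho> * u)\<^sup>2 = (1 - \<rho>\<^sup>2) * ((u - u0) * (u + u1))"
proof -
  define s r where "s = sqrt (1 - c\<^sup>2)" and "r = sqrt (1 - \<rho>\<^sup>2)"
  have s: "s \<noteq> 0" "s * s = 1 - c * c" using sc by (auto simp: s_def power2_eq_square)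
  have r: "r \<noteq> 0" "r * r = 1 - \<rho> * \<rho>" using sr by (auto simp: r_def power2_eq_square)
  have r2: "1 - \<rho>\<^sup>2 = r * r" unfolding r by (simp add: power2_eq_square)
  have "(1 - \<rho>\<^sup>2) * ((u - u0) * (u + u1)) = r * r * u * u + (r * r * (u1 - u0)) * u - r * r * (u0 * u1)"
    unfolding r2 by (simp add: algebra_simps)
  also have "r * r * (u1 - u0) = 2 * \<rho> * (slope * r)"
    using s(1) r(1) by (simp add: u1_def u0_def slope_def s_def[symmetric] r_def[symmetric] diff_divide_distrib[symmetric])
  also have "r * r * (u0 * u1) = 1 + (slope * r)\<^sup>2"
  proof -
    have "r * r * (u0 * u1) = (1 - \<rho> * c) * (1 + \<rho> * c) / (s * s)"
      using s(1) r(1) by (simp add: u1_def u0_def s_def[symmetric] r_def[symmetric])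
    also have "(1 - \<rho> * c) * (1 + \<rho> * c) = s * s + c * c * (r * r)"
      unfolding s r by (simp add: algebra_simps)
    also have "\<dots> / (s * s) = 1 + (slope * r)\<^sup>2"
    proof -
      have "slope * r = c * r / s" by (simp add: slope_def s_def)
      then show ?thesis using s(1) by (simp only: power2_eq_square) (simp add: add_divide_distrib)
    qed
    finally show ?thesis .
  qed
  also have "r * r * u * u + 2 * \<rho> * (slope * r) * u - (1 + (slope * r)\<^sup>2) = u\<^sup>2 - 1 - (slope * r - \<rho> * u)\<^sup>2"
    unfolding r by (simp add: power2_eq_square algebra_simps)
  finally show ?thesis by (simp add: r_def)
qed

text \<open>The factorisation alone only says that \<open>angle_cos\<close> lies outside [-1,1] for
  1 < u < u0. The sign decides that it exceeds 1, so that the arc is empty there and not the full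
  half-circle.\<close>

lemma angle_cos_numerator_pos: "u \<le> u0 \<Longrightarrow> 0 < slope * sqrt (1 - \<rho>\<^sup>2) - \<rho> * u"
proof -
  assume u: "u \<le> u0"
  have "offset * u \<le> offset * u0" using u offset_nonneg by (intro mult_left_mono)
  also have "\<dots> < slope"
  proof -
    have "slope - offset * u0 = c / sqrt (1 - c\<^sup>2) - \<rho> * (1 - \<rho> * c) / ((sqrt (1 - \<rho>\<^sup>2))\<^sup>2 * sqrt (1 - c\<^sup>2))"
      by (simp add: slope_def u0_def offset_def power2_eq_square)
    also have "\<dots> = (c * (1 - \<rho>\<^sup>2) - \<rho> * (1 - \<rho> * c)) / ((1 - \<rho>\<^sup>2) * sqrt (1 - c\<^sup>2))"
      unfolding sr(2) using sc sr by (simp add: diff_divide_distrib)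
    also have "c * (1 - \<rho>\<^sup>2) - \<rho> * (1 - \<rho> * c) = c - \<rho>" by (simp add: power2_eq_square algebra_simps)
    also have "0 < (c - \<rho>) / ((1 - \<rho>\<^sup>2) * sqrt (1 - c\<^sup>2))" using sc sr rho_c by auto
    finally show ?thesis by simp
  qed
  finally have "0 < (slope - offset * u) * sqrt (1 - \<rho>\<^sup>2)" using sr by simp
  also have "\<dots> = slope * sqrt (1 - \<rho>\<^sup>2) - \<rho> * u" using sr by (simp add: offset_def algebra_simps)
  finally show ?thesis .
qed

lemma one_minus_angle_cos_square:
  assumes "1 < u"
  shows "1 - (angle_cos u)\<^sup>2 = (1 - \<rho>\<^sup>2) * ((u - u0) * (u + u1)) / (u\<^sup>2 - 1)"
proof -
  have u2: "0 < u\<^sup>2 - 1" using assms by simp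
  have "1 - (angle_cos u)\<^sup>2 = (u\<^sup>2 - 1 - (slope * sqrt (1 - \<rho>\<^sup>2) - \<rho> * u)\<^sup>2) / (u\<^sup>2 - 1)"
    using u2 by (simp add: angle_cos_def power_divide divide_simps)
  then show ?thesis by (simp only: quadratic_factor)
qed

lemma angle_cos_range:
  assumes "u0 \<le> u"
  shows "- 1 \<le> angle_cos u \<and> angle_cos u \<le> 1"
proof -
  have u: "1 < u" using assms u0_gt_1 by simp
  have "0 \<le> 1 - (angle_cos u)\<^sup>2"
    unfolding one_minus_angle_cos_square[OF u] using assms u1_pos u sr by (intro divide_nonneg_nonneg mult_nonneg_nonneg) auto
  then show ?thesis by (simp add: abs_square_le_1 abs_le_iff)
qed

lemma angle_cos_range_strict:
  assumes "u0 < u"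
  shows "- 1 < angle_cos u \<and> angle_cos u < 1"
proof -
  have u: "1 < u" using assms u0_gt_1 by simp
  have "0 < (1 - \<rho>\<^sup>2) * ((u - u0) * (u + u1)) / (u\<^sup>2 - 1)"
    using assms u1_pos u sr by (intro divide_pos_pos mult_pos_pos) auto
  then have "(angle_cos u)\<^sup>2 < 1"
    unfolding one_minus_angle_cos_square[OF u, symmetric] by simp
  then show ?thesis by (simp add: abs_square_less_1 abs_less_iff)
qed

lemma angle_cos_gt_1:
  assumes "1 < u" "u < u0"
  shows "1 < angle_cos u"
proof -
  have "(1 - \<rho>\<^sup>2) * ((u - u0) * (u + u1)) / (u\<^sup>2 - 1) < 0"
    using assms u1_pos sr by (intro divide_neg_pos mult_pos_neg mult_neg_pos) auto
  then have "1 < (angle_cos u)\<^sup>2"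
    unfolding one_minus_angle_cos_square[OF assms(1), symmetric] by simp
  moreover have "0 < angle_cos u"
    using angle_cos_numerator_pos[of u] assms by (simp add: angle_cos_def)
  ultimately show ?thesis using power_le_one[of "angle_cos u" 2] by linarith
qed

lemma angle_cos_u0: "angle_cos u0 = 1"
proof -
  have "1 - (angle_cos u0)\<^sup>2 = 0" unfolding one_minus_angle_cos_square[OF u0_gt_1] by simp
  then have "angle_cos u0 = 1 \<or> angle_cos u0 = - 1" by (simp add: power2_eq_1_iff)
  moreover have "0 < angle_cos u0"
    using angle_cos_numerator_pos[of u0] u0_gt_1 by (simp add: angle_cos_def)
  ultimately show ?thesis by auto
qed

lemma angle_cos_has_deriv:
  assumes "1 < u"
  shows "(angle_cos has_real_derivative (\<rho> - slope * sqrt (1 - \<rho>\<^sup>2) * u) / (sqrt (u\<^sup>2 - 1)) ^ 3) (at u)"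
proof -
  define A where "A = slope * sqrt (1 - \<rho>\<^sup>2)"
  have u2: "0 < u\<^sup>2 - 1" using assms by simp
  define R where "R = sqrt (u\<^sup>2 - 1)"
  have R: "R \<noteq> 0" "R * R = u * u - 1" using u2 by (auto simp: R_def power2_eq_square)
  have "((\<lambda>u. (A - \<rho> * u) / sqrt (u\<^sup>2 - 1)) has_real_derivative
     ((- \<rho>) * R - (A - \<rho> * u) * (inverse R * u)) / (R * R)) (at u)"
    unfolding R_def
  proof (rule DERIV_divide)
    show "((\<lambda>u. A - \<rho> * u) has_real_derivative - \<rho>) (at u)"
      by (auto intro!: derivative_eq_intros)
    show "((\<lambda>u. sqrt (u\<^sup>2 - 1)) has_real_derivative inverse (sqrt (u\<^sup>2 - 1)) * u) (at u)"
    proof -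
      have "((\<lambda>u. sqrt (u\<^sup>2 - 1)) has_real_derivative (inverse (sqrt (u\<^sup>2 - 1)) / 2) * (2 * u)) (at u)"
      proof (rule DERIV_chain2[OF DERIV_real_sqrt])
        show "((\<lambda>u. u\<^sup>2 - 1) has_real_derivative 2 * u) (at u)"
          by (auto intro!: derivative_eq_intros)
      qed (use u2 in simp)
      then show ?thesis by simp
    qed
  qed (use u2 in simp)
  also have "((- \<rho>) * R - (A - \<rho> * u) * (inverse R * u)) / (R * R) = (- \<rho> * (R * R) - (A - \<rho> * u) * u) / R ^ 3"
    using R(1) by (simp add: divide_simps power3_eq_cube)
  also have "- \<rho> * (R * R) - (A - \<rho> * u) * u = \<rho> - A * u"
    unfolding R(2) by (simp add: algebra_simps)
  finally show ?thesis unfolding angle_cos_def[abs_def] A_def R_def .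
qed

lemma arccos_angle_cos_has_deriv:
  assumes "u0 < u"
  shows "((\<lambda>u. arccos (angle_cos u)) has_real_derivative angle_deriv slope offset u0 u1 u) (at u)"
proof -
  have u: "1 < u" using assms u0_gt_1 by simp
  have u2: "0 < u\<^sup>2 - 1" using u by simp
  define R where "R = sqrt (u\<^sup>2 - 1)"
  define S where "S = sqrt ((u - u0) * (u + u1))"
  have R: "0 < R" "R\<^sup>2 = u\<^sup>2 - 1" using u2 by (auto simp: R_def)
  have S: "0 < S" using assms u u1_pos by (simp add: S_def)
  have r: "sqrt (1 - (angle_cos u)\<^sup>2) = sqrt (1 - \<rho>\<^sup>2) * S / R"
    unfolding one_minus_angle_cos_square[OF u] by (simp add: R_def S_def real_sqrt_mult real_sqrt_divide)
  have "((\<lambda>u. arccos (angle_cos u)) has_real_derivative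
      inverse (- sqrt (1 - (angle_cos u)\<^sup>2)) * ((\<rho> - slope * sqrt (1 - \<rho>\<^sup>2) * u) / R ^ 3)) (at u)"
    unfolding R_def using angle_cos_range_strict[OF assms] angle_cos_has_deriv[OF u]
    by (intro DERIV_chain2[OF DERIV_arccos]) auto
  also have "inverse (- sqrt (1 - (angle_cos u)\<^sup>2)) * ((\<rho> - slope * sqrt (1 - \<rho>\<^sup>2) * u) / R ^ 3)
    = ((slope * u - offset) * sqrt (1 - \<rho>\<^sup>2)) / (R\<^sup>2 * (sqrt (1 - \<rho>\<^sup>2) * S))"
    unfolding r using R(1) S sr(1) by (simp add: offset_def field_simps power2_eq_square power3_eq_cube)
  also have "\<dots> = angle_deriv slope offset u0 u1 u"
    unfolding angle_deriv_def R(2)[symmetric] S_def[symmetric] using sr(1) by simp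
  finally show ?thesis .
qed

lemma angle_deriv_nonneg:
  assumes "u0 \<le> u"
  shows "0 \<le> angle_deriv slope offset u0 u1 u"
proof -
  have "slope * u0 \<le> slope * u" using assms slope_pos by (intro mult_left_mono) auto
  then have "0 \<le> slope * u - offset" using offset_less by linarith
  moreover have "0 \<le> u\<^sup>2 - 1" using assms u0_gt_1 by simp
  moreover have "0 \<le> (u - u0) * (u + u1)" using assms u0_gt_1 u1_pos by simp
  ultimately show ?thesis by (simp add: angle_deriv_def)
qed

lemma angle_deriv_measurable[measurable]: "angle_deriv slope offset u0 u1 \<in> borel_measurable borel"
  unfolding angle_deriv_def[abs_def] by measurable

text \<open>The derivative is unbounded at u0, so the fundamental theorem is applied with
  differentiability in the interior and continuity on the closed interval; the initial value is
  arccos 1 = 0.\<close>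

lemma arccos_angle_cos_eq_integral:
  assumes "u0 \<le> u"
  shows "ennreal (arccos (angle_cos u)) =
    (\<integral>\<^sup>+w. ennreal (angle_deriv slope offset u0 u1 w) * indicator {u0..u} w \<partial>lborel)"
proof -
  have "((\<lambda>w. angle_deriv slope offset u0 u1 w) has_integral (arccos (angle_cos u) - arccos (angle_cos u0))) {u0..u}"
  proof (rule fundamental_theorem_of_calculus_interior[OF assms])
    show "continuous_on {u0..u} (\<lambda>u. arccos (angle_cos u))"
    proof (rule continuous_on_arccos)
      show "continuous_on {u0..u} angle_cos"
        using u0_gt_1 by (intro continuous_at_imp_continuous_on ballI DERIV_isCont[OF angle_cos_has_deriv]) auto
      show "\<forall>x\<in>{u0..u}. - 1 \<le> angle_cos x \<and> angle_cos x \<le> 1" using angle_cos_range by auto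
    qed
    show "((\<lambda>u. arccos (angle_cos u)) has_vector_derivative angle_deriv slope offset u0 u1 x) (at x)"
      if "x \<in> {u0<..<u}" for x
      using arccos_angle_cos_has_deriv[of x] that by (simp add: has_real_derivative_iff_has_vector_derivative)
  qed
  then have "((\<lambda>w. angle_deriv slope offset u0 u1 w) has_integral arccos (angle_cos u)) {u0..u}"
    by (simp add: angle_cos_u0)
  then show ?thesis
    by (intro nn_integral_has_integral_lebesgue'[symmetric]) (auto intro: angle_deriv_nonneg)
qed

text \<open>The event that the coefficient is at least c, in the coordinates (u, v);
  \<open>corr_ratio_event\<close> justifies it.\<close>

definition tail_set :: "(real \<times> real) set" where
  "tail_set = {p. (1 - \<rho>) * fst p + slope * sqrt (1 - \<rho>\<^sup>2) \<le> snd p}"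

lemma tail_set_measurable[measurable]: "tail_set \<in> sets (borel \<Otimes>\<^sub>M borel)"
proof -
  have "tail_set = {p \<in> space (borel \<Otimes>\<^sub>M borel). (1 - \<rho>) * fst p + slope * sqrt (1 - \<rho>\<^sup>2) \<le> snd p}"
    by (simp add: tail_set_def space_pair_measure)
  then show ?thesis by simp
qed

lemma angle_measure:
  assumes u: "1 < u"
  shows "(\<integral>\<^sup>+\<alpha>. ennreal (indicator tail_set (u, u - sqrt (u\<^sup>2 - 1) * cos \<alpha>)) * indicator {0..pi} \<alpha> \<partial>lborel)
    = ennreal (arccos (angle_cos u)) * indicator {u0..} u"
proof -
  have R: "0 < sqrt (u\<^sup>2 - 1)" using u by simp
  have mem: "(u, u - sqrt (u\<^sup>2 - 1) * cos \<alpha>) \<in> tail_set \<longleftrightarrow> angle_cos u \<le> - cos \<alpha>" for \<alpha>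
    unfolding angle_cos_def divide_le_eq using R by (auto simp: tail_set_def algebra_simps)
  show ?thesis
  proof (cases "u0 \<le> u")
    case True
    then have q: "- 1 \<le> angle_cos u" "angle_cos u \<le> 1" using angle_cos_range by auto
    have iff: "angle_cos u \<le> - cos \<alpha> \<longleftrightarrow> pi - arccos (angle_cos u) \<le> \<alpha>" if "\<alpha> \<in> {0..pi}" for \<alpha>
    proof -
      have "arccos (angle_cos u) \<le> pi" "0 \<le> arccos (angle_cos u)" using arccos_bounded[OF q] by auto
      then have "cos \<alpha> \<le> cos (pi - arccos (angle_cos u)) \<longleftrightarrow> pi - arccos (angle_cos u) \<le> \<alpha>"
        using that by (intro cos_mono_le_eq) auto
      moreover have "cos (pi - arccos (angle_cos u)) = - angle_cos u" using q by simp
      ultimately show ?thesis by auto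
    qed
    have b: "arccos (angle_cos u) \<le> pi" "0 \<le> arccos (angle_cos u)" using arccos_bounded[OF q] by auto
    have "(\<integral>\<^sup>+\<alpha>. ennreal (indicator tail_set (u, u - sqrt (u\<^sup>2 - 1) * cos \<alpha>)) * indicator {0..pi} \<alpha> \<partial>lborel)
      = (\<integral>\<^sup>+\<alpha>. indicator {pi - arccos (angle_cos u)..pi} \<alpha> \<partial>lborel)"
      using iff b by (intro nn_integral_cong) (auto simp: indicator_def mem)
    also have "\<dots> = ennreal (arccos (angle_cos u))" using b by simp
    finally show ?thesis using True by simp
  next
    case False
    then have "1 < angle_cos u" using angle_cos_gt_1[OF u] by simp
    then have "\<not> angle_cos u \<le> - cos \<alpha>" for \<alpha> using cos_ge_minus_one[of \<alpha>] by linarith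
    then have "(u, u - sqrt (u\<^sup>2 - 1) * cos \<alpha>) \<notin> tail_set" for \<alpha> using mem by blast
    then show ?thesis using False by simp
  qed
qed

text \<open>The integration by parts is carried out by Tonelli on the region u0 \<le> w \<le> u: the
  angle is an integral of its derivative over w, and the inner integral of u^(-(N+1)) over u \<ge> w
  is w^(-N) / N. Nonnegativity makes boundary terms and convergence questions disappear.\<close>

lemma tail_integral:
  assumes N: "0 < N"
  shows "(\<integral>\<^sup>+u. \<integral>\<^sup>+\<alpha>. ennreal (indicator {1<..} u * (1 / u) ^ (N + 1) * indicator tail_set (u, u - sqrt (u\<^sup>2 - 1) * cos \<alpha>)) *
      indicator {0..pi} \<alpha> \<partial>lborel \<partial>lborel) =
    (\<integral>\<^sup>+\<tau>. ennreal (indicator {0<..} \<tau> * ((1 / u0) ^ N / real N * (exp (- real N * \<tau>) *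
      (u0 * exp \<tau> * angle_deriv slope offset u0 u1 (u0 * exp \<tau>))))) \<partial>lborel)"
proof -
  define d where "d = angle_deriv slope offset u0 u1"
  have d_m[measurable]: "d \<in> borel_measurable borel" unfolding d_def by measurable
  have d0: "0 \<le> d w" if "u0 \<le> w" for w using angle_deriv_nonneg that by (simp add: d_def)
  have u00: "0 < u0" using u0_gt_1 by simp
  have "(\<integral>\<^sup>+u. \<integral>\<^sup>+\<alpha>. ennreal (indicator {1<..} u * (1 / u) ^ (N + 1) * indicator tail_set (u, u - sqrt (u\<^sup>2 - 1) * cos \<alpha>)) *
      indicator {0..pi} \<alpha> \<partial>lborel \<partial>lborel) =
    (\<integral>\<^sup>+u. \<integral>\<^sup>+w. (ennreal ((1 / u) ^ (N + 1)) * indicator {w..} u) * (ennreal (d w) * indicator {u0..} w) \<partial>lborel \<partial>lborel)"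
  proof (rule nn_integral_cong)
    fix u :: real
    show "(\<integral>\<^sup>+\<alpha>. ennreal (indicator {1<..} u * (1 / u) ^ (N + 1) * indicator tail_set (u, u - sqrt (u\<^sup>2 - 1) * cos \<alpha>)) *
      indicator {0..pi} \<alpha> \<partial>lborel) =
      (\<integral>\<^sup>+w. (ennreal ((1 / u) ^ (N + 1)) * indicator {w..} u) * (ennreal (d w) * indicator {u0..} w) \<partial>lborel)"
    proof (cases "1 < u")
      case u: True
      have "(\<integral>\<^sup>+\<alpha>. ennreal (indicator {1<..} u * (1 / u) ^ (N + 1) * indicator tail_set (u, u - sqrt (u\<^sup>2 - 1) * cos \<alpha>)) *
          indicator {0..pi} \<alpha> \<partial>lborel) =
        (\<integral>\<^sup>+\<alpha>. ennreal ((1 / u) ^ (N + 1)) * (ennreal (indicator tail_set (u, u - sqrt (u\<^sup>2 - 1) * cos \<alpha>)) *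
          indicator {0..pi} \<alpha>) \<partial>lborel)"
        using u by (intro nn_integral_cong) (auto simp: indicator_def)
      also have "\<dots> = ennreal ((1 / u) ^ (N + 1)) * (\<integral>\<^sup>+\<alpha>. ennreal (indicator tail_set (u, u - sqrt (u\<^sup>2 - 1) * cos \<alpha>)) *
          indicator {0..pi} \<alpha> \<partial>lborel)"
        by (rule nn_integral_cmult) measurable
      also have "\<dots> = ennreal ((1 / u) ^ (N + 1)) * (\<integral>\<^sup>+w. ennreal (d w) * indicator {u0..u} w \<partial>lborel)"
        unfolding angle_measure[OF u] d_def
        by (cases "u0 \<le> u") (simp_all add: arccos_angle_cos_eq_integral)
      also have "\<dots> = (\<integral>\<^sup>+w. ennreal ((1 / u) ^ (N + 1)) * (ennreal (d w) * indicator {u0..u} w) \<partial>lborel)"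
        by (rule nn_integral_cmult[symmetric]) measurable
      also have "\<dots> = (\<integral>\<^sup>+w. (ennreal ((1 / u) ^ (N + 1)) * indicator {w..} u) * (ennreal (d w) * indicator {u0..} w) \<partial>lborel)"
        by (intro nn_integral_cong) (auto simp: indicator_def)
      finally show ?thesis .
    next
      case False
      then have z: "indicator {w..} u * (ennreal (d w) * indicator {u0..} w) = 0" for w
        using u0_gt_1 by (auto simp: indicator_def)
      show ?thesis using False by (simp add: mult.assoc z)
    qed
  qed
  also have "\<dots> = (\<integral>\<^sup>+w. \<integral>\<^sup>+u. (ennreal ((1 / u) ^ (N + 1)) * indicator {w..} u) * (ennreal (d w) * indicator {u0..} w) \<partial>lborel \<partial>lborel)"
    unfolding indicator_def of_bool_def atLeast_iff by (rule lborel_pair.Fubini') measurable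
  also have "\<dots> = (\<integral>\<^sup>+w. ennreal ((1 / w) ^ N / real N * d w) * indicator {u0..} w \<partial>lborel)"
  proof (rule nn_integral_cong)
    fix w :: real
    show "(\<integral>\<^sup>+u. (ennreal ((1 / u) ^ (N + 1)) * indicator {w..} u) * (ennreal (d w) * indicator {u0..} w) \<partial>lborel)
      = ennreal ((1 / w) ^ N / real N * d w) * indicator {u0..} w"
    proof (cases "u0 \<le> w")
      case True
      then have w: "0 < w" using u00 by simp
      have "(\<integral>\<^sup>+u. (ennreal ((1 / u) ^ (N + 1)) * indicator {w..} u) * (ennreal (d w) * indicator {u0..} w) \<partial>lborel)
        = (\<integral>\<^sup>+u. ennreal ((1 / u) ^ (N + 1)) * indicator {w..} u \<partial>lborel) * (ennreal (d w) * indicator {u0..} w)"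
        by (rule nn_integral_multc) measurable
      also have "\<dots> = ennreal ((1 / w) ^ N / real N) * ennreal (d w) * indicator {u0..} w"
        unfolding nn_integral_power_tail[OF w N] by (simp add: mult.assoc)
      also have "ennreal ((1 / w) ^ N / real N) * ennreal (d w) = ennreal ((1 / w) ^ N / real N * d w)"
        using w by (intro ennreal_mult'[symmetric]) auto
      finally show ?thesis .
    qed simp
  qed
  also have "\<dots> = (\<integral>\<^sup>+\<tau>. ennreal (((1 / (u0 * exp \<tau>)) ^ N / real N * d (u0 * exp \<tau>)) * (u0 * exp \<tau>)) * indicator {0..} \<tau> \<partial>lborel)"
  proof -
    have "(\<integral>\<^sup>+w. ennreal ((1 / w) ^ N / real N * d w) * indicator {u0 * exp 0..} w \<partial>lborel) =
      (\<integral>\<^sup>+\<tau>. ennreal (((1 / (u0 * exp \<tau>)) ^ N / real N * d (u0 * exp \<tau>)) * (u0 * exp \<tau>)) * indicator {0..} \<tau> \<partial>lborel)"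
    proof (rule nn_integral_substitution_atLeast)
      show "((\<lambda>\<tau>. u0 * exp \<tau>) has_real_derivative u0 * exp \<tau>) (at \<tau>)" for \<tau>
        by (auto intro!: derivative_eq_intros)
      show "filterlim (\<lambda>\<tau>. u0 * exp \<tau>) at_top at_top"
        by (rule filterlim_tendsto_pos_mult_at_top[OF tendsto_const u00 exp_at_top])
    qed (use u00 in \<open>auto intro!: continuous_intros\<close>)
    then show ?thesis by simp
  qed
  also have "\<dots> = (\<integral>\<^sup>+\<tau>. ennreal (indicator {0<..} \<tau> * ((1 / u0) ^ N / real N * (exp (- real N * \<tau>) *
      (u0 * exp \<tau> * d (u0 * exp \<tau>))))) \<partial>lborel)"
  proof (intro nn_integral_cong_AE)
    show "AE \<tau> in lborel. ennreal (((1 / (u0 * exp \<tau>)) ^ N / real N * d (u0 * exp \<tau>)) * (u0 * exp \<tau>)) * indicator {0..} \<tau> =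
      ennreal (indicator {0<..} \<tau> * ((1 / u0) ^ N / real N * (exp (- real N * \<tau>) * (u0 * exp \<tau> * d (u0 * exp \<tau>)))))"
      using AE_lborel_singleton[of 0]
    proof eventually_elim
      case (elim \<tau>)
      have "(1 / (u0 * exp \<tau>)) ^ N = (1 / u0) ^ N * exp (- real N * \<tau>)"
        using exp_of_nat_mult[of N "- \<tau>"] by (simp add: exp_minus power_mult_distrib[symmetric] divide_inverse)
      then show ?case using elim by (auto simp: indicator_def mult_ac)
    qed
  qed
  finally show ?thesis by (simp add: d_def)
qed

end

section \<open>Matching the integral with the claimed leading term\<close>

context corr_level
begin

text \<open>The coefficient g 0 of \<open>angle_deriv_expansion\<close>, that is, the limit of its
  function F at \<tau> = 0.\<close>

definition lead_coeff0 :: real where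
  "lead_coeff0 = u0 * (slope * u0 - offset) / ((u0\<^sup>2 - 1) * sqrt (u0 * (u0 + u1)))"

lemma lead_coeff0_eq:
  "lead_coeff0 = sqrt (1 - \<rho> * c) * sqrt (1 - \<rho>\<^sup>2) / (sqrt 2 * (c - \<rho>))"
proof -
  define s r e t where "s = sqrt (1 - c\<^sup>2)" and "r = sqrt (1 - \<rho>\<^sup>2)" and "e = sqrt (1 - \<rho> * c)" and "t = c - \<rho>"
  have pos: "0 < s" "0 < r" "0 < e" "0 < t" using sc sr rho_c_mult rho_c by (auto simp: s_def r_def e_def t_def)
  have ee: "1 - \<rho> * c = e * e" using rho_c_mult by (simp add: e_def)
  have ss: "1 - c\<^sup>2 = s * s" using sc by (simp add: s_def power2_eq_square)
  have u0: "u0 = e * e / (r * s)" by (simp add: u0_def s_def r_def ee)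
  have uu: "u0 + u1 = 2 / (r * s)"
    unfolding u0_def u1_def s_def[symmetric] r_def[symmetric] by (simp add: add_divide_distrib[symmetric])
  have "sqrt (u0 * (u0 + u1)) = sqrt (2 * (e / (r * s))\<^sup>2)"
    unfolding uu by (simp add: u0 power2_eq_square)
  also have "\<dots> = sqrt 2 * (e / (r * s))"
    using pos by (simp add: real_sqrt_mult del: power_divide)
  finally have sq: "sqrt (u0 * (u0 + u1)) = sqrt 2 * (e / (r * s))" .
  have "lead_coeff0 = (e * e / (r * s)) * (t / (s * s * r)) / ((t / (r * s))\<^sup>2 * (sqrt 2 * (e / (r * s))))"
  proof -
    have "slope * u0 - offset = t / (s * s * r)" using slope_u0 unfolding ss r_def t_def .
    moreover have "u0\<^sup>2 - 1 = (t / (r * s))\<^sup>2" using u0_square unfolding s_def r_def t_def .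
    ultimately show ?thesis unfolding lead_coeff0_def sq by (simp only: u0)
  qed
  also have "\<dots> = e * r / (sqrt 2 * t)"
    using pos by (simp add: power2_eq_square divide_simps)
  finally show ?thesis by (simp add: e_def r_def t_def)
qed

lemma lead_coeff0_pos: "0 < lead_coeff0"
  unfolding lead_coeff0_eq using rho_c rho_c_mult sr by (intro divide_pos_pos mult_pos_pos) auto

text \<open>Here the saddle-point constants meet the integral formula: u0^2 compensates the exponent
  n - 2, and sqrt 2 is the one in sqrt(2 \<pi> n).\<close>

lemma prefactor_constant:
  "g_G \<rho> c / saddle_eq \<rho> c = u0\<^sup>2 * lead_coeff0 * sqrt 2"
proof -
  define s r e t where "s = sqrt (1 - c\<^sup>2)" and "r = sqrt (1 - \<rho>\<^sup>2)" and "e = sqrt (1 - \<rho> * c)" and "t = c - \<rho>"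
  have pos: "0 < s" "0 < r" "0 < e" "0 < t" using sc sr rho_c_mult rho_c by (auto simp: s_def r_def e_def t_def)
  have ee: "1 - \<rho> * c = e * e" using rho_c_mult by (simp add: e_def)
  have ss: "1 - c\<^sup>2 = s * s" using sc by (simp add: s_def power2_eq_square)
  have rr: "1 - \<rho>\<^sup>2 = r * r" using sr by (simp add: r_def power2_eq_square)
  have p1: "(1 - \<rho> * c) powr (3 / 2) = e ^ 3"
  proof -
    have "(e * e) powr (1 + 1 / 2) = e * e * sqrt (e * e)"
      unfolding powr_add using pos by (subst powr_half_sqrt) auto
    also have "\<dots> = e ^ 3" using pos by (simp add: power3_eq_cube)
    finally show ?thesis by (simp add: ee)
  qed
  have p2: "(1 - \<rho>\<^sup>2) powr (- 1 / 2) = 1 / r"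
    using sr powr_minus[of "1 - \<rho>\<^sup>2" "1 / 2"] by (simp add: r_def powr_half_sqrt inverse_eq_divide)
  have p3: "(1 - c\<^sup>2) powr (- 2) = 1 / (s * s)\<^sup>2"
    using pos powr_minus[of "s * s" 2] by (simp add: ss inverse_eq_divide)
  have "saddle_eq \<rho> c = (c * (e * e) - \<rho> * (s * s)) / ((s * s) * (e * e))"
    unfolding saddle_eq_def ss ee using pos by (simp add: diff_frac_eq)
  also have "c * (e * e) - \<rho> * (s * s) = t"
    unfolding ss[symmetric] ee[symmetric] t_def by (simp add: power2_eq_square algebra_simps)
  finally have sd: "saddle_eq \<rho> c = t / ((s * s) * (e * e))" .
  have u0: "u0 = e * e / (r * s)" by (simp add: u0_def s_def r_def ee)
  have lc: "lead_coeff0 = e * r / (sqrt 2 * t)" by (simp add: lead_coeff0_eq e_def r_def t_def)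
  have "g_G \<rho> c / saddle_eq \<rho> c = 1 / r * e ^ 3 * (1 / (s * s)\<^sup>2) / (t / ((s * s) * (e * e)))"
    unfolding g_G_def p1 p2 p3 sd ..
  also have "\<dots> = (e * e / (r * s))\<^sup>2 * (e * r / (sqrt 2 * t)) * sqrt 2"
    using pos by (simp add: power2_eq_square power3_eq_cube divide_simps)
  finally show ?thesis unfolding u0 lc .
qed

text \<open>Watson's lemma produces the terms g k Gamma(k + 1/2) n^(-k-1/2). The prefactor W is
  exactly the term k = 0, because Gamma(1/2) = sqrt \<pi>, so division by it leaves \<delta> k / n^k
  with \<delta> 0 = 1.\<close>

lemma sharp_expansion_from_integral:
  fixes P :: "nat \<Rightarrow> real"
  assumes rho: "\<rho> \<le> sqrt (3 + 2 * sqrt 3) / 3"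
    and P: "\<And>n. 2 < n \<Longrightarrow> P n = (1 / u0) ^ (n - 2) / pi *
      (LINT \<tau>|lborel. indicator {0<..} \<tau> * (exp (- real (n - 2) * \<tau>) *
        (u0 * exp \<tau> * angle_deriv slope offset u0 u1 (u0 * exp \<tau>))))"
  shows "\<exists>\<delta>. sharp_expansion (L_G \<rho>) (Lstar_G \<rho>) (R0_G \<rho>) c P \<delta>"
proof -
  interpret corr_param \<rho> by standard (use rho rho_c in auto)
  define F where "F \<tau> = exp (2 * \<tau>) * (sqrt \<tau> * (u0 * exp \<tau> * angle_deriv slope offset u0 u1 (u0 * exp \<tau>)))" for \<tau>
  define I where "I n = (LINT \<tau>|lborel. indicator {0<..} \<tau> * (\<tau> powr (- 1 / 2) * exp (- real n * \<tau>) * F \<tau>))" for n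
  obtain g where g0: "g 0 = lead_coeff0"
    and g: "\<And>p. \<exists>C. \<forall>\<tau>>0. \<bar>F \<tau> - (\<Sum>k\<le>p. g k * \<tau> ^ k)\<bar> \<le> C * \<tau> ^ (p + 1) * exp (2 * \<tau>)"
    using angle_deriv_expansion[OF slope_pos offset_nonneg offset_less u0_gt_1 u1_pos]
    unfolding lead_coeff0_def F_def by blast
  have F_m[measurable]: "F \<in> borel_measurable borel" unfolding F_def[abs_def] by measurable
  define W where "W n = exp (- real n * Lstar_G \<rho> c + R0_G \<rho> (lambda_c (L_G \<rho>) c)) /
     (lambda_c (L_G \<rho>) c * sigma_c (L_G \<rho>) c * sqrt (2 * pi * real n))" for n
  have W: "W n = (1 / u0) ^ n * (u0\<^sup>2 * lead_coeff0) / (sqrt pi * sqrt (real n))" if "0 < n" for n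
  proof -
    have "W n = u0 powr (- real n) * (g_G \<rho> c / (saddle_eq \<rho> c * sqrt (2 * pi * real n)))"
      unfolding W_def using expansion_prefactor[OF rho_c(2,3)] by (simp add: u0_def)
    also have "\<dots> = u0 powr (- real n) * ((g_G \<rho> c / saddle_eq \<rho> c) / sqrt (2 * pi * real n))" by simp
    also have "\<dots> = (1 / u0) ^ n * (u0\<^sup>2 * lead_coeff0) / (sqrt pi * sqrt (real n))"
      unfolding prefactor_constant using u0_gt_1 that
      by (simp add: powr_minus powr_realpow power_inverse real_sqrt_mult divide_inverse)
    finally show ?thesis .
  qed
  have W_pos: "0 < W n" if "0 < n" for n
    unfolding W[OF that] using lead_coeff0_pos u0_gt_1 that by (intro divide_pos_pos mult_pos_pos) auto
  define \<delta> where "\<delta> k = g k * Gamma (real k + 1 / 2) / (lead_coeff0 * sqrt pi)" for k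
  have quot: "P n / W n = I n * sqrt (real n) / (sqrt pi * lead_coeff0)" if n: "2 < n" for n
  proof -
    have "(\<lambda>\<tau>. indicator {0<..} \<tau> * (exp (- real (n - 2) * \<tau>) *
        (u0 * exp \<tau> * angle_deriv slope offset u0 u1 (u0 * exp \<tau>)))) =
      (\<lambda>\<tau>. indicator {0<..} \<tau> * (\<tau> powr (- 1 / 2) * exp (- real n * \<tau>) * F \<tau>))"
    proof
      fix \<tau> :: real
      have "exp (- real (n - 2) * \<tau>) = exp (- real n * \<tau>) * exp (2 * \<tau>)"
        using n by (simp add: exp_add[symmetric] of_nat_diff algebra_simps)
      moreover have "\<tau> powr (- 1 / 2) * sqrt \<tau> = 1" if "0 < \<tau>"
        using that by (simp add: powr_minus powr_half_sqrt)
      ultimately show "indicator {0<..} \<tau> * (exp (- real (n - 2) * \<tau>) *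
        (u0 * exp \<tau> * angle_deriv slope offset u0 u1 (u0 * exp \<tau>))) =
        indicator {0<..} \<tau> * (\<tau> powr (- 1 / 2) * exp (- real n * \<tau>) * F \<tau>)"
        by (cases "0 < \<tau>") (simp_all add: F_def mult_ac)
    qed
    then have "P n = (1 / u0) ^ (n - 2) / pi * I n" unfolding P[OF n] I_def by simp
    also have "(1 / u0) ^ (n - 2) = (1 / u0) ^ n * u0\<^sup>2"
    proof -
      have e: "n - 2 + 2 = n" using n by simp
      have "(1 / u0) ^ n = (1 / u0) ^ (n - 2 + 2)" unfolding e ..
      also have "\<dots> = (1 / u0) ^ (n - 2) * (1 / u0)\<^sup>2" by (rule power_add)
      finally have "(1 / u0) ^ n = (1 / u0) ^ (n - 2) * (1 / u0)\<^sup>2" .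
      then show ?thesis using u0_gt_1 by (simp add: power_one_over)
    qed
    finally have "P n / W n = ((1 / u0) ^ n * u0\<^sup>2 / pi * I n) / ((1 / u0) ^ n * (u0\<^sup>2 * lead_coeff0) / (sqrt pi * sqrt (real n)))"
      using W[of n] n by simp
    also have "\<dots> = I n * (sqrt pi * sqrt (real n)) / (pi * lead_coeff0)"
      using u0_gt_1 by simp
    also have "\<dots> = I n * sqrt (real n) / (sqrt pi * lead_coeff0)"
    proof -
      have "I n * (r * q) / ((r * r) * l) = I n * q / (r * l)" if "r \<noteq> 0" for q r l :: real
        using that by simp
      from this[of "sqrt pi" "sqrt (real n)" lead_coeff0] show ?thesis by simp
    qed
    finally show ?thesis .
  qed
  have "sharp_expansion (L_G \<rho>) (Lstar_G \<rho>) (R0_G \<rho>) c P \<delta>"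
    unfolding sharp_expansion_def W_def[symmetric]
  proof (intro allI impI)
    fix p :: nat assume "1 \<le> p"
    \<comment> \<open>With the error defined by the quotient, the expansion is an identity for n > 0
      and only the order of \<epsilon> remains to be shown.\<close>
    define \<epsilon> where "\<epsilon> n = P n / W n - (1 + (\<Sum>k=1..p. \<delta> k / real n ^ k))" for n
    obtain C where C: "\<And>\<tau>. 0 < \<tau> \<Longrightarrow> \<bar>F \<tau> - (\<Sum>k\<le>p. g k * \<tau> ^ k)\<bar> \<le> C * \<tau> ^ (p + 1) * exp (2 * \<tau>)"
      using g[of p] by blast
    have C0: "0 \<le> C"
    proof -
      have "0 \<le> C * exp 2" using C[of 1] by (simp add: order.trans[OF abs_ge_zero])
      then show ?thesis by (simp add: zero_le_mult_iff)
    qed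
    define K where "K = C * Gamma (real p + 3 / 2) * 2 powr (real p + 3 / 2) / (sqrt pi * lead_coeff0)"
    \<comment> \<open>For n \<ge> 4 one has n - 2 \<ge> n / 2, so the shift by M = 2 in Watson's
      error costs only a constant factor.\<close>
    have bound: "norm (\<epsilon> n) \<le> K * norm (1 / real n ^ (p + 1))" if n: "4 \<le> n" for n
    proof -
      have n0: "0 < real n" using n by simp
      have Q: "0 < sqrt pi * lead_coeff0" using lead_coeff0_pos by simp
      define S where "S = (\<Sum>k\<le>p. g k * Gamma (real k + 1 / 2) * real n powr (- (real k + 1 / 2)))"
      have "S * sqrt (real n) / (sqrt pi * lead_coeff0) = (\<Sum>k\<le>p. \<delta> k / real n ^ k)"
        unfolding S_def sum_distrib_right sum_divide_distrib
      proof (rule sum.cong[OF refl])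
        fix k
        have "real n powr (- (real k + 1 / 2)) * sqrt (real n) = real n powr (- (real k + 1 / 2) + 1 / 2)"
          unfolding powr_add using n0 by (simp add: powr_half_sqrt)
        also have "- (real k + 1 / 2) + 1 / 2 = - real k" by simp
        also have "real n powr (- real k) = 1 / real n ^ k" using n0 by (simp only: powr_minus_divide powr_realpow)
        finally show "g k * Gamma (real k + 1 / 2) * real n powr (- (real k + 1 / 2)) * sqrt (real n) / (sqrt pi * lead_coeff0) = \<delta> k / real n ^ k"
          by (simp add: \<delta>_def mult.assoc mult.commute[of lead_coeff0])
      qed
      also have "\<dots> = \<delta> 0 + (\<Sum>k=1..p. \<delta> k / real n ^ k)"
      proof -
        have "{..p} = insert 0 {1..p}" by auto
        then show ?thesis by simp
      qed
      also have "\<delta> 0 = 1"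
        using lead_coeff0_pos by (simp add: \<delta>_def g0 Gamma_one_half_real)
      finally have "\<epsilon> n = (I n - S) * sqrt (real n) / (sqrt pi * lead_coeff0)"
        unfolding \<epsilon>_def using quot[of n] n by (simp add: diff_divide_distrib left_diff_distrib)
      then have "norm (\<epsilon> n) = \<bar>I n - S\<bar> * sqrt (real n) / (sqrt pi * lead_coeff0)"
        using lead_coeff0_pos by (simp add: abs_mult)
      also have "\<dots> \<le> (C * Gamma (real p + 3 / 2) * (real n - 2) powr (- (real p + 3 / 2))) * sqrt (real n) / (sqrt pi * lead_coeff0)"
        using watson_lemma[OF _ F_m C, of "real n"] n Q unfolding I_def S_def
        by (intro divide_right_mono mult_right_mono) auto
      also have "\<dots> \<le> (C * Gamma (real p + 3 / 2) * (2 powr (real p + 3 / 2) * real n powr (- (real p + 3 / 2)))) * sqrt (real n) / (sqrt pi * lead_coeff0)"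
      proof -
        have "(real n - 2) powr (- (real p + 3 / 2)) \<le> (real n / 2) powr (- (real p + 3 / 2))"
          using n by (intro powr_mono2') auto
        also have "\<dots> = 2 powr (real p + 3 / 2) * real n powr (- (real p + 3 / 2))"
        proof -
          have "(real n / 2) powr (- q) = 2 powr q * real n powr (- q)" for q
            unfolding powr_minus using n0 by (simp add: powr_divide field_simps)
          then show ?thesis .
        qed
        finally show ?thesis
          using C0 Q Gamma_real_pos[of "real p + 3 / 2"] by (intro divide_right_mono mult_right_mono mult_left_mono) auto
      qed
      also have "\<dots> = K * (real n powr (- (real p + 3 / 2)) * sqrt (real n))" by (simp add: K_def mult_ac)
      also have "real n powr (- (real p + 3 / 2)) * sqrt (real n) = real n powr (- (real p + 3 / 2) + 1 / 2)"
        unfolding powr_add using n0 by (simp add: powr_half_sqrt)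
      also have "- (real p + 3 / 2) + 1 / 2 = - real (p + 1)" by simp
      also have "real n powr (- real (p + 1)) = norm (1 / real n ^ (p + 1))"
        using n0 by (simp only: powr_minus_divide powr_realpow) simp
      finally show ?thesis .
    qed
    have "\<epsilon> \<in> O(\<lambda>n. 1 / real n ^ (p + 1))"
      by (rule bigoI[of _ K]) (use bound in \<open>auto simp: eventually_at_top_linorder intro!: exI[of _ 4]\<close>)
    moreover have "\<forall>\<^sub>F n in sequentially. P n = W n * (1 + (\<Sum>k = 1..p. \<delta> k / real n ^ k) + \<epsilon> n)"
      using eventually_gt_at_top[of 0]
    proof eventually_elim
      case (elim n)
      then show ?case using W_pos[of n] by (simp add: \<epsilon>_def)
    qed
    ultimately show "\<exists>\<epsilon>\<in>O(\<lambda>n. 1 / real n ^ (p + 1)). \<forall>\<^sub>F n in sequentially.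
        P n = W n * (1 + (\<Sum>k = 1..p. \<delta> k / real n ^ k) + \<epsilon> n)"
      by blast
  qed
  then show ?thesis by blast
qed

end

section \<open>Gaussian vectors and their Gram matrix\<close>

lemma space_std_normal[simp]: "space std_normal = UNIV"
  and sets_std_normal[simp, measurable_cong]: "sets std_normal = sets borel"
  by (auto simp: std_normal_def)

lemma prob_space_std_normal: "prob_space std_normal"
  unfolding std_normal_def by (rule prob_space_normal_density) simp

interpretation std_normal: prob_space std_normal by (rule prob_space_std_normal)

interpretation std_normal_pair: pair_prob_space std_normal std_normal ..

interpretation std_normal_prod: product_prob_space "\<lambda>_::nat. std_normal" UNIV ..

lemma nn_integral_std_normal:
  assumes [measurable]: "f \<in> borel_measurable borel"
  shows "(\<integral>\<^sup>+x. f x \<partial>std_normal) = (\<integral>\<^sup>+x. ennreal (std_normal_density x) * f x \<partial>lborel)"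
  unfolding std_normal_def by (rule nn_integral_density) auto

lemma std_normal_minus:
  assumes [measurable]: "f \<in> borel_measurable borel"
  shows "(\<integral>\<^sup>+x. f (- x) \<partial>std_normal) = (\<integral>\<^sup>+x. f x \<partial>std_normal)"
proof -
  have "(\<integral>\<^sup>+x. ennreal (std_normal_density x) * f x \<partial>lborel) =
    ennreal \<bar>- 1\<bar> * (\<integral>\<^sup>+x. ennreal (std_normal_density (0 + (- 1) * x)) * f (0 + (- 1) * x) \<partial>lborel)"
    by (rule nn_integral_real_affine) auto
  then show ?thesis by (simp add: nn_integral_std_normal normal_density_def)
qed

lemma std_normal_pair_integral:
  fixes F :: "real \<times> real \<Rightarrow> ennreal"
  assumes [measurable]: "F \<in> borel_measurable (borel \<Otimes>\<^sub>M borel)"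
  shows "(\<integral>\<^sup>+z. \<integral>\<^sup>+w. F (z, w) \<partial>std_normal \<partial>std_normal) =
    (\<integral>\<^sup>+w. \<integral>\<^sup>+z. ennreal (exp (- (z\<^sup>2 + w\<^sup>2) / 2) / (2 * pi)) * F (z, w) \<partial>lborel \<partial>lborel)"
proof -
  have "(\<integral>\<^sup>+z. \<integral>\<^sup>+w. F (z, w) \<partial>std_normal \<partial>std_normal) =
     (\<integral>\<^sup>+z. \<integral>\<^sup>+w. ennreal (std_normal_density z) * (ennreal (std_normal_density w) * F (z, w)) \<partial>lborel \<partial>lborel)"
    by (simp add: nn_integral_std_normal nn_integral_cmult)
  also have "\<dots> = (\<integral>\<^sup>+w. \<integral>\<^sup>+z. ennreal (std_normal_density z) * (ennreal (std_normal_density w) * F (z, w)) \<partial>lborel \<partial>lborel)"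
    by (rule lborel_pair.Fubini') measurable
  also have "\<dots> = (\<integral>\<^sup>+w. \<integral>\<^sup>+z. ennreal (exp (- (z\<^sup>2 + w\<^sup>2) / 2) / (2 * pi)) * F (z, w) \<partial>lborel \<partial>lborel)"
  proof (intro nn_integral_cong)
    fix z w :: real
    have "exp (- z\<^sup>2 / 2) * exp (- w\<^sup>2 / 2) = exp (- (z\<^sup>2 + w\<^sup>2) / 2)"
      by (simp add: exp_add[symmetric] field_simps)
    then have "std_normal_density z * std_normal_density w = exp (- (z\<^sup>2 + w\<^sup>2) / 2) / (sqrt (2 * pi) * sqrt (2 * pi))"
      unfolding std_normal_density_def by simp
    then have "std_normal_density z * std_normal_density w = exp (- (z\<^sup>2 + w\<^sup>2) / 2) / (2 * pi)"
      by (simp del: real_sqrt_mult)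
    then show "ennreal (std_normal_density z) * (ennreal (std_normal_density w) * F (z, w)) =
      ennreal (exp (- (z\<^sup>2 + w\<^sup>2) / 2) / (2 * pi)) * F (z, w)"
      by (simp only: mult.assoc[symmetric] ennreal_mult'[symmetric] normal_density_nonneg)
  qed
  finally show ?thesis .
qed

text \<open>The rotation is a product of two maps that change a single coordinate.\<close>

lemma std_normal_rotation_aux:
  fixes F :: "real \<times> real \<Rightarrow> ennreal" and p q :: real
  assumes F[measurable]: "F \<in> borel_measurable (borel \<Otimes>\<^sub>M borel)"
    and pq: "p\<^sup>2 + q\<^sup>2 = 1" and p: "p \<noteq> 0"
  shows "(\<integral>\<^sup>+z. \<integral>\<^sup>+w. F (p * z + q * w, p * w - q * z) \<partial>std_normal \<partial>std_normal) =
    (\<integral>\<^sup>+z. \<integral>\<^sup>+w. F (z, w) \<partial>std_normal \<partial>std_normal)"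
proof -
  define G where "G x = ennreal (exp (- ((fst x)\<^sup>2 + (snd x)\<^sup>2) / 2) / (2 * pi)) * F x" for x
  have G[measurable]: "G \<in> borel_measurable (borel \<Otimes>\<^sub>M borel)"
    unfolding G_def[abs_def] by measurable
  have inv: "(p * z + q * w)\<^sup>2 + (p * w - q * z)\<^sup>2 = z\<^sup>2 + w\<^sup>2" for z w
  proof -
    have "(p * z + q * w)\<^sup>2 + (p * w - q * z)\<^sup>2 = (p\<^sup>2 + q\<^sup>2) * (z\<^sup>2 + w\<^sup>2)"
      by (simp add: power2_eq_square algebra_simps)
    then show ?thesis by (simp add: pq)
  qed
  have "(\<integral>\<^sup>+z. \<integral>\<^sup>+w. F (p * z + q * w, p * w - q * z) \<partial>std_normal \<partial>std_normal) =
    (\<integral>\<^sup>+w. \<integral>\<^sup>+z. G (p * z + q * w, p * w - q * z) \<partial>lborel \<partial>lborel)"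
    using std_normal_pair_integral[of "\<lambda>x. F (p * fst x + q * snd x, p * snd x - q * fst x)"]
    by (simp add: G_def inv)
  also have "\<dots> = (\<integral>\<^sup>+w. \<integral>\<^sup>+z. ennreal \<bar>1 / p\<bar> * G (z, (w - q * z) / p) \<partial>lborel \<partial>lborel)"
  proof (rule nn_integral_cong)
    fix w :: real
    have "(\<integral>\<^sup>+z. G (p * z + q * w, p * w - q * z) \<partial>lborel) =
      ennreal \<bar>1 / p\<bar> * (\<integral>\<^sup>+z. G (p * (- q * w / p + 1 / p * z) + q * w, p * w - q * (- q * w / p + 1 / p * z)) \<partial>lborel)"
      by (rule nn_integral_real_affine) (use p in auto)
    also have "\<dots> = ennreal \<bar>1 / p\<bar> * (\<integral>\<^sup>+z. G (z, (w - q * z) / p) \<partial>lborel)"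
    proof -
      have "p * (- q * w / p + 1 / p * z) + q * w = z" for z using p by (simp add: field_simps)
      moreover have "p * w - q * (- q * w / p + 1 / p * z) = (w - q * z) / p" for z
      proof -
        have "p * w - q * (- q * w / p + 1 / p * z) = ((p\<^sup>2 + q\<^sup>2) * w - q * z) / p"
          using p by (simp add: field_simps power2_eq_square)
        then show ?thesis by (simp add: pq)
      qed
      ultimately show ?thesis by simp
    qed
    also have "\<dots> = (\<integral>\<^sup>+z. ennreal \<bar>1 / p\<bar> * G (z, (w - q * z) / p) \<partial>lborel)"
      by (rule nn_integral_cmult[symmetric]) measurable
    finally show "(\<integral>\<^sup>+z. G (p * z + q * w, p * w - q * z) \<partial>lborel) = \<dots>" .
  qed
  also have "\<dots> = (\<integral>\<^sup>+z. \<integral>\<^sup>+w. ennreal \<bar>1 / p\<bar> * G (z, (w - q * z) / p) \<partial>lborel \<partial>lborel)"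
    by (rule lborel_pair.Fubini') measurable
  also have "\<dots> = (\<integral>\<^sup>+z. \<integral>\<^sup>+w. G (z, w) \<partial>lborel \<partial>lborel)"
  proof (rule nn_integral_cong)
    fix z :: real
    have "(\<integral>\<^sup>+w. ennreal \<bar>1 / p\<bar> * G (z, (w - q * z) / p) \<partial>lborel) =
      ennreal \<bar>p\<bar> * (\<integral>\<^sup>+w. ennreal \<bar>1 / p\<bar> * G (z, (q * z + p * w - q * z) / p) \<partial>lborel)"
      by (rule nn_integral_real_affine) (use p in auto)
    also have "\<dots> = ennreal \<bar>p\<bar> * (ennreal \<bar>1 / p\<bar> * (\<integral>\<^sup>+w. G (z, w) \<partial>lborel))"
      using p by (simp add: nn_integral_cmult)
    also have "\<dots> = (\<integral>\<^sup>+w. G (z, w) \<partial>lborel)"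
      using p by (simp add: mult.assoc[symmetric] ennreal_mult'[symmetric])
    finally show "(\<integral>\<^sup>+w. ennreal \<bar>1 / p\<bar> * G (z, (w - q * z) / p) \<partial>lborel) = (\<integral>\<^sup>+w. G (z, w) \<partial>lborel)" .
  qed
  also have "\<dots> = (\<integral>\<^sup>+w. \<integral>\<^sup>+z. G (z, w) \<partial>lborel \<partial>lborel)"
    by (rule lborel_pair.Fubini') measurable
  also have "\<dots> = (\<integral>\<^sup>+z. \<integral>\<^sup>+w. F (z, w) \<partial>std_normal \<partial>std_normal)"
    by (subst std_normal_pair_integral) (simp_all add: G_def)
  finally show ?thesis .
qed

lemma std_normal_swap:
  fixes F :: "real \<times> real \<Rightarrow> ennreal"
  assumes [measurable]: "F \<in> borel_measurable (borel \<Otimes>\<^sub>M borel)"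
  shows "(\<integral>\<^sup>+z. \<integral>\<^sup>+w. F (w, z) \<partial>std_normal \<partial>std_normal) = (\<integral>\<^sup>+z. \<integral>\<^sup>+w. F (z, w) \<partial>std_normal \<partial>std_normal)"
  by (rule std_normal_pair.Fubini') measurable

lemma std_normal_rotation:
  fixes F :: "real \<times> real \<Rightarrow> ennreal" and p q :: real
  assumes F[measurable]: "F \<in> borel_measurable (borel \<Otimes>\<^sub>M borel)"
    and pq: "p\<^sup>2 + q\<^sup>2 = 1"
  shows "(\<integral>\<^sup>+z. \<integral>\<^sup>+w. F (p * z + q * w, p * w - q * z) \<partial>std_normal \<partial>std_normal) =
    (\<integral>\<^sup>+z. \<integral>\<^sup>+w. F (z, w) \<partial>std_normal \<partial>std_normal)"
proof (cases "p = 0")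
  case False
  then show ?thesis using std_normal_rotation_aux[OF F pq] by simp
next
  \<comment> \<open>For p = 0 the first shear is not invertible; the map is then an exchange of the
    coordinates with one change of sign.\<close>
  case p: True
  then have q: "q * q = 1" "q \<noteq> 0" using pq by (auto simp: power2_eq_square)
  have "q = 1 \<or> q = - 1" using q by (simp add: square_eq_1_iff)
  then have "(\<integral>\<^sup>+z. \<integral>\<^sup>+w. F (q * w, - (q * z)) \<partial>std_normal \<partial>std_normal) =
    (\<integral>\<^sup>+z. \<integral>\<^sup>+w. F (w, z) \<partial>std_normal \<partial>std_normal)"
  proof
    assume "q = 1"
    moreover have "(\<lambda>z. \<integral>\<^sup>+w. F (w, z) \<partial>std_normal) \<in> borel_measurable borel" by measurable
    ultimately show ?thesis
      using std_normal_minus[of "\<lambda>z. \<integral>\<^sup>+w. F (w, z) \<partial>std_normal"] by simp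
  next
    assume "q = - 1"
    then show ?thesis using std_normal_minus[of "\<lambda>w. F (w, z)" for z] by simp
  qed
  then show ?thesis using p std_normal_swap[OF F] by simp
qed

section \<open>Standard normal vectors and chi-square laws\<close>

abbreviation gauss_n :: "nat \<Rightarrow> (nat \<Rightarrow> real) measure" where
  "gauss_n n \<equiv> Pi\<^sub>M {1..n} (\<lambda>_. std_normal)"

text \<open>The value k = 0 is meaningful: it gives the point mass at 0, from which the inductions
  start.\<close>

definition chi_sq :: "nat \<Rightarrow> real measure" where
  "chi_sq k = distr (gauss_n k) borel (\<lambda>y. \<Sum>i=1..k. (y i)\<^sup>2)"

lemma prob_space_gauss_n: "prob_space (gauss_n n)"
  by (intro prob_space_PiM prob_space_std_normal)

lemma sigma_finite_gauss_n: "sigma_finite_measure (gauss_n n)"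
  by (rule prob_space_imp_sigma_finite[OF prob_space_gauss_n])

lemma sigma_finite_std_normal: "sigma_finite_measure std_normal"
  by (rule prob_space_imp_sigma_finite[OF prob_space_std_normal])

lemma gauss_n_Suc_integral:
  assumes "f \<in> borel_measurable (gauss_n (Suc n))"
  shows "(\<integral>\<^sup>+x. f x \<partial>gauss_n (Suc n)) = (\<integral>\<^sup>+w. \<integral>\<^sup>+x. f (x(Suc n := w)) \<partial>gauss_n n \<partial>std_normal)"
proof -
  have e: "{1..Suc n} = insert (Suc n) {1..n}" by auto
  show ?thesis
    using std_normal_prod.product_nn_integral_insert_rev[of "{1..n}" "Suc n" f] assms unfolding e by simp
qed

lemma sum_Suc_upd: "(\<Sum>i=1..Suc n. h i ((x(Suc n := w)) i)) = (\<Sum>i=1..n. h i (x i)) + h (Suc n) w"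
  for h :: "nat \<Rightarrow> 'a \<Rightarrow> 'b::comm_monoid_add"
proof -
  have "(\<Sum>i=1..n. h i ((x(Suc n := w)) i)) = (\<Sum>i=1..n. h i (x i))" by (rule sum.cong) auto
  then show ?thesis by simp
qed

lemma sets_chi_sq[simp, measurable_cong]: "sets (chi_sq k) = sets borel"
  and space_chi_sq[simp]: "space (chi_sq k) = UNIV"
  by (auto simp: chi_sq_def)

lemma prob_space_chi_sq: "prob_space (chi_sq k)"
  unfolding chi_sq_def using prob_space_gauss_n by (rule prob_space.prob_space_distr) measurable

lemma sigma_finite_chi_sq: "sigma_finite_measure (chi_sq k)"
  by (rule prob_space_imp_sigma_finite[OF prob_space_chi_sq])

lemma Fubini_std_normal_chi_sq:
  fixes G :: "real \<times> real \<Rightarrow> ennreal"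
  assumes [measurable]: "G \<in> borel_measurable (borel \<Otimes>\<^sub>M borel)"
  shows "(\<integral>\<^sup>+w. \<integral>\<^sup>+t. G (w, t) \<partial>chi_sq k \<partial>std_normal) = (\<integral>\<^sup>+t. \<integral>\<^sup>+w. G (w, t) \<partial>std_normal \<partial>chi_sq k)"
proof -
  interpret pair_sigma_finite "chi_sq k" std_normal
    by (intro pair_sigma_finite.intro sigma_finite_chi_sq sigma_finite_std_normal)
  show ?thesis by (rule Fubini') measurable
qed

lemma chi_sq_0:
  assumes [measurable]: "G \<in> borel_measurable borel"
  shows "(\<integral>\<^sup>+t. G t \<partial>chi_sq 0) = G 0"
proof -
  have "emeasure (Pi\<^sub>M {} (\<lambda>_::nat. std_normal)) (space (Pi\<^sub>M {} (\<lambda>_::nat. std_normal))) = 1"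
    by (intro prob_space.emeasure_space_1 prob_space_PiM prob_space_std_normal)
  then show ?thesis unfolding chi_sq_def by (subst nn_integral_distr) simp_all
qed

lemma chi_sq_Suc:
  assumes [measurable]: "G \<in> borel_measurable borel"
  shows "(\<integral>\<^sup>+t. G t \<partial>chi_sq (Suc k)) = (\<integral>\<^sup>+w. \<integral>\<^sup>+t. G (t + w\<^sup>2) \<partial>chi_sq k \<partial>std_normal)"
proof -
  have "(\<integral>\<^sup>+t. G t \<partial>chi_sq (Suc k)) = (\<integral>\<^sup>+y. G (\<Sum>i=1..Suc k. (y i)\<^sup>2) \<partial>gauss_n (Suc k))"
    unfolding chi_sq_def by (rule nn_integral_distr) measurable
  also have "\<dots> = (\<integral>\<^sup>+w. \<integral>\<^sup>+y. G (\<Sum>i=1..Suc k. ((y(Suc k := w)) i)\<^sup>2) \<partial>gauss_n k \<partial>std_normal)"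
    by (rule gauss_n_Suc_integral) measurable
  also have "\<dots> = (\<integral>\<^sup>+w. \<integral>\<^sup>+y. G ((\<Sum>i=1..k. (y i)\<^sup>2) + w\<^sup>2) \<partial>gauss_n k \<partial>std_normal)"
    by (simp only: sum_Suc_upd[of "\<lambda>_ x. x\<^sup>2"])
  also have "\<dots> = (\<integral>\<^sup>+w. \<integral>\<^sup>+t. G (t + w\<^sup>2) \<partial>chi_sq k \<partial>std_normal)"
    unfolding chi_sq_def by (intro nn_integral_cong nn_integral_distr[symmetric]) measurable
  finally show ?thesis .
qed

lemma rotation_norm_square:
  fixes p q z w :: real
  shows "(p * z + q * w)\<^sup>2 + (p * w - q * z)\<^sup>2 = (p\<^sup>2 + q\<^sup>2) * (z\<^sup>2 + w\<^sup>2)"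
  by (simp add: power2_eq_square algebra_simps)

text \<open>The plane is rotated so that the first axis points along (\<alpha>, \<beta>); the
  squared norm does not change.\<close>

lemma std_normal_linear_form:
  fixes H :: "real \<times> real \<Rightarrow> ennreal" and \<alpha> \<beta> :: real
  assumes H[measurable]: "H \<in> borel_measurable (borel \<Otimes>\<^sub>M borel)"
  shows "(\<integral>\<^sup>+z. \<integral>\<^sup>+w. H (\<alpha> * z + \<beta> * w, z\<^sup>2 + w\<^sup>2) \<partial>std_normal \<partial>std_normal) =
    (\<integral>\<^sup>+z. \<integral>\<^sup>+w. H (sqrt (\<alpha>\<^sup>2 + \<beta>\<^sup>2) * z, z\<^sup>2 + w\<^sup>2) \<partial>std_normal \<partial>std_normal)"
proof (cases "\<alpha> = 0 \<and> \<beta> = 0")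
  case False
  define r where "r = sqrt (\<alpha>\<^sup>2 + \<beta>\<^sup>2)"
  have r2: "r\<^sup>2 = \<alpha>\<^sup>2 + \<beta>\<^sup>2" by (simp add: r_def)
  have r: "r \<noteq> 0" using False by (simp add: r_def sum_power2_eq_zero_iff)
  have one: "(\<alpha> / r)\<^sup>2 + (\<beta> / r)\<^sup>2 = 1"
  proof -
    have "(\<alpha> / r)\<^sup>2 + (\<beta> / r)\<^sup>2 = (\<alpha>\<^sup>2 + \<beta>\<^sup>2) / r\<^sup>2" by (simp add: power_divide add_divide_distrib)
    then show ?thesis unfolding r2[symmetric] using r by simp
  qed
  have inv: "(\<alpha> / r * z + \<beta> / r * w)\<^sup>2 + (\<alpha> / r * w - \<beta> / r * z)\<^sup>2 = z\<^sup>2 + w\<^sup>2" for z w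
    unfolding rotation_norm_square one by simp
  have lin: "r * (\<alpha> / r * z + \<beta> / r * w) = \<alpha> * z + \<beta> * w" for z w using r by (simp add: field_simps)
  show ?thesis
    using std_normal_rotation[of "\<lambda>x. H (r * fst x, (fst x)\<^sup>2 + (snd x)\<^sup>2)", OF _ one]
    by (simp add: inv lin r_def[symmetric] del: times_divide_eq_left)
qed simp

lemma std_normal_abs_form:
  fixes H :: "real \<times> real \<Rightarrow> ennreal"
  assumes H[measurable]: "H \<in> borel_measurable (borel \<Otimes>\<^sub>M borel)"
  shows "(\<integral>\<^sup>+w. H (\<beta> * w, w\<^sup>2) \<partial>std_normal) = (\<integral>\<^sup>+w. H (\<bar>\<beta>\<bar> * w, w\<^sup>2) \<partial>std_normal)"
  using std_normal_minus[of "\<lambda>w. H (\<beta> * w, w\<^sup>2)"] by (cases "0 \<le> \<beta>") simp_all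

section \<open>Centred statistics of a normal vector\<close>

definition centered_norm :: "nat \<Rightarrow> (nat \<Rightarrow> real) \<Rightarrow> real" where
  "centered_norm n x = sqrt (\<Sum>i=1..n. (x i - sample_mean n x)\<^sup>2)"

lemma sum_eq_sample_mean: "0 < n \<Longrightarrow> (\<Sum>i=1..n. x i) = real n * sample_mean n x"
  by (simp add: sample_mean_def)

lemma centered_sum_squares:
  assumes "0 < n"
  shows "(\<Sum>i=1..n. (x i - sample_mean n x)\<^sup>2) = (\<Sum>i=1..n. (x i)\<^sup>2) - real n * (sample_mean n x)\<^sup>2"
proof -
  have "(\<Sum>i=1..n. (x i - sample_mean n x)\<^sup>2) =
      (\<Sum>i=1..n. (x i)\<^sup>2) - 2 * sample_mean n x * (\<Sum>i=1..n. x i) + real n * (sample_mean n x)\<^sup>2"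
    by (simp add: power2_diff sum.distrib sum_subtractf sum_distrib_left algebra_simps)
  then show ?thesis unfolding sum_eq_sample_mean[OF assms] by (simp add: power2_eq_square)
qed

lemma centered_sum_product:
  assumes "0 < n"
  shows "(\<Sum>i=1..n. (x i - sample_mean n x) * (y i - sample_mean n y)) =
    (\<Sum>i=1..n. x i * y i) - real n * sample_mean n x * sample_mean n y"
proof -
  have "(\<Sum>i=1..n. (x i - sample_mean n x) * (y i - sample_mean n y)) =
      (\<Sum>i=1..n. x i * y i) - sample_mean n x * (\<Sum>i=1..n. y i) - sample_mean n y * (\<Sum>i=1..n. x i)
      + real n * sample_mean n x * sample_mean n y"
    by (simp add: sum.distrib sum_subtractf sum_distrib_left algebra_simps)
  then show ?thesis unfolding sum_eq_sample_mean[OF assms] by simp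
qed

lemma sample_mean_Suc: "real (Suc n) * sample_mean (Suc n) x = real n * sample_mean n x + x (Suc n)"
  by (cases "n = 0") (simp_all add: sum_eq_sample_mean[symmetric] sample_mean_def)

lemma centered_norm_square: "(centered_norm n x)\<^sup>2 = (\<Sum>i=1..n. (x i - sample_mean n x)\<^sup>2)"
  by (simp add: centered_norm_def sum_nonneg)

lemma centered_norm_nonneg: "0 \<le> centered_norm n x"
  by (simp add: centered_norm_def sum_nonneg)

text \<open>Welford's update of the centred sum of squares, written as a sum of two squares so that
  the added term can serve as a coefficient in a plane rotation.\<close>

lemma centered_norm_Suc:
  assumes n: "0 < n"
  shows "(centered_norm (Suc n) x)\<^sup>2 =
    (centered_norm n x)\<^sup>2 + (sqrt (real n) / sqrt (real (Suc n)) * (x (Suc n) - sample_mean n x))\<^sup>2"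
proof -
  define m m' N \<xi> where "m = sample_mean n x" and "m' = sample_mean (Suc n) x" and "N = real n" and "\<xi> = x (Suc n)"
  have N: "0 < N" using n by (simp add: N_def)
  have e: "(N + 1) * m' = N * m + \<xi>"
    using sample_mean_Suc[of n x] by (simp add: m_def m'_def N_def \<xi>_def add.commute)
  then have m': "m' = (N * m + \<xi>) / (N + 1)" using N by (simp add: field_simps)
  have "(N + 1) * m'\<^sup>2 = (N * m + \<xi>)\<^sup>2 / (N + 1)" unfolding m' using N by (simp add: power2_eq_square)
  also have "\<dots> = N * m\<^sup>2 + \<xi>\<^sup>2 - N / (N + 1) * (\<xi> - m)\<^sup>2"
    using N by (simp add: field_simps power2_eq_square)
  finally have e2: "(N + 1) * m'\<^sup>2 = N * m\<^sup>2 + \<xi>\<^sup>2 - N / (N + 1) * (\<xi> - m)\<^sup>2" .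
  have "(centered_norm n x)\<^sup>2 = (\<Sum>i=1..n. (x i)\<^sup>2) - N * m\<^sup>2"
    unfolding centered_norm_square centered_sum_squares[OF n] m_def N_def ..
  moreover have "(centered_norm (Suc n) x)\<^sup>2 = (\<Sum>i=1..n. (x i)\<^sup>2) + \<xi>\<^sup>2 - (N + 1) * m'\<^sup>2"
    unfolding centered_norm_square centered_sum_squares[OF zero_less_Suc] m'_def N_def \<xi>_def by (simp add: add.commute)
  moreover have "(sqrt N / sqrt (real (Suc n)) * (\<xi> - m))\<^sup>2 = N / (N + 1) * (\<xi> - m)\<^sup>2"
    using N by (simp add: power_mult_distrib power_divide N_def add.commute)
  ultimately show ?thesis using e2 by (simp add: m_def N_def \<xi>_def)
qed

text \<open>Adding one coordinate is absorbed by two plane rotations: one for the mean, one for the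
  component along the centred vector \<open>x\<close>.\<close>

lemma gauss_n_statistics:
  fixes f :: "real \<times> real \<times> real \<Rightarrow> ennreal" and x :: "nat \<Rightarrow> real"
  assumes "f \<in> borel_measurable (borel \<Otimes>\<^sub>M borel \<Otimes>\<^sub>M borel)"
  shows "(\<integral>\<^sup>+V. f (\<Sum>i=1..k+2. V i, \<Sum>i=1..k+2. x i * V i, \<Sum>i=1..k+2. (V i)\<^sup>2) \<partial>gauss_n (k + 2)) =
    (\<integral>\<^sup>+t. \<integral>\<^sup>+z. \<integral>\<^sup>+g. f (sqrt (real (k + 2)) * g,
        sample_mean (k + 2) x * (sqrt (real (k + 2)) * g) + centered_norm (k + 2) x * z,
        g\<^sup>2 + (z\<^sup>2 + t)) \<partial>std_normal \<partial>std_normal \<partial>chi_sq k)"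
  using assms
proof (induction k arbitrary: f)
  case 0
  note [measurable] = 0
  \<comment> \<open>In dimension 2 the centred part of x is its component along (-1, 1) / sqrt 2;
    this signed length is \<beta>.\<close>
  define \<beta> where "\<beta> = (x 2 - x 1) / sqrt 2"
  have mean2: "sample_mean 2 x = (x 1 + x 2) / 2"
    by (simp add: sample_mean_def numeral_2_eq_2)
  have norm2: "centered_norm 2 x = \<bar>\<beta>\<bar>"
  proof -
    have "(\<Sum>i=1..2. (x i - sample_mean 2 x)\<^sup>2) = \<beta>\<^sup>2"
      unfolding mean2 by (simp add: numeral_2_eq_2 \<beta>_def power2_eq_square field_simps)
    then show ?thesis by (simp add: centered_norm_def)
  qed
  have one: "(1 / sqrt 2)\<^sup>2 + (1 / sqrt 2 :: real)\<^sup>2 = 1" by (simp add: power_divide)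
  have "(\<integral>\<^sup>+V. f (\<Sum>i=1..2. V i, \<Sum>i=1..2. x i * V i, \<Sum>i=1..2. (V i)\<^sup>2) \<partial>gauss_n 2) =
    (\<integral>\<^sup>+w. \<integral>\<^sup>+v. f (v + w, x 1 * v + x 2 * w, v\<^sup>2 + w\<^sup>2) \<partial>std_normal \<partial>std_normal)"
  proof -
    have "(\<integral>\<^sup>+V. f (\<Sum>i=1..Suc 1. V i, \<Sum>i=1..Suc 1. x i * V i, \<Sum>i=1..Suc 1. (V i)\<^sup>2) \<partial>gauss_n (Suc 1)) =
      (\<integral>\<^sup>+w. \<integral>\<^sup>+V. f (\<Sum>i=1..Suc 1. (V(Suc 1 := w)) i, \<Sum>i=1..Suc 1. x i * (V(Suc 1 := w)) i, \<Sum>i=1..Suc 1. ((V(Suc 1 := w)) i)\<^sup>2) \<partial>gauss_n 1 \<partial>std_normal)"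
      by (rule gauss_n_Suc_integral) measurable
    also have "\<dots> = (\<integral>\<^sup>+w. \<integral>\<^sup>+v. f (v + w, x 1 * v + x 2 * w, v\<^sup>2 + w\<^sup>2) \<partial>std_normal \<partial>std_normal)"
    proof (rule nn_integral_cong)
      fix w :: real
      have "(\<integral>\<^sup>+V. f (V 1 + w, x 1 * V 1 + x 2 * w, (V 1)\<^sup>2 + w\<^sup>2) \<partial>Pi\<^sub>M {1::nat} (\<lambda>_. std_normal)) =
        (\<integral>\<^sup>+v. f (v + w, x 1 * v + x 2 * w, v\<^sup>2 + w\<^sup>2) \<partial>std_normal)"
        by (rule std_normal_prod.product_nn_integral_singleton[of "\<lambda>v. f (v + w, x 1 * v + x 2 * w, v\<^sup>2 + w\<^sup>2)"]) measurable
      then show "(\<integral>\<^sup>+V. f (\<Sum>i=1..Suc 1. (V(Suc 1 := w)) i, \<Sum>i=1..Suc 1. x i * (V(Suc 1 := w)) i, \<Sum>i=1..Suc 1. ((V(Suc 1 := w)) i)\<^sup>2) \<partial>gauss_n 1) =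
        (\<integral>\<^sup>+v. f (v + w, x 1 * v + x 2 * w, v\<^sup>2 + w\<^sup>2) \<partial>std_normal)"
        by (simp add: numeral_2_eq_2)
    qed
    finally show ?thesis by (simp add: numeral_2_eq_2)
  qed
  also have "\<dots> = (\<integral>\<^sup>+v. \<integral>\<^sup>+w. f (v + w, x 1 * v + x 2 * w, v\<^sup>2 + w\<^sup>2) \<partial>std_normal \<partial>std_normal)"
    by (rule std_normal_pair.Fubini') measurable
  also have "\<dots> = (\<integral>\<^sup>+g. \<integral>\<^sup>+w. f (sqrt 2 * g, sample_mean 2 x * (sqrt 2 * g) + \<beta> * w, g\<^sup>2 + w\<^sup>2) \<partial>std_normal \<partial>std_normal)"
  proof -
    define F where "F y = f (sqrt 2 * fst y, sample_mean 2 x * (sqrt 2 * fst y) + \<beta> * snd y, (fst y)\<^sup>2 + (snd y)\<^sup>2)" for y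
    have [measurable]: "F \<in> borel_measurable (borel \<Otimes>\<^sub>M borel)" unfolding F_def[abs_def] by measurable
    have "F (1 / sqrt 2 * v + 1 / sqrt 2 * w, 1 / sqrt 2 * w - 1 / sqrt 2 * v) = f (v + w, x 1 * v + x 2 * w, v\<^sup>2 + w\<^sup>2)" for v w
    proof -
      have 1: "sqrt 2 * (1 / sqrt 2 * v + 1 / sqrt 2 * w) = v + w" by (simp add: field_simps)
      have 2: "sample_mean 2 x * (v + w) + \<beta> * (1 / sqrt 2 * w - 1 / sqrt 2 * v) = x 1 * v + x 2 * w"
        unfolding mean2 \<beta>_def by (simp add: field_simps)
      have 3: "(1 / sqrt 2 * v + 1 / sqrt 2 * w)\<^sup>2 + (1 / sqrt 2 * w - 1 / sqrt 2 * v)\<^sup>2 = v\<^sup>2 + w\<^sup>2"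
        by (simp add: power2_eq_square field_simps)
      show ?thesis unfolding F_def fst_conv snd_conv 1 2 3 ..
    qed
    then show ?thesis using std_normal_rotation[OF _ one, of F] by (simp add: F_def)
  qed
  \<comment> \<open>\<beta> may be negative; the symmetry of w replaces it by the centred
    norm.\<close>
  also have "\<dots> = (\<integral>\<^sup>+g. \<integral>\<^sup>+w. f (sqrt 2 * g, sample_mean 2 x * (sqrt 2 * g) + \<bar>\<beta>\<bar> * w, g\<^sup>2 + w\<^sup>2) \<partial>std_normal \<partial>std_normal)"
    by (intro nn_integral_cong std_normal_abs_form[of "\<lambda>y. f (sqrt 2 * g, sample_mean 2 x * (sqrt 2 * g) + fst y, g\<^sup>2 + snd y)" for g, simplified]) measurable
  also have "\<dots> = (\<integral>\<^sup>+z. \<integral>\<^sup>+g. f (sqrt 2 * g, sample_mean 2 x * (sqrt 2 * g) + \<bar>\<beta>\<bar> * z, g\<^sup>2 + z\<^sup>2) \<partial>std_normal \<partial>std_normal)"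
    by (rule std_normal_pair.Fubini') measurable
  also have "\<dots> = (\<integral>\<^sup>+t. \<integral>\<^sup>+z. \<integral>\<^sup>+g. f (sqrt 2 * g, sample_mean 2 x * (sqrt 2 * g) + \<bar>\<beta>\<bar> * z, g\<^sup>2 + (z\<^sup>2 + t)) \<partial>std_normal \<partial>std_normal \<partial>chi_sq 0)"
    by (subst chi_sq_0) simp_all
  finally show ?case unfolding add_0_left norm2 by (simp only: of_nat_numeral)
next
  case (Suc k)
  note [measurable] = Suc.prems
  define n where "n = k + 2"
  have n: "0 < n" "Suc k + 2 = Suc n" by (auto simp: n_def)
  define m m' r r' \<xi> where "m = sample_mean n x" and "m' = sample_mean (Suc n) x"
    and "r = centered_norm n x" and "r' = centered_norm (Suc n) x" and "\<xi> = x (Suc n)"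
  define a b where "a = sqrt (real n)" and "b = sqrt (real (Suc n))"
  have ab: "0 < a" "0 < b" "a * a = real n" "b * b = real n + 1" "b * b = a * a + 1" using n by (auto simp: a_def b_def)
  \<comment> \<open>The unit constant vector of dimension n + 1 has coordinates a/b and 1/b with
    respect to the unit constant vector of dimension n and the new axis; these are the entries of
    the first rotation.\<close>
  have one: "(a / b)\<^sup>2 + (1 / b)\<^sup>2 = 1"
    using ab by (simp add: power_divide power2_eq_square add_divide_distrib[symmetric])
  \<comment> \<open>The coefficient of the new direction in the centred vector, as in
    \<open>centered_norm_Suc\<close>.\<close>
  define \<beta> where "\<beta> = a / b * (\<xi> - m)"
  have r': "r' = sqrt (r\<^sup>2 + \<beta>\<^sup>2)"
    using centered_norm_Suc[OF n(1), of x] centered_norm_nonneg[of "Suc n" x]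
    by (simp add: r'_def r_def \<beta>_def a_def b_def m_def \<xi>_def real_sqrt_unique)
  have m': "b * b * m' = a * a * m + \<xi>"
    using sample_mean_Suc[of n x] unfolding ab(3,4) by (simp add: m'_def m_def \<xi>_def add.commute)
  have "(\<integral>\<^sup>+V. f (\<Sum>i=1..Suc n. V i, \<Sum>i=1..Suc n. x i * V i, \<Sum>i=1..Suc n. (V i)\<^sup>2) \<partial>gauss_n (Suc n)) =
    (\<integral>\<^sup>+w. \<integral>\<^sup>+V. f (\<Sum>i=1..Suc n. (V(Suc n := w)) i, \<Sum>i=1..Suc n. x i * (V(Suc n := w)) i, \<Sum>i=1..Suc n. ((V(Suc n := w)) i)\<^sup>2) \<partial>gauss_n n \<partial>std_normal)"
    by (rule gauss_n_Suc_integral) measurable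
  also have "\<dots> = (\<integral>\<^sup>+w. \<integral>\<^sup>+V. f ((\<Sum>i=1..n. V i) + w, (\<Sum>i=1..n. x i * V i) + \<xi> * w, (\<Sum>i=1..n. (V i)\<^sup>2) + w\<^sup>2) \<partial>gauss_n n \<partial>std_normal)"
    unfolding \<xi>_def by (simp only: sum_Suc_upd[of "\<lambda>_ x. x"] sum_Suc_upd[of "\<lambda>_ x. x\<^sup>2"] sum_Suc_upd[of "\<lambda>i y. x i * y"])
  also have "\<dots> = (\<integral>\<^sup>+w. \<integral>\<^sup>+t. \<integral>\<^sup>+z. \<integral>\<^sup>+g. f (a * g + w, m * (a * g) + r * z + \<xi> * w, g\<^sup>2 + (z\<^sup>2 + t) + w\<^sup>2) \<partial>std_normal \<partial>std_normal \<partial>chi_sq k \<partial>std_normal)"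
  proof (rule nn_integral_cong)
    fix w :: real
    define f' where "f' y = f (fst y + w, fst (snd y) + \<xi> * w, snd (snd y) + w\<^sup>2)" for y
    have [measurable]: "f' \<in> borel_measurable (borel \<Otimes>\<^sub>M borel \<Otimes>\<^sub>M borel)"
      unfolding f'_def[abs_def] by measurable
    show "(\<integral>\<^sup>+V. f ((\<Sum>i=1..n. V i) + w, (\<Sum>i=1..n. x i * V i) + \<xi> * w, (\<Sum>i=1..n. (V i)\<^sup>2) + w\<^sup>2) \<partial>gauss_n n) =
      (\<integral>\<^sup>+t. \<integral>\<^sup>+z. \<integral>\<^sup>+g. f (a * g + w, m * (a * g) + r * z + \<xi> * w, g\<^sup>2 + (z\<^sup>2 + t) + w\<^sup>2) \<partial>std_normal \<partial>std_normal \<partial>chi_sq k)"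
      using Suc.IH[of f'] unfolding n_def[symmetric] by (simp add: f'_def a_def m_def r_def)
  qed
  also have "\<dots> = (\<integral>\<^sup>+t. \<integral>\<^sup>+w. \<integral>\<^sup>+z. \<integral>\<^sup>+g. f (a * g + w, m * (a * g) + r * z + \<xi> * w, g\<^sup>2 + (z\<^sup>2 + t) + w\<^sup>2) \<partial>std_normal \<partial>std_normal \<partial>std_normal \<partial>chi_sq k)"
    using Fubini_std_normal_chi_sq[of "\<lambda>y. \<integral>\<^sup>+z. \<integral>\<^sup>+g. f (a * g + fst y, m * (a * g) + r * z + \<xi> * fst y, g\<^sup>2 + (z\<^sup>2 + snd y) + (fst y)\<^sup>2) \<partial>std_normal \<partial>std_normal" k]
    by simp
  also have "\<dots> = (\<integral>\<^sup>+t. \<integral>\<^sup>+z. \<integral>\<^sup>+w. \<integral>\<^sup>+g. f (a * g + w, m * (a * g) + r * z + \<xi> * w, g\<^sup>2 + (z\<^sup>2 + t) + w\<^sup>2) \<partial>std_normal \<partial>std_normal \<partial>std_normal \<partial>chi_sq k)"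
    by (rule nn_integral_cong, rule std_normal_pair.Fubini') measurable
  also have "\<dots> = (\<integral>\<^sup>+t. \<integral>\<^sup>+z. \<integral>\<^sup>+g. \<integral>\<^sup>+w. f (a * g + w, m * (a * g) + r * z + \<xi> * w, g\<^sup>2 + (z\<^sup>2 + t) + w\<^sup>2) \<partial>std_normal \<partial>std_normal \<partial>std_normal \<partial>chi_sq k)"
    by (rule nn_integral_cong, rule nn_integral_cong, rule std_normal_pair.Fubini') measurable
  \<comment> \<open>The rotation of (g, w) makes g the coordinate along the constant vectors in
    dimension n + 1; w becomes a centred coordinate.\<close>
  also have "\<dots> = (\<integral>\<^sup>+t. \<integral>\<^sup>+z. \<integral>\<^sup>+g. \<integral>\<^sup>+w. f (b * g, m' * (b * g) + (r * z + \<beta> * w), g\<^sup>2 + ((z\<^sup>2 + w\<^sup>2) + t)) \<partial>std_normal \<partial>std_normal \<partial>std_normal \<partial>chi_sq k)"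
  proof (rule nn_integral_cong, rule nn_integral_cong)
    fix t z :: real
    define F where "F y = f (b * fst y, m' * (b * fst y) + (r * z + \<beta> * snd y), (fst y)\<^sup>2 + ((z\<^sup>2 + (snd y)\<^sup>2) + t))" for y
    have [measurable]: "F \<in> borel_measurable (borel \<Otimes>\<^sub>M borel)" unfolding F_def[abs_def] by measurable
    have "F (a / b * g + 1 / b * w, a / b * w - 1 / b * g) = f (a * g + w, m * (a * g) + r * z + \<xi> * w, g\<^sup>2 + (z\<^sup>2 + t) + w\<^sup>2)" for g w
    proof -
      have 1: "b * (a / b * g + 1 / b * w) = a * g + w" using ab(2) by (simp add: field_simps)
      have 2: "m' * (a * g + w) + (r * z + \<beta> * (a / b * w - 1 / b * g)) = m * (a * g) + r * z + \<xi> * w"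
      proof -
        have "b * b * (m' * (a * g + w) + \<beta> * (a / b * w - 1 / b * g)) = (b * b * m') * (a * g + w) + a * (\<xi> - m) * (a * w - g)"
          using ab(2) by (simp add: \<beta>_def field_simps)
        also have "\<dots> = (a * a + 1) * (m * (a * g) + \<xi> * w)" unfolding m' by (simp add: algebra_simps)
        finally have "b * b * (m' * (a * g + w) + \<beta> * (a / b * w - 1 / b * g)) = b * b * (m * (a * g) + \<xi> * w)"
          unfolding ab(5) .
        then have "m' * (a * g + w) + \<beta> * (a / b * w - 1 / b * g) = m * (a * g) + \<xi> * w" using ab(2) by simp
        then show ?thesis by simp
      qed
      have 3: "(a / b * g + 1 / b * w)\<^sup>2 + (z\<^sup>2 + (a / b * w - 1 / b * g)\<^sup>2 + t) = g\<^sup>2 + (z\<^sup>2 + t) + w\<^sup>2"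
      proof -
        have "(a / b * g + 1 / b * w)\<^sup>2 + (a / b * w - 1 / b * g)\<^sup>2 = g\<^sup>2 + w\<^sup>2"
          unfolding rotation_norm_square one by simp
        then show ?thesis by simp
      qed
      show ?thesis unfolding F_def fst_conv snd_conv 1 2 3 ..
    qed
    then show "(\<integral>\<^sup>+g. \<integral>\<^sup>+w. f (a * g + w, m * (a * g) + r * z + \<xi> * w, g\<^sup>2 + (z\<^sup>2 + t) + w\<^sup>2) \<partial>std_normal \<partial>std_normal) =
      (\<integral>\<^sup>+g. \<integral>\<^sup>+w. f (b * g, m' * (b * g) + (r * z + \<beta> * w), g\<^sup>2 + ((z\<^sup>2 + w\<^sup>2) + t)) \<partial>std_normal \<partial>std_normal)"
      using std_normal_rotation[OF _ one, of F] by (simp add: F_def)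
  qed
  also have "\<dots> = (\<integral>\<^sup>+t. \<integral>\<^sup>+z. \<integral>\<^sup>+w. \<integral>\<^sup>+g. f (b * g, m' * (b * g) + (r * z + \<beta> * w), g\<^sup>2 + ((z\<^sup>2 + w\<^sup>2) + t)) \<partial>std_normal \<partial>std_normal \<partial>std_normal \<partial>chi_sq k)"
    by (rule nn_integral_cong, rule nn_integral_cong, rule std_normal_pair.Fubini') measurable
  \<comment> \<open>The rotation of (z, w) aligns z with the new centred vector. What is left of w
    occurs only as w^2 and will turn \<open>chi_sq k\<close> into
    \<open>chi_sq (Suc k)\<close>.\<close>
  also have "\<dots> = (\<integral>\<^sup>+t. \<integral>\<^sup>+z. \<integral>\<^sup>+w. \<integral>\<^sup>+g. f (b * g, m' * (b * g) + r' * z, g\<^sup>2 + ((z\<^sup>2 + w\<^sup>2) + t)) \<partial>std_normal \<partial>std_normal \<partial>std_normal \<partial>chi_sq k)"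
    unfolding r'
    by (intro nn_integral_cong std_normal_linear_form[of "\<lambda>y. \<integral>\<^sup>+g. f (b * g, m' * (b * g) + fst y, g\<^sup>2 + (snd y + t)) \<partial>std_normal" for t, simplified]) measurable
  also have "\<dots> = (\<integral>\<^sup>+t. \<integral>\<^sup>+w. \<integral>\<^sup>+z. \<integral>\<^sup>+g. f (b * g, m' * (b * g) + r' * z, g\<^sup>2 + ((z\<^sup>2 + w\<^sup>2) + t)) \<partial>std_normal \<partial>std_normal \<partial>std_normal \<partial>chi_sq k)"
    by (rule nn_integral_cong, rule std_normal_pair.Fubini') measurable
  also have "\<dots> = (\<integral>\<^sup>+w. \<integral>\<^sup>+t. \<integral>\<^sup>+z. \<integral>\<^sup>+g. f (b * g, m' * (b * g) + r' * z, g\<^sup>2 + ((z\<^sup>2 + w\<^sup>2) + t)) \<partial>std_normal \<partial>std_normal \<partial>chi_sq k \<partial>std_normal)"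
    using Fubini_std_normal_chi_sq[of "\<lambda>y. \<integral>\<^sup>+z. \<integral>\<^sup>+g. f (b * g, m' * (b * g) + r' * z, g\<^sup>2 + ((z\<^sup>2 + (fst y)\<^sup>2) + snd y)) \<partial>std_normal \<partial>std_normal" k]
    by simp
  also have "\<dots> = (\<integral>\<^sup>+t. \<integral>\<^sup>+z. \<integral>\<^sup>+g. f (b * g, m' * (b * g) + r' * z, g\<^sup>2 + (z\<^sup>2 + t)) \<partial>std_normal \<partial>std_normal \<partial>chi_sq (Suc k))"
    by (subst chi_sq_Suc) (simp_all add: add_ac)
  finally show ?case unfolding n(2) by (simp add: m'_def b_def r'_def)
qed

text \<open>Centred sums are functions of the three raw sums, and in these functions the coordinate
  g along the constant vectors cancels; it then integrates to 1.\<close>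

lemma gauss_n_centered_statistics:
  fixes f :: "real \<times> real \<Rightarrow> ennreal" and x :: "nat \<Rightarrow> real"
  assumes [measurable]: "f \<in> borel_measurable (borel \<Otimes>\<^sub>M borel)"
  shows "(\<integral>\<^sup>+V. f (\<Sum>i=1..k+2. (x i - sample_mean (k + 2) x) * (V i - sample_mean (k + 2) V),
      \<Sum>i=1..k+2. (V i - sample_mean (k + 2) V)\<^sup>2) \<partial>gauss_n (k + 2)) =
    (\<integral>\<^sup>+t. \<integral>\<^sup>+z. f (centered_norm (k + 2) x * z, z\<^sup>2 + t) \<partial>std_normal \<partial>chi_sq k)"
proof -
  define n where "n = k + 2"
  have n: "0 < n" by (simp add: n_def)
  define f' where "f' y = f (fst (snd y) - sample_mean n x * fst y, snd (snd y) - (fst y)\<^sup>2 / real n)" for y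
  have [measurable]: "f' \<in> borel_measurable (borel \<Otimes>\<^sub>M borel \<Otimes>\<^sub>M borel)"
    unfolding f'_def[abs_def] by measurable
  have 1: "f' (\<Sum>i=1..n. V i, \<Sum>i=1..n. x i * V i, \<Sum>i=1..n. (V i)\<^sup>2) =
    f (\<Sum>i=1..n. (x i - sample_mean n x) * (V i - sample_mean n V), \<Sum>i=1..n. (V i - sample_mean n V)\<^sup>2)" for V
    unfolding f'_def centered_sum_product[OF n] centered_sum_squares[OF n] fst_conv snd_conv sum_eq_sample_mean[OF n, of V]
    using n by (simp add: power2_eq_square mult_ac)
  have 2: "f' (sqrt (real n) * g, sample_mean n x * (sqrt (real n) * g) + centered_norm n x * z, g\<^sup>2 + (z\<^sup>2 + t))
    = f (centered_norm n x * z, z\<^sup>2 + t)" for g z t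
    using n by (simp add: f'_def power_mult_distrib)
  have "(\<integral>\<^sup>+V. f' (\<Sum>i=1..n. V i, \<Sum>i=1..n. x i * V i, \<Sum>i=1..n. (V i)\<^sup>2) \<partial>gauss_n n) =
    (\<integral>\<^sup>+t. \<integral>\<^sup>+z. \<integral>\<^sup>+g. f' (sqrt (real n) * g,
        sample_mean n x * (sqrt (real n) * g) + centered_norm n x * z,
        g\<^sup>2 + (z\<^sup>2 + t)) \<partial>std_normal \<partial>std_normal \<partial>chi_sq k)"
    unfolding n_def by (rule gauss_n_statistics) measurable
  then show ?thesis
    unfolding 1 2 by (simp add: std_normal.emeasure_space_1[simplified] n_def)
qed

section \<open>Chi-square densities and the law of the Gram matrix\<close>

lemma gauss_n_centered_norm:
  fixes f :: "real \<Rightarrow> ennreal"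
  assumes [measurable]: "f \<in> borel_measurable borel"
  shows "(\<integral>\<^sup>+V. f ((centered_norm (k + 2) V)\<^sup>2) \<partial>gauss_n (k + 2)) = (\<integral>\<^sup>+\<sigma>. f \<sigma> \<partial>chi_sq (Suc k))"
proof -
  have "(\<integral>\<^sup>+V. f ((centered_norm (k + 2) V)\<^sup>2) \<partial>gauss_n (k + 2)) =
    (\<integral>\<^sup>+t. \<integral>\<^sup>+z. f (z\<^sup>2 + t) \<partial>std_normal \<partial>chi_sq k)"
    using gauss_n_centered_statistics[of "\<lambda>y. f (snd y)" k] by (simp add: centered_norm_square)
  also have "\<dots> = (\<integral>\<^sup>+z. \<integral>\<^sup>+t. f (z\<^sup>2 + t) \<partial>chi_sq k \<partial>std_normal)"
    using Fubini_std_normal_chi_sq[of "\<lambda>y. f ((fst y)\<^sup>2 + snd y)" k] by simp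
  also have "\<dots> = (\<integral>\<^sup>+\<sigma>. f \<sigma> \<partial>chi_sq (Suc k))"
    by (subst chi_sq_Suc) (simp_all add: add.commute)
  finally show ?thesis .
qed

text \<open>Induction on the number of squares: with w = s x the pair (s, w) is described by the
  radius r = s sqrt(1 + x^2) and the slope x, in which the density is a product. The integral over x
  joins the constant, which is left unspecified.\<close>

lemma nn_integral_chi_sq:
  assumes "0 < k"
  shows "\<exists>C::ennreal. \<forall>G\<in>borel_measurable borel. (\<integral>\<^sup>+\<sigma>. G \<sigma> \<partial>chi_sq k) =
    C * (\<integral>\<^sup>+s. ennreal (indicator {0<..} s * (s ^ (k - 1) * exp (- s\<^sup>2 / 2))) * G (s\<^sup>2) \<partial>lborel)"
  using assms
proof (induction k)
  case (Suc k)
  show ?case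
  proof (cases "k = 0")
    case True
    have "(\<integral>\<^sup>+\<sigma>. G \<sigma> \<partial>chi_sq 1) = 2 * ennreal (1 / sqrt (2 * pi)) *
      (\<integral>\<^sup>+s. ennreal (indicator {0<..} s * (s ^ 0 * exp (- s\<^sup>2 / 2))) * G (s\<^sup>2) \<partial>lborel)"
      if [measurable]: "G \<in> borel_measurable borel" for G :: "real \<Rightarrow> ennreal"
    proof -
      have "(\<integral>\<^sup>+\<sigma>. G \<sigma> \<partial>chi_sq 1) = (\<integral>\<^sup>+w. G (w\<^sup>2) \<partial>std_normal)"
        by (simp add: chi_sq_Suc chi_sq_0)
      also have "\<dots> = (\<integral>\<^sup>+w. ennreal (std_normal_density w) * G (w\<^sup>2) \<partial>lborel)"
        by (rule nn_integral_std_normal) measurable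
      also have "\<dots> = 2 * (\<integral>\<^sup>+w. ennreal (std_normal_density w) * G (w\<^sup>2) * indicator {0..} w \<partial>lborel)"
        by (rule nn_integral_even) (auto simp: normal_density_def)
      also have "(\<integral>\<^sup>+w. ennreal (std_normal_density w) * G (w\<^sup>2) * indicator {0..} w \<partial>lborel) =
        (\<integral>\<^sup>+w. ennreal (1 / sqrt (2 * pi)) * (ennreal (indicator {0<..} w * (w ^ 0 * exp (- w\<^sup>2 / 2))) * G (w\<^sup>2)) \<partial>lborel)"
      proof (rule nn_integral_cong_AE)
        show "AE w in lborel. ennreal (std_normal_density w) * G (w\<^sup>2) * indicator {0..} w =
          ennreal (1 / sqrt (2 * pi)) * (ennreal (indicator {0<..} w * (w ^ 0 * exp (- w\<^sup>2 / 2))) * G (w\<^sup>2))"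
          using AE_lborel_singleton[of 0]
        proof eventually_elim
          case (elim w)
          have "ennreal (std_normal_density w) = ennreal (1 / sqrt (2 * pi)) * ennreal (exp (- w\<^sup>2 / 2))"
            unfolding std_normal_density_def by (rule ennreal_mult) auto
          then show ?case using elim by (auto simp: indicator_def mult.assoc)
        qed
      qed
      also have "\<dots> = ennreal (1 / sqrt (2 * pi)) *
        (\<integral>\<^sup>+w. ennreal (indicator {0<..} w * (w ^ 0 * exp (- w\<^sup>2 / 2))) * G (w\<^sup>2) \<partial>lborel)"
        by (rule nn_integral_cmult) measurable
      finally show ?thesis by (simp add: mult.assoc)
    qed
    then show ?thesis using True by auto
  next
    case False
    then obtain C :: ennreal where C: "\<And>G. G \<in> borel_measurable borel \<Longrightarrow> (\<integral>\<^sup>+\<sigma>. G \<sigma> \<partial>chi_sq k) =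
      C * (\<integral>\<^sup>+s. ennreal (indicator {0<..} s * (s ^ (k - 1) * exp (- s\<^sup>2 / 2))) * G (s\<^sup>2) \<partial>lborel)"
      using Suc.IH by auto
    define q where "q x = sqrt (1 + x\<^sup>2)" for x :: real
    have q: "0 < q x" "(q x)\<^sup>2 = 1 + x\<^sup>2" for x by (auto simp: q_def add_pos_nonneg)
    have [measurable]: "q \<in> borel_measurable borel" unfolding q_def[abs_def] by measurable
    have regroup: "e1 * (L * (e2 * g)) = (L * e3) * (e4 * g)" if "e1 * e2 = e3 * e4" for e1 e2 e3 e4 L g :: ennreal
    proof -
      have "e1 * (L * (e2 * g)) = L * ((e1 * e2) * g)" by (simp only: mult_ac)
      also have "\<dots> = (L * e3) * (e4 * g)" unfolding that by (simp only: mult_ac)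
      finally show ?thesis .
    qed
    define K where "K = C * (\<integral>\<^sup>+x. ennreal (1 / sqrt (2 * pi)) * ennreal ((1 / q x) ^ Suc k) \<partial>lborel)"
    have "(\<integral>\<^sup>+\<sigma>. G \<sigma> \<partial>chi_sq (Suc k)) =
      K * (\<integral>\<^sup>+s. ennreal (indicator {0<..} s * (s ^ k * exp (- s\<^sup>2 / 2))) * G (s\<^sup>2) \<partial>lborel)"
      if G[measurable]: "G \<in> borel_measurable borel" for G :: "real \<Rightarrow> ennreal"
    proof -
      define H where "H s x = ennreal (1 / sqrt (2 * pi)) *
        (ennreal (indicator {0<..} s * (s ^ k * exp (- (s\<^sup>2 * (1 + x\<^sup>2)) / 2))) * G (s\<^sup>2 * (1 + x\<^sup>2)))" for s x :: real
      have "(\<integral>\<^sup>+\<sigma>. G \<sigma> \<partial>chi_sq (Suc k)) = (\<integral>\<^sup>+w. \<integral>\<^sup>+t. G (t + w\<^sup>2) \<partial>chi_sq k \<partial>std_normal)"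
        by (rule chi_sq_Suc) measurable
      also have "\<dots> = (\<integral>\<^sup>+w. C * (\<integral>\<^sup>+s. ennreal (indicator {0<..} s * (s ^ (k - 1) * exp (- s\<^sup>2 / 2))) * G (s\<^sup>2 + w\<^sup>2) \<partial>lborel) \<partial>std_normal)"
        by (intro nn_integral_cong C) measurable
      also have "\<dots> = C * (\<integral>\<^sup>+w. \<integral>\<^sup>+s. ennreal (indicator {0<..} s * (s ^ (k - 1) * exp (- s\<^sup>2 / 2))) * G (s\<^sup>2 + w\<^sup>2) \<partial>lborel \<partial>std_normal)"
        by (rule nn_integral_cmult) measurable
      also have "(\<integral>\<^sup>+w. \<integral>\<^sup>+s. ennreal (indicator {0<..} s * (s ^ (k - 1) * exp (- s\<^sup>2 / 2))) * G (s\<^sup>2 + w\<^sup>2) \<partial>lborel \<partial>std_normal) =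
        (\<integral>\<^sup>+w. ennreal (std_normal_density w) * (\<integral>\<^sup>+s. ennreal (indicator {0<..} s * (s ^ (k - 1) * exp (- s\<^sup>2 / 2))) * G (s\<^sup>2 + w\<^sup>2) \<partial>lborel) \<partial>lborel)"
        by (rule nn_integral_std_normal) measurable
      also have "\<dots> = (\<integral>\<^sup>+w. \<integral>\<^sup>+s. ennreal (std_normal_density w) * (ennreal (indicator {0<..} s * (s ^ (k - 1) * exp (- s\<^sup>2 / 2))) * G (s\<^sup>2 + w\<^sup>2)) \<partial>lborel \<partial>lborel)"
        by (intro nn_integral_cong nn_integral_cmult[symmetric]) measurable
      also have "\<dots> = (\<integral>\<^sup>+s. \<integral>\<^sup>+w. ennreal (std_normal_density w) * (ennreal (indicator {0<..} s * (s ^ (k - 1) * exp (- s\<^sup>2 / 2))) * G (s\<^sup>2 + w\<^sup>2)) \<partial>lborel \<partial>lborel)"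
        by (rule lborel_pair.Fubini') measurable
      also have "\<dots> = (\<integral>\<^sup>+s. \<integral>\<^sup>+x. H s x \<partial>lborel \<partial>lborel)"
      proof (rule nn_integral_cong)
        fix s :: real
        show "(\<integral>\<^sup>+w. ennreal (std_normal_density w) * (ennreal (indicator {0<..} s * (s ^ (k - 1) * exp (- s\<^sup>2 / 2))) * G (s\<^sup>2 + w\<^sup>2)) \<partial>lborel) =
          (\<integral>\<^sup>+x. H s x \<partial>lborel)"
        proof (cases "0 < s")
          case s: True
          have "(\<integral>\<^sup>+w. ennreal (std_normal_density w) * (ennreal (indicator {0<..} s * (s ^ (k - 1) * exp (- s\<^sup>2 / 2))) * G (s\<^sup>2 + w\<^sup>2)) \<partial>lborel) =
            ennreal s * (\<integral>\<^sup>+x. ennreal (std_normal_density (s * x)) * (ennreal (indicator {0<..} s * (s ^ (k - 1) * exp (- s\<^sup>2 / 2))) * G (s\<^sup>2 + (s * x)\<^sup>2)) \<partial>lborel)"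
            by (rule nn_integral_scale[OF _ s]) measurable
          also have "\<dots> = (\<integral>\<^sup>+x. ennreal s * (ennreal (std_normal_density (s * x)) * (ennreal (indicator {0<..} s * (s ^ (k - 1) * exp (- s\<^sup>2 / 2))) * G (s\<^sup>2 + (s * x)\<^sup>2))) \<partial>lborel)"
            by (rule nn_integral_cmult[symmetric]) measurable
          also have "\<dots> = (\<integral>\<^sup>+x. H s x \<partial>lborel)"
          proof (rule nn_integral_cong)
            fix x :: real
            have "s * (std_normal_density (s * x) * (s ^ (k - 1) * exp (- s\<^sup>2 / 2))) =
              1 / sqrt (2 * pi) * ((s * s ^ (k - 1)) * (exp (- (s * x)\<^sup>2 / 2) * exp (- s\<^sup>2 / 2)))"
              unfolding std_normal_density_def by (simp only: mult_ac)
            also have "s * s ^ (k - 1) = s ^ k" using False by (cases k) auto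
            also have "exp (- (s * x)\<^sup>2 / 2) * exp (- s\<^sup>2 / 2) = exp (- (s\<^sup>2 * (1 + x\<^sup>2)) / 2)"
              by (simp add: exp_add[symmetric] power_mult_distrib field_simps)
            finally have e: "s * (std_normal_density (s * x) * (s ^ (k - 1) * exp (- s\<^sup>2 / 2))) =
              1 / sqrt (2 * pi) * (s ^ k * exp (- (s\<^sup>2 * (1 + x\<^sup>2)) / 2))" .
            have "ennreal s * (ennreal (std_normal_density (s * x)) * ennreal (s ^ (k - 1) * exp (- s\<^sup>2 / 2))) =
              ennreal (1 / sqrt (2 * pi)) * ennreal (s ^ k * exp (- (s\<^sup>2 * (1 + x\<^sup>2)) / 2))"
            proof -
              have "ennreal s * (ennreal (std_normal_density (s * x)) * ennreal (s ^ (k - 1) * exp (- s\<^sup>2 / 2))) =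
                ennreal (s * (std_normal_density (s * x) * (s ^ (k - 1) * exp (- s\<^sup>2 / 2))))"
                using s by (simp only: ennreal_mult'[symmetric] less_imp_le normal_density_nonneg)
              then show ?thesis unfolding e using s by (simp only: ennreal_mult'[symmetric] divide_nonneg_nonneg zero_le_one real_sqrt_ge_zero pi_ge_zero mult_nonneg_nonneg zero_le_numeral)
            qed
            moreover have "s\<^sup>2 + (s * x)\<^sup>2 = s\<^sup>2 * (1 + x\<^sup>2)" by (simp add: power_mult_distrib algebra_simps)
            ultimately show "ennreal s * (ennreal (std_normal_density (s * x)) * (ennreal (indicator {0<..} s * (s ^ (k - 1) * exp (- s\<^sup>2 / 2))) * G (s\<^sup>2 + (s * x)\<^sup>2))) = H s x"
              using s by (simp add: H_def mult.assoc[symmetric])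
          qed
          finally show ?thesis .
        qed (simp add: H_def)
      qed
      also have "\<dots> = (\<integral>\<^sup>+x. \<integral>\<^sup>+s. H s x \<partial>lborel \<partial>lborel)"
        unfolding H_def by (rule lborel_pair.Fubini') measurable
      also have "\<dots> = (\<integral>\<^sup>+x. (ennreal (1 / sqrt (2 * pi)) * ennreal ((1 / q x) ^ Suc k)) *
        (\<integral>\<^sup>+r. ennreal (indicator {0<..} r * (r ^ k * exp (- r\<^sup>2 / 2))) * G (r\<^sup>2) \<partial>lborel) \<partial>lborel)"
      proof (rule nn_integral_cong)
        fix x :: real
        have qx: "0 < 1 / q x" using q by simp
        have "(\<integral>\<^sup>+s. H s x \<partial>lborel) = ennreal (1 / q x) * (\<integral>\<^sup>+r. H (1 / q x * r) x \<partial>lborel)"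
          unfolding H_def by (rule nn_integral_scale[OF _ qx]) measurable
        also have "\<dots> = (\<integral>\<^sup>+r. ennreal (1 / q x) * H (1 / q x * r) x \<partial>lborel)"
          unfolding H_def by (rule nn_integral_cmult[symmetric]) measurable
        also have "\<dots> = (\<integral>\<^sup>+r. (ennreal (1 / sqrt (2 * pi)) * ennreal ((1 / q x) ^ Suc k)) *
          (ennreal (indicator {0<..} r * (r ^ k * exp (- r\<^sup>2 / 2))) * G (r\<^sup>2)) \<partial>lborel)"
        proof (rule nn_integral_cong)
          fix r :: real
          have sq: "(1 / q x * r)\<^sup>2 * (1 + x\<^sup>2) = r\<^sup>2"
            \<comment> \<open>The substitution s = r / q x replaces s^2 (1 + x^2) by r^2.\<close>
            using q(1)[of x] unfolding q(2)[symmetric] by (simp add: power_divide)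
          have ind: "indicator {0<..} (1 / q x * r) = (indicator {0<..} r :: real)"
            using q(1)[of x] by (auto simp: indicator_def zero_less_divide_iff)
          have "ennreal (1 / q x) * ennreal (indicator {0<..} r * ((1 / q x * r) ^ k * exp (- r\<^sup>2 / 2))) =
            ennreal ((1 / q x) ^ Suc k) * ennreal (indicator {0<..} r * (r ^ k * exp (- r\<^sup>2 / 2)))"
            using q(1)[of x] by (subst (1 2) ennreal_mult'[symmetric]) (simp_all only: power_mult_distrib power_Suc mult_ac, simp_all)
          then show "ennreal (1 / q x) * H (1 / q x * r) x = (ennreal (1 / sqrt (2 * pi)) * ennreal ((1 / q x) ^ Suc k)) *
            (ennreal (indicator {0<..} r * (r ^ k * exp (- r\<^sup>2 / 2))) * G (r\<^sup>2))"
            unfolding H_def sq ind by (rule regroup)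
        qed
        also have "\<dots> = (ennreal (1 / sqrt (2 * pi)) * ennreal ((1 / q x) ^ Suc k)) *
          (\<integral>\<^sup>+r. ennreal (indicator {0<..} r * (r ^ k * exp (- r\<^sup>2 / 2))) * G (r\<^sup>2) \<partial>lborel)"
          by (rule nn_integral_cmult) measurable
        finally show "(\<integral>\<^sup>+s. H s x \<partial>lborel) = \<dots>" .
      qed
      also have "\<dots> = (\<integral>\<^sup>+x. ennreal (1 / sqrt (2 * pi)) * ennreal ((1 / q x) ^ Suc k) \<partial>lborel) *
        (\<integral>\<^sup>+r. ennreal (indicator {0<..} r * (r ^ k * exp (- r\<^sup>2 / 2))) * G (r\<^sup>2) \<partial>lborel)"
        by (rule nn_integral_multc) measurable
      finally show ?thesis by (simp only: K_def mult.assoc)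
    qed
    then show ?thesis by auto
  qed
qed simp

text \<open>Bartlett's decomposition of the Gram matrix of two centred normal vectors: given U, the
  vector V splits into its coordinate z along the centred U and an independent orthogonal rest of
  squared length t. U enters only through its squared centred norm \<sigma>.\<close>

lemma gram_integral:
  fixes h :: "real \<times> real \<times> real \<Rightarrow> ennreal"
  assumes h[measurable]: "h \<in> borel_measurable (borel \<Otimes>\<^sub>M borel \<Otimes>\<^sub>M borel)"
  shows "(\<integral>\<^sup>+U. \<integral>\<^sup>+V. h (\<Sum>i=1..N+2. (U i - sample_mean (N + 2) U)\<^sup>2,
      \<Sum>i=1..N+2. (U i - sample_mean (N + 2) U) * (V i - sample_mean (N + 2) V),
      \<Sum>i=1..N+2. (V i - sample_mean (N + 2) V)\<^sup>2) \<partial>gauss_n (N + 2) \<partial>gauss_n (N + 2)) =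
    (\<integral>\<^sup>+\<sigma>. \<integral>\<^sup>+t. \<integral>\<^sup>+z. h (\<sigma>, sqrt \<sigma> * z, z\<^sup>2 + t) \<partial>std_normal \<partial>chi_sq N \<partial>chi_sq (Suc N))"
proof -
  interpret chi: sigma_finite_measure "chi_sq N" by (rule sigma_finite_chi_sq)
  define g where "g \<sigma> = (\<integral>\<^sup>+t. \<integral>\<^sup>+z. h (\<sigma>, sqrt \<sigma> * z, z\<^sup>2 + t) \<partial>std_normal \<partial>chi_sq N)" for \<sigma>
  have [measurable]: "g \<in> borel_measurable borel" unfolding g_def[abs_def] by measurable
  have "(\<integral>\<^sup>+V. h (\<Sum>i=1..N+2. (U i - sample_mean (N + 2) U)\<^sup>2,
      \<Sum>i=1..N+2. (U i - sample_mean (N + 2) U) * (V i - sample_mean (N + 2) V),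
      \<Sum>i=1..N+2. (V i - sample_mean (N + 2) V)\<^sup>2) \<partial>gauss_n (N + 2)) = g ((centered_norm (N + 2) U)\<^sup>2)" for U
  proof -
    have "sqrt ((centered_norm (N + 2) U)\<^sup>2) = centered_norm (N + 2) U" by (simp add: centered_norm_nonneg)
    then show ?thesis
      using gauss_n_centered_statistics[of "\<lambda>y. h ((centered_norm (N + 2) U)\<^sup>2, y)" N U]
      unfolding g_def centered_norm_square[symmetric] by simp
  qed
  then show ?thesis using gauss_n_centered_norm[of g N] by (simp add: g_def)
qed

text \<open>Passing from \<sigma> and t to their square roots makes all three arguments of h
  quadratic forms in (s, t, z), as the homogeneity argument requires. The constant is chosen before
  h, so that one h can determine it for all others.\<close>

lemma gram_density:
  assumes N: "0 < N"
  shows "\<exists>C. \<forall>h\<in>borel_measurable (borel \<Otimes>\<^sub>M borel \<Otimes>\<^sub>M borel).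
    (\<integral>\<^sup>+\<sigma>. \<integral>\<^sup>+t. \<integral>\<^sup>+z. h (\<sigma>, sqrt \<sigma> * z, z\<^sup>2 + t) \<partial>std_normal \<partial>chi_sq N \<partial>chi_sq (Suc N)) =
    C * (\<integral>\<^sup>+t. \<integral>\<^sup>+s. \<integral>\<^sup>+z. ennreal (indicator {0<..} t * (t ^ (N - 1) * exp (- t\<^sup>2 / 2))) *
      (ennreal (indicator {0<..} s * (s ^ N * exp (- s\<^sup>2 / 2))) *
      (ennreal (exp (- z\<^sup>2 / 2)) * h (s\<^sup>2, s * z, z\<^sup>2 + t\<^sup>2))) \<partial>lborel \<partial>lborel \<partial>lborel)"
proof -
  interpret chi: sigma_finite_measure "chi_sq N" by (rule sigma_finite_chi_sq)
  define d1 d2 e where "d1 s = ennreal (indicator {0<..} s * (s ^ N * exp (- s\<^sup>2 / 2)))"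
    and "d2 t = ennreal (indicator {0<..} t * (t ^ (N - 1) * exp (- t\<^sup>2 / 2)))"
    and "e z = ennreal (exp (- z\<^sup>2 / 2))" for s t z :: real
  have [measurable]: "d1 \<in> borel_measurable borel" "d2 \<in> borel_measurable borel" "e \<in> borel_measurable borel"
    unfolding d1_def[abs_def] d2_def[abs_def] e_def[abs_def] by measurable
  obtain C1 where C1: "\<And>G. G \<in> borel_measurable borel \<Longrightarrow>
    (\<integral>\<^sup>+\<sigma>. G \<sigma> \<partial>chi_sq (Suc N)) = C1 * (\<integral>\<^sup>+s. d1 s * G (s\<^sup>2) \<partial>lborel)"
    using nn_integral_chi_sq[of "Suc N"] unfolding d1_def by auto
  obtain C2 where C2: "\<And>G. G \<in> borel_measurable borel \<Longrightarrow>
    (\<integral>\<^sup>+t. G t \<partial>chi_sq N) = C2 * (\<integral>\<^sup>+t. d2 t * G (t\<^sup>2) \<partial>lborel)"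
    using nn_integral_chi_sq[OF N] unfolding d2_def by auto
  define C3 where "C3 = ennreal (1 / sqrt (2 * pi))"
  have C3: "(\<integral>\<^sup>+z. G z \<partial>std_normal) = C3 * (\<integral>\<^sup>+z. e z * G z \<partial>lborel)"
    if [measurable]: "G \<in> borel_measurable borel" for G
  proof -
    have "ennreal (std_normal_density z) = C3 * e z" for z
      unfolding std_normal_density_def C3_def e_def by (rule ennreal_mult) auto
    then have "(\<integral>\<^sup>+z. G z \<partial>std_normal) = (\<integral>\<^sup>+z. C3 * (e z * G z) \<partial>lborel)"
      by (simp add: nn_integral_std_normal mult.assoc)
    also have "\<dots> = C3 * (\<integral>\<^sup>+z. e z * G z \<partial>lborel)" by (rule nn_integral_cmult) measurable
    finally show ?thesis .
  qed
  have "(\<integral>\<^sup>+\<sigma>. \<integral>\<^sup>+t. \<integral>\<^sup>+z. h (\<sigma>, sqrt \<sigma> * z, z\<^sup>2 + t) \<partial>std_normal \<partial>chi_sq N \<partial>chi_sq (Suc N)) =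
    C1 * (C2 * C3) * (\<integral>\<^sup>+t. \<integral>\<^sup>+s. \<integral>\<^sup>+z. d2 t * (d1 s * (e z * h (s\<^sup>2, s * z, z\<^sup>2 + t\<^sup>2))) \<partial>lborel \<partial>lborel \<partial>lborel)"
    if h[measurable]: "h \<in> borel_measurable (borel \<Otimes>\<^sub>M borel \<Otimes>\<^sub>M borel)" for h :: "real \<times> real \<times> real \<Rightarrow> ennreal"
  proof -
    have inner: "(\<integral>\<^sup>+t. \<integral>\<^sup>+z. h (\<sigma>, r * z, z\<^sup>2 + t) \<partial>std_normal \<partial>chi_sq N) =
      (C2 * C3) * (\<integral>\<^sup>+t. \<integral>\<^sup>+z. d2 t * (e z * h (\<sigma>, r * z, z\<^sup>2 + t\<^sup>2)) \<partial>lborel \<partial>lborel)" for \<sigma> r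
    proof -
      have "(\<integral>\<^sup>+t. \<integral>\<^sup>+z. h (\<sigma>, r * z, z\<^sup>2 + t) \<partial>std_normal \<partial>chi_sq N) =
        (\<integral>\<^sup>+t. C3 * (\<integral>\<^sup>+z. e z * h (\<sigma>, r * z, z\<^sup>2 + t) \<partial>lborel) \<partial>chi_sq N)"
        by (intro nn_integral_cong C3) measurable
      also have "\<dots> = C2 * (\<integral>\<^sup>+t. d2 t * (C3 * (\<integral>\<^sup>+z. e z * h (\<sigma>, r * z, z\<^sup>2 + t\<^sup>2) \<partial>lborel)) \<partial>lborel)"
        by (rule C2) measurable
      also have "\<dots> = C2 * (\<integral>\<^sup>+t. C3 * (\<integral>\<^sup>+z. d2 t * (e z * h (\<sigma>, r * z, z\<^sup>2 + t\<^sup>2)) \<partial>lborel) \<partial>lborel)"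
      proof -
        have "d2 t * (C3 * (\<integral>\<^sup>+z. e z * h (\<sigma>, r * z, z\<^sup>2 + t\<^sup>2) \<partial>lborel)) =
          C3 * (\<integral>\<^sup>+z. d2 t * (e z * h (\<sigma>, r * z, z\<^sup>2 + t\<^sup>2)) \<partial>lborel)" for t
          by (subst nn_integral_cmult) (simp_all add: mult.left_commute)
        then show ?thesis by simp
      qed
      also have "\<dots> = C2 * (C3 * (\<integral>\<^sup>+t. \<integral>\<^sup>+z. d2 t * (e z * h (\<sigma>, r * z, z\<^sup>2 + t\<^sup>2)) \<partial>lborel \<partial>lborel))"
        by (subst nn_integral_cmult) simp_all
      finally show ?thesis by (simp only: mult.assoc)
    qed
    have "(\<integral>\<^sup>+\<sigma>. \<integral>\<^sup>+t. \<integral>\<^sup>+z. h (\<sigma>, sqrt \<sigma> * z, z\<^sup>2 + t) \<partial>std_normal \<partial>chi_sq N \<partial>chi_sq (Suc N)) =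
      C1 * (\<integral>\<^sup>+s. d1 s * (\<integral>\<^sup>+t. \<integral>\<^sup>+z. h (s\<^sup>2, sqrt (s\<^sup>2) * z, z\<^sup>2 + t) \<partial>std_normal \<partial>chi_sq N) \<partial>lborel)"
      by (rule C1) measurable
    also have "\<dots> = C1 * (\<integral>\<^sup>+s. (C2 * C3) * (\<integral>\<^sup>+t. \<integral>\<^sup>+z. d2 t * (d1 s * (e z * h (s\<^sup>2, s * z, z\<^sup>2 + t\<^sup>2))) \<partial>lborel \<partial>lborel) \<partial>lborel)"
    proof -
      have "d1 s * (\<integral>\<^sup>+t. \<integral>\<^sup>+z. h (s\<^sup>2, sqrt (s\<^sup>2) * z, z\<^sup>2 + t) \<partial>std_normal \<partial>chi_sq N) =
        (C2 * C3) * (\<integral>\<^sup>+t. \<integral>\<^sup>+z. d2 t * (d1 s * (e z * h (s\<^sup>2, s * z, z\<^sup>2 + t\<^sup>2))) \<partial>lborel \<partial>lborel)" for s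
      proof (cases "0 < s")
        case True
        have "d1 s * (\<integral>\<^sup>+t. \<integral>\<^sup>+z. h (s\<^sup>2, sqrt (s\<^sup>2) * z, z\<^sup>2 + t) \<partial>std_normal \<partial>chi_sq N) =
          (C2 * C3) * (d1 s * (\<integral>\<^sup>+t. \<integral>\<^sup>+z. d2 t * (e z * h (s\<^sup>2, s * z, z\<^sup>2 + t\<^sup>2)) \<partial>lborel \<partial>lborel))"
          unfolding inner using True by (simp add: mult.left_commute)
        also have "d1 s * (\<integral>\<^sup>+t. \<integral>\<^sup>+z. d2 t * (e z * h (s\<^sup>2, s * z, z\<^sup>2 + t\<^sup>2)) \<partial>lborel \<partial>lborel) =
          (\<integral>\<^sup>+t. \<integral>\<^sup>+z. d1 s * (d2 t * (e z * h (s\<^sup>2, s * z, z\<^sup>2 + t\<^sup>2))) \<partial>lborel \<partial>lborel)"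
          by (simp add: nn_integral_cmult)
        also have "\<dots> = (\<integral>\<^sup>+t. \<integral>\<^sup>+z. d2 t * (d1 s * (e z * h (s\<^sup>2, s * z, z\<^sup>2 + t\<^sup>2))) \<partial>lborel \<partial>lborel)"
          by (simp add: mult.left_commute)
        finally show ?thesis .
      qed (simp add: d1_def)
      then show ?thesis by simp
    qed
    also have "\<dots> = C1 * ((C2 * C3) * (\<integral>\<^sup>+s. \<integral>\<^sup>+t. \<integral>\<^sup>+z. d2 t * (d1 s * (e z * h (s\<^sup>2, s * z, z\<^sup>2 + t\<^sup>2))) \<partial>lborel \<partial>lborel \<partial>lborel))"
      by (subst nn_integral_cmult) simp_all
    also have "(\<integral>\<^sup>+s. \<integral>\<^sup>+t. \<integral>\<^sup>+z. d2 t * (d1 s * (e z * h (s\<^sup>2, s * z, z\<^sup>2 + t\<^sup>2))) \<partial>lborel \<partial>lborel \<partial>lborel) =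
      (\<integral>\<^sup>+t. \<integral>\<^sup>+s. \<integral>\<^sup>+z. d2 t * (d1 s * (e z * h (s\<^sup>2, s * z, z\<^sup>2 + t\<^sup>2))) \<partial>lborel \<partial>lborel \<partial>lborel)"
      by (rule lborel_pair.Fubini') measurable
    finally show ?thesis by (simp only: mult.assoc)
  qed
  then show ?thesis unfolding d1_def d2_def e_def by blast
qed

text \<open>The constant is not computed from the Gamma function: it is determined by total mass 1.\<close>

lemma gram_event:
  fixes B :: "(real \<times> real) set"
  assumes N: "0 < N" and B[measurable]: "B \<in> sets (borel \<Otimes>\<^sub>M borel)"
    and A[measurable]: "A \<in> sets (borel \<Otimes>\<^sub>M borel \<Otimes>\<^sub>M borel)"
    and AB: "\<And>s t z. 0 < s \<Longrightarrow> 0 < t \<Longrightarrow>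
      (s\<^sup>2, s * z, z\<^sup>2 + t\<^sup>2) \<in> A \<longleftrightarrow> ((s\<^sup>2 + z\<^sup>2 + t\<^sup>2) / (2 * s * t), s / t) \<in> B"
  shows "(\<integral>\<^sup>+\<sigma>. \<integral>\<^sup>+t. \<integral>\<^sup>+z. indicator A (\<sigma>, sqrt \<sigma> * z, z\<^sup>2 + t) \<partial>std_normal \<partial>chi_sq N \<partial>chi_sq (Suc N)) =
    ennreal (real N / pi) *
    (\<integral>\<^sup>+u. \<integral>\<^sup>+\<alpha>. ennreal (indicator {1<..} u * (1 / u) ^ (N + 1) * indicator B (u, u - sqrt (u\<^sup>2 - 1) * cos \<alpha>)) *
      indicator {0..pi} \<alpha> \<partial>lborel \<partial>lborel)"
proof -
  define J where "J B = (\<integral>\<^sup>+u. \<integral>\<^sup>+\<alpha>. ennreal (indicator {1<..} u * (1 / u) ^ (N + 1) * indicator B (u, u - sqrt (u\<^sup>2 - 1) * cos \<alpha>)) *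
      indicator {0..pi} \<alpha> \<partial>lborel \<partial>lborel)" for B :: "(real \<times> real) set"
  define E where "E A = (\<integral>\<^sup>+\<sigma>. \<integral>\<^sup>+t. \<integral>\<^sup>+z. indicator A (\<sigma>, sqrt \<sigma> * z, z\<^sup>2 + t) \<partial>std_normal \<partial>chi_sq N \<partial>chi_sq (Suc N))"
    for A :: "(real \<times> real \<times> real) set"
  obtain C where C: "\<And>h. h \<in> borel_measurable (borel \<Otimes>\<^sub>M borel \<Otimes>\<^sub>M borel) \<Longrightarrow>
    (\<integral>\<^sup>+\<sigma>. \<integral>\<^sup>+t. \<integral>\<^sup>+z. h (\<sigma>, sqrt \<sigma> * z, z\<^sup>2 + t) \<partial>std_normal \<partial>chi_sq N \<partial>chi_sq (Suc N)) =
    C * (\<integral>\<^sup>+t. \<integral>\<^sup>+s. \<integral>\<^sup>+z. ennreal (indicator {0<..} t * (t ^ (N - 1) * exp (- t\<^sup>2 / 2))) *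
      (ennreal (indicator {0<..} s * (s ^ N * exp (- s\<^sup>2 / 2))) *
      (ennreal (exp (- z\<^sup>2 / 2)) * h (s\<^sup>2, s * z, z\<^sup>2 + t\<^sup>2))) \<partial>lborel \<partial>lborel \<partial>lborel)"
    using gram_density[OF N] by blast
  define K where "K = C * ((\<integral>\<^sup>+t. ennreal (indicator {0<..} t * (t ^ (2 * N + 1) * exp (- t\<^sup>2 / 2))) \<partial>lborel) * ennreal ((1 / 2) ^ N))"
  \<comment> \<open>Stated for arbitrary sets because it is used twice: for the event in question
    and for the whole space, where it yields K.\<close>
  have main: "E A = K * J B"
    if [measurable]: "B \<in> sets (borel \<Otimes>\<^sub>M borel)" "A \<in> sets (borel \<Otimes>\<^sub>M borel \<Otimes>\<^sub>M borel)"
    and AB: "\<And>s t z. 0 < s \<Longrightarrow> 0 < t \<Longrightarrow>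
      (s\<^sup>2, s * z, z\<^sup>2 + t\<^sup>2) \<in> A \<longleftrightarrow> ((s\<^sup>2 + z\<^sup>2 + t\<^sup>2) / (2 * s * t), s / t) \<in> B"
    for A and B :: "(real \<times> real) set"
  proof -
    have "E A = C * (\<integral>\<^sup>+t. \<integral>\<^sup>+s. \<integral>\<^sup>+z. ennreal (indicator {0<..} t * (t ^ (N - 1) * exp (- t\<^sup>2 / 2))) *
      (ennreal (indicator {0<..} s * (s ^ N * exp (- s\<^sup>2 / 2))) *
      (ennreal (exp (- z\<^sup>2 / 2)) * indicator A (s\<^sup>2, s * z, z\<^sup>2 + t\<^sup>2))) \<partial>lborel \<partial>lborel \<partial>lborel)"
      unfolding E_def by (rule C) measurable
    also have "\<dots> = C * (\<integral>\<^sup>+t. \<integral>\<^sup>+s. \<integral>\<^sup>+z. ennreal (indicator {0<..} t * (t ^ (N - 1) * exp (- t\<^sup>2 / 2))) *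
      (ennreal (indicator {0<..} s * (s ^ N * exp (- s\<^sup>2 / 2))) *
      (ennreal (exp (- z\<^sup>2 / 2)) * indicator B ((s\<^sup>2 + z\<^sup>2 + t\<^sup>2) / (2 * s * t), s / t))) \<partial>lborel \<partial>lborel \<partial>lborel)"
    proof -
      have "ennreal (indicator {0<..} t * (t ^ (N - 1) * exp (- t\<^sup>2 / 2))) *
        (ennreal (indicator {0<..} s * (s ^ N * exp (- s\<^sup>2 / 2))) *
        (ennreal (exp (- z\<^sup>2 / 2)) * indicator A (s\<^sup>2, s * z, z\<^sup>2 + t\<^sup>2))) =
        ennreal (indicator {0<..} t * (t ^ (N - 1) * exp (- t\<^sup>2 / 2))) *
        (ennreal (indicator {0<..} s * (s ^ N * exp (- s\<^sup>2 / 2))) *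
        (ennreal (exp (- z\<^sup>2 / 2)) * indicator B ((s\<^sup>2 + z\<^sup>2 + t\<^sup>2) / (2 * s * t), s / t)))" for s t z :: real
        using AB[of s t z] by (cases "0 < s"; cases "0 < t") (simp_all add: indicator_def)
      then show ?thesis by presburger
    qed
    also have "\<dots> = K * J B"
      using homogeneous_integral[OF that(1) N] unfolding K_def J_def by (simp only: mult.assoc)
    finally show ?thesis .
  qed
  have "E UNIV = 1"
  proof -
    interpret c1: prob_space "chi_sq N" by (rule prob_space_chi_sq)
    interpret c2: prob_space "chi_sq (Suc N)" by (rule prob_space_chi_sq)
    show ?thesis
      using std_normal.emeasure_space_1 c1.emeasure_space_1 c2.emeasure_space_1 by (simp add: E_def)
  qed
  have "J UNIV = ennreal (pi / real N)"
  proof -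
    have "J UNIV = (\<integral>\<^sup>+u. (ennreal ((1 / u) ^ (N + 1)) * indicator {1..} u) * ennreal pi \<partial>lborel)"
    proof -
      have "(\<integral>\<^sup>+\<alpha>. ennreal (indicator {1<..} u * (1 / u) ^ (N + 1) * indicator UNIV (u, u - sqrt (u\<^sup>2 - 1) * cos \<alpha>)) *
        indicator {0..pi} \<alpha> \<partial>lborel) = ennreal (indicator {1<..} u * (1 / u) ^ (N + 1)) * ennreal pi" for u
        by (simp add: nn_integral_cmult)
      moreover have "AE u in lborel. ennreal (indicator {1<..} u * (1 / u) ^ (N + 1)) * ennreal pi =
        (ennreal ((1 / u) ^ (N + 1)) * indicator {1..} u) * ennreal pi"
        using AE_lborel_singleton[of "1::real"] by eventually_elim (auto simp: indicator_def)
      ultimately show ?thesis unfolding J_def by (simp only:) (rule nn_integral_cong_AE)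
    qed
    also have "\<dots> = (\<integral>\<^sup>+u. ennreal ((1 / u) ^ (N + 1)) * indicator {1..} u \<partial>lborel) * ennreal pi"
      by (rule nn_integral_multc) measurable
    also have "\<dots> = ennreal (1 / real N) * ennreal pi"
      using nn_integral_power_tail[of 1 N] N by simp
    also have "\<dots> = ennreal (pi / real N)" by (subst ennreal_mult[symmetric]) auto
    finally show ?thesis .
  qed
  have K1: "K * ennreal (pi / real N) = 1" 
  proof -
    have "(UNIV :: (real \<times> real) set) \<in> sets (borel \<Otimes>\<^sub>M borel)"
      "(UNIV :: (real \<times> real \<times> real) set) \<in> sets (borel \<Otimes>\<^sub>M borel \<Otimes>\<^sub>M borel)"
      using sets.top[of "borel \<Otimes>\<^sub>M borel :: (real \<times> real) measure"]
        sets.top[of "borel \<Otimes>\<^sub>M borel \<Otimes>\<^sub>M borel :: (real \<times> real \<times> real) measure"]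
      by (simp_all add: space_pair_measure)
    then show ?thesis
      using main[of UNIV UNIV] \<open>E UNIV = 1\<close> \<open>J UNIV = ennreal (pi / real N)\<close> by simp
  qed
  \<comment> \<open>K is an extended real not yet known to be finite, so it is isolated by
    multiplication and not by cancellation.\<close>
  have "K = K * (ennreal (pi / real N) * ennreal (real N / pi))"
    using N by (subst ennreal_mult[symmetric]) auto
  also have "\<dots> = ennreal (real N / pi)" by (simp add: mult.assoc[symmetric] K1)
  finally have "K = ennreal (real N / pi)" .
  then show ?thesis using main[OF B A AB] unfolding E_def J_def by simp
qed

section \<open>The correlation coefficient of Gaussian samples\<close>

lemma pearson_measurable[measurable]:
  assumes [measurable]: "\<And>i. i \<in> {1..n} \<Longrightarrow> (\<lambda>\<omega>. f \<omega> i) \<in> borel_measurable M"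
    "\<And>i. i \<in> {1..n} \<Longrightarrow> (\<lambda>\<omega>. g \<omega> i) \<in> borel_measurable M"
  shows "(\<lambda>\<omega>. pearson n (f \<omega>) (g \<omega>)) \<in> borel_measurable M"
  unfolding pearson_def sample_mean_def by measurable

lemma pearson_cong:
  assumes "\<And>i. i \<in> {1..n} \<Longrightarrow> x i = x' i" "\<And>i. i \<in> {1..n} \<Longrightarrow> y i = y' i"
  shows "pearson n x y = pearson n x' y'"
proof -
  have m: "sample_mean n x = sample_mean n x'" "sample_mean n y = sample_mean n y'"
    using assms by (auto simp: sample_mean_def)
  have "(\<Sum>i=1..n. (x i - a) * (y i - b)) = (\<Sum>i=1..n. (x' i - a) * (y' i - b))"
    "(\<Sum>i=1..n. (x i - a)\<^sup>2) = (\<Sum>i=1..n. (x' i - a)\<^sup>2)"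
    "(\<Sum>i=1..n. (y i - b)\<^sup>2) = (\<Sum>i=1..n. (y' i - b)\<^sup>2)" for a b
    using assms by (auto intro!: sum.cong)
  then show ?thesis unfolding pearson_def m by simp
qed

lemma sample_mean_affine:
  assumes "0 < n"
  shows "sample_mean n (\<lambda>i. m + (a * U i + b * V i)) = m + (a * sample_mean n U + b * sample_mean n V)"
  using assms by (simp add: sample_mean_def sum.distrib sum_distrib_left[symmetric] add_divide_distrib)

text \<open>Shifts and positive scale factors cancel. Taking a sum and a difference of the same
  terms leaves no mixed entry A U V in the numerator, and the two factors under the root differ only
  in its sign.\<close>

lemma pearson_gram:
  assumes n: "0 < n" and s: "0 < s1" "0 < s2"
  defines "A \<equiv> \<lambda>U V. \<Sum>i=1..n. (U i - sample_mean n U) * (V i - sample_mean n V)"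
  shows "pearson n (\<lambda>i. m1 + s1 * (p * U i + q * V i)) (\<lambda>i. m2 + s2 * (p * U i - q * V i)) =
    (p\<^sup>2 * A U U - q\<^sup>2 * A V V) /
    sqrt ((p\<^sup>2 * A U U + 2 * p * q * A U V + q\<^sup>2 * A V V) * (p\<^sup>2 * A U U - 2 * p * q * A U V + q\<^sup>2 * A V V))"
proof -
  define u v where "u i = U i - sample_mean n U" and "v i = V i - sample_mean n V" for i
  have A: "A U U = (\<Sum>i=1..n. u i * u i)" "A U V = (\<Sum>i=1..n. u i * v i)" "A V V = (\<Sum>i=1..n. v i * v i)"
    by (simp_all add: A_def u_def v_def)
  have m1: "sample_mean n (\<lambda>i. m1 + s1 * (p * U i + q * V i)) = m1 + s1 * (p * sample_mean n U + q * sample_mean n V)"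
    using sample_mean_affine[OF n, of m1 "s1 * p" U "s1 * q" V] by (simp add: algebra_simps)
  have m2: "sample_mean n (\<lambda>i. m2 + s2 * (p * U i - q * V i)) = m2 + s2 * (p * sample_mean n U - q * sample_mean n V)"
    using sample_mean_affine[OF n, of m2 "s2 * p" U "- s2 * q" V] by (simp add: algebra_simps)
  have x: "m1 + s1 * (p * U i + q * V i) - (m1 + s1 * (p * sample_mean n U + q * sample_mean n V)) = s1 * (p * u i + q * v i)" for i
    by (simp add: u_def v_def algebra_simps)
  have y: "m2 + s2 * (p * U i - q * V i) - (m2 + s2 * (p * sample_mean n U - q * sample_mean n V)) = s2 * (p * u i - q * v i)" for i
    by (simp add: u_def v_def algebra_simps)
  have xy: "(\<Sum>i=1..n. s1 * (p * u i + q * v i) * (s2 * (p * u i - q * v i))) = s1 * s2 * (p\<^sup>2 * A U U - q\<^sup>2 * A V V)"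
    unfolding A by (simp add: sum_distrib_left sum_subtractf[symmetric] power2_eq_square algebra_simps)
  have xx: "(\<Sum>i=1..n. (s1 * (p * u i + q * v i))\<^sup>2) = s1\<^sup>2 * (p\<^sup>2 * A U U + 2 * p * q * A U V + q\<^sup>2 * A V V)"
    unfolding A by (simp add: sum_distrib_left sum.distrib[symmetric] power2_eq_square algebra_simps)
  have yy: "(\<Sum>i=1..n. (s2 * (p * u i - q * v i))\<^sup>2) = s2\<^sup>2 * (p\<^sup>2 * A U U - 2 * p * q * A U V + q\<^sup>2 * A V V)"
    unfolding A by (simp add: sum_distrib_left sum_subtractf[symmetric] sum.distrib[symmetric] power2_eq_square algebra_simps)
  have r: "sqrt ((s1\<^sup>2 * X) * (s2\<^sup>2 * Y)) = s1 * s2 * sqrt (X * Y)" for X Y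
    using s by (simp add: real_sqrt_mult)
  show ?thesis
    unfolding pearson_def m1 m2 x y xy xx yy r using s by simp
qed

context corr_level
begin

text \<open>The weights satisfy p^2 + q^2 = 1 and p^2 - q^2 = \<rho>, so p U + q V and p U - q V
  have variance 1 and correlation \<rho> for independent standard normal U and V.\<close>

definition p_rho :: real where "p_rho = sqrt ((1 + \<rho>) / 2)"
definition q_rho :: real where "q_rho = sqrt ((1 - \<rho>) / 2)"

lemma p_rho: "0 < p_rho" "p_rho\<^sup>2 = (1 + \<rho>) / 2"
  and q_rho: "0 < q_rho" "q_rho\<^sup>2 = (1 - \<rho>) / 2"
  using rho_c by (auto simp: p_rho_def q_rho_def)

lemma pq_rho: "2 * p_rho * q_rho = sqrt (1 - \<rho>\<^sup>2)"
proof -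
  have "(2 * p_rho * q_rho)\<^sup>2 = 1 - \<rho>\<^sup>2"
    unfolding power_mult_distrib p_rho(2) q_rho(2) by (simp add: power2_eq_square field_simps)
  then show ?thesis using p_rho(1) q_rho(1) by (intro real_sqrt_unique[symmetric]) auto
qed

definition corr_ratio :: "real \<times> real \<times> real \<Rightarrow> real" where
  "corr_ratio x = (case x of (a, b, d) \<Rightarrow> (p_rho\<^sup>2 * a - q_rho\<^sup>2 * d) /
    sqrt ((p_rho\<^sup>2 * a + 2 * p_rho * q_rho * b + q_rho\<^sup>2 * d) * (p_rho\<^sup>2 * a - 2 * p_rho * q_rho * b + q_rho\<^sup>2 * d)))"

lemma corr_ratio_measurable[measurable]: "corr_ratio \<in> borel_measurable (borel \<Otimes>\<^sub>M borel \<Otimes>\<^sub>M borel)"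
  unfolding corr_ratio_def[abs_def] by measurable

text \<open>The product under the root is x^2 + w^2, with x the numerator and w = sqrt(1 - \<rho>^2)
  s t. As c > 0, the condition c \<le> x / sqrt(x^2 + w^2) can be squared and solved to
  \<open>slope\<close> w \<le> x. Since x = s^2 - (1 - \<rho>)(s^2 + z^2 + t^2)/2, division by s t
  makes it linear in u and v.\<close>

lemma corr_ratio_event:
  assumes s: "0 < s" and t: "0 < t"
  shows "c \<le> corr_ratio (s\<^sup>2, s * z, z\<^sup>2 + t\<^sup>2) \<longleftrightarrow> ((s\<^sup>2 + z\<^sup>2 + t\<^sup>2) / (2 * s * t), s / t) \<in> tail_set"
proof -
  define x where "x = p_rho\<^sup>2 * s\<^sup>2 - q_rho\<^sup>2 * (z\<^sup>2 + t\<^sup>2)"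
  define w where "w = sqrt (1 - \<rho>\<^sup>2) * (s * t)"
  have w: "0 < w" using s t sr by (simp add: w_def)
  have w2: "w\<^sup>2 = 4 * p_rho\<^sup>2 * q_rho\<^sup>2 * s\<^sup>2 * t\<^sup>2"
    unfolding w_def pq_rho[symmetric] by (simp add: power_mult_distrib)
  \<comment> \<open>A difference of squares: the term 4 p^2 q^2 s^2 z^2 cancels against part of 4
    p^2 q^2 s^2 (z^2 + t^2), leaving w^2.\<close>
  have prod: "(p_rho\<^sup>2 * s\<^sup>2 + 2 * p_rho * q_rho * (s * z) + q_rho\<^sup>2 * (z\<^sup>2 + t\<^sup>2)) *
      (p_rho\<^sup>2 * s\<^sup>2 - 2 * p_rho * q_rho * (s * z) + q_rho\<^sup>2 * (z\<^sup>2 + t\<^sup>2)) = x\<^sup>2 + w\<^sup>2"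
    unfolding w2 x_def by (simp add: power2_eq_square algebra_simps)
  have pos: "0 < x\<^sup>2 + w\<^sup>2" using w by (simp add: add_nonneg_pos)
  have "c \<le> corr_ratio (s\<^sup>2, s * z, z\<^sup>2 + t\<^sup>2) \<longleftrightarrow> c \<le> x / sqrt (x\<^sup>2 + w\<^sup>2)"
    unfolding corr_ratio_def prod[symmetric] by (simp add: x_def)
  also have "\<dots> \<longleftrightarrow> c * sqrt (x\<^sup>2 + w\<^sup>2) \<le> x"
    using pos by (subst le_divide_eq) simp
  also have "\<dots> \<longleftrightarrow> slope * w \<le> x"
  proof
    assume a: "c * sqrt (x\<^sup>2 + w\<^sup>2) \<le> x"
    have c0: "0 < c" using rho_c by simp
    have x0: "0 \<le> x" using a c0 pos by (meson less_imp_le mult_nonneg_nonneg order.trans real_sqrt_ge_zero)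
    have "(c * sqrt (x\<^sup>2 + w\<^sup>2))\<^sup>2 \<le> x\<^sup>2" using a c0 pos by (intro power_mono) auto
    then have "c\<^sup>2 * w\<^sup>2 \<le> x\<^sup>2 * (1 - c\<^sup>2)" using pos by (simp add: power_mult_distrib algebra_simps)
    then have "c\<^sup>2 * w\<^sup>2 \<le> x\<^sup>2 * (sqrt (1 - c\<^sup>2))\<^sup>2" unfolding sc(2) .
    then have "(c * w)\<^sup>2 \<le> (x * sqrt (1 - c\<^sup>2))\<^sup>2" unfolding power_mult_distrib .
    then have "c * w \<le> x * sqrt (1 - c\<^sup>2)" by (rule power2_le_imp_le) (use x0 sc in auto)
    then show "slope * w \<le> x" using sc(1) by (simp add: slope_def divide_le_eq)
  next
    assume a: "slope * w \<le> x"
    have c0: "0 < c" using rho_c by simp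
    have x0: "0 < x" using a slope_pos w by (meson less_le_trans mult_pos_pos)
    have "c * w \<le> x * sqrt (1 - c\<^sup>2)" using a sc(1) by (simp add: slope_def divide_le_eq)
    then have "(c * w)\<^sup>2 \<le> (x * sqrt (1 - c\<^sup>2))\<^sup>2" using c0 w by (intro power_mono) auto
    then have "c\<^sup>2 * w\<^sup>2 \<le> x\<^sup>2 * (1 - c\<^sup>2)" unfolding power_mult_distrib sc(2) .
    then have "(c * sqrt (x\<^sup>2 + w\<^sup>2))\<^sup>2 \<le> x\<^sup>2" using pos by (simp add: power_mult_distrib algebra_simps)
    then show "c * sqrt (x\<^sup>2 + w\<^sup>2) \<le> x" by (rule power2_le_imp_le) (use x0 in auto)
  qed
  also have "\<dots> \<longleftrightarrow> ((s\<^sup>2 + z\<^sup>2 + t\<^sup>2) / (2 * s * t), s / t) \<in> tail_set"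
  proof -
    have "((s\<^sup>2 + z\<^sup>2 + t\<^sup>2) / (2 * s * t), s / t) \<in> tail_set \<longleftrightarrow>
      (1 - \<rho>) * ((s\<^sup>2 + z\<^sup>2 + t\<^sup>2) / (2 * s * t)) + slope * sqrt (1 - \<rho>\<^sup>2) \<le> s / t"
      by (simp add: tail_set_def)
    also have "\<dots> \<longleftrightarrow> ((1 - \<rho>) * ((s\<^sup>2 + z\<^sup>2 + t\<^sup>2) / (2 * s * t)) + slope * sqrt (1 - \<rho>\<^sup>2)) * (s * t) \<le> s / t * (s * t)"
      using s t by (subst mult_le_cancel_right_pos) auto
    also have "((1 - \<rho>) * ((s\<^sup>2 + z\<^sup>2 + t\<^sup>2) / (2 * s * t)) + slope * sqrt (1 - \<rho>\<^sup>2)) * (s * t) =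
      (1 - \<rho>) * (s\<^sup>2 + z\<^sup>2 + t\<^sup>2) / 2 + slope * w"
    proof -
      have "E / (2 * s * t) * (s * t) = E / 2" for E using s t by simp
      from this[of "s\<^sup>2 + z\<^sup>2 + t\<^sup>2"] show ?thesis
        unfolding w_def distrib_right mult.assoc[of "1 - \<rho>"] by (simp add: mult.assoc)
    qed
    also have "s / t * (s * t) = s\<^sup>2" using t by (simp add: power2_eq_square)
    also have "(1 - \<rho>) * (s\<^sup>2 + z\<^sup>2 + t\<^sup>2) / 2 + slope * w \<le> s\<^sup>2 \<longleftrightarrow> slope * w \<le> x"
    proof -
      have "x = s\<^sup>2 - (1 - \<rho>) * (s\<^sup>2 + z\<^sup>2 + t\<^sup>2) / 2"
        unfolding x_def p_rho(2) q_rho(2) by (simp add: field_simps)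
      then show ?thesis by linarith
    qed
    finally show ?thesis by simp
  qed
  finally show ?thesis .
qed

definition tail_prob :: "nat \<Rightarrow> real" where
  "tail_prob n = (1 / u0) ^ (n - 2) / pi *
    (LINT \<tau>|lborel. indicator {0<..} \<tau> * (exp (- real (n - 2) * \<tau>) *
      (u0 * exp \<tau> * angle_deriv slope offset u0 u1 (u0 * exp \<tau>))))"

lemma gauss_pearson_tail:
  assumes n: "2 < n" and s: "0 < s1" "0 < s2"
  shows "enn2real (\<integral>\<^sup>+U. \<integral>\<^sup>+V. indicator {r. c \<le> r}
      (pearson n (\<lambda>i. m1 + s1 * (p_rho * U i + q_rho * V i)) (\<lambda>i. m2 + s2 * (p_rho * U i - q_rho * V i)))
      \<partial>gauss_n n \<partial>gauss_n n) = tail_prob n"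
proof -
  \<comment> \<open>Of the n dimensions of V, one belongs to the mean and one to the direction of
    the centred U.\<close>
  define N where "N = n - 2"
  have N: "0 < N" "n = N + 2" "0 < n" using n by (auto simp: N_def)
  define A where "A = {x. c \<le> corr_ratio x}"
  have A_m[measurable]: "A \<in> sets (borel \<Otimes>\<^sub>M borel \<Otimes>\<^sub>M borel)"
  proof -
    have "A = {x \<in> space (borel \<Otimes>\<^sub>M borel \<Otimes>\<^sub>M borel). c \<le> corr_ratio x}"
      by (simp add: A_def space_pair_measure)
    then show ?thesis by simp
  qed
  have "indicator {r. c \<le> r}
      (pearson n (\<lambda>i. m1 + s1 * (p_rho * U i + q_rho * V i)) (\<lambda>i. m2 + s2 * (p_rho * U i - q_rho * V i))) =
    (indicator A (\<Sum>i=1..n. (U i - sample_mean n U)\<^sup>2,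
      \<Sum>i=1..n. (U i - sample_mean n U) * (V i - sample_mean n V),
      \<Sum>i=1..n. (V i - sample_mean n V)\<^sup>2) :: ennreal)" for U V
    unfolding pearson_gram[OF N(3) s] by (simp add: A_def corr_ratio_def indicator_def power2_eq_square)
  then have "(\<integral>\<^sup>+U. \<integral>\<^sup>+V. indicator {r. c \<le> r}
      (pearson n (\<lambda>i. m1 + s1 * (p_rho * U i + q_rho * V i)) (\<lambda>i. m2 + s2 * (p_rho * U i - q_rho * V i)))
      \<partial>gauss_n n \<partial>gauss_n n) =
    (\<integral>\<^sup>+\<sigma>. \<integral>\<^sup>+t. \<integral>\<^sup>+z. indicator A (\<sigma>, sqrt \<sigma> * z, z\<^sup>2 + t) \<partial>std_normal \<partial>chi_sq N \<partial>chi_sq (Suc N))"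
    unfolding N(2) using gram_integral[of "indicator A" N] by simp
  also have "\<dots> = ennreal (real N / pi) *
    (\<integral>\<^sup>+\<tau>. ennreal (indicator {0<..} \<tau> * ((1 / u0) ^ N / real N * (exp (- real N * \<tau>) *
      (u0 * exp \<tau> * angle_deriv slope offset u0 u1 (u0 * exp \<tau>))))) \<partial>lborel)"
    unfolding tail_integral[OF N(1), symmetric]
    by (rule gram_event[OF N(1) tail_set_measurable A_m]) (simp add: A_def corr_ratio_event)
  finally have "enn2real (\<integral>\<^sup>+U. \<integral>\<^sup>+V. indicator {r. c \<le> r}
      (pearson n (\<lambda>i. m1 + s1 * (p_rho * U i + q_rho * V i)) (\<lambda>i. m2 + s2 * (p_rho * U i - q_rho * V i)))
      \<partial>gauss_n n \<partial>gauss_n n) = real N / pi *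
    enn2real (\<integral>\<^sup>+\<tau>. ennreal (indicator {0<..} \<tau> * ((1 / u0) ^ N / real N * (exp (- real N * \<tau>) *
      (u0 * exp \<tau> * angle_deriv slope offset u0 u1 (u0 * exp \<tau>))))) \<partial>lborel)"
    by (simp add: enn2real_mult)
  also have "enn2real (\<integral>\<^sup>+\<tau>. ennreal (indicator {0<..} \<tau> * ((1 / u0) ^ N / real N * (exp (- real N * \<tau>) *
      (u0 * exp \<tau> * angle_deriv slope offset u0 u1 (u0 * exp \<tau>))))) \<partial>lborel) =
    (LINT \<tau>|lborel. indicator {0<..} \<tau> * ((1 / u0) ^ N / real N * (exp (- real N * \<tau>) *
      (u0 * exp \<tau> * angle_deriv slope offset u0 u1 (u0 * exp \<tau>)))))"
  proof (rule integral_eq_nn_integral[symmetric])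
    show "AE \<tau> in lborel. 0 \<le> indicator {0<..} \<tau> * ((1 / u0) ^ N / real N * (exp (- real N * \<tau>) *
      (u0 * exp \<tau> * angle_deriv slope offset u0 u1 (u0 * exp \<tau>))))"
    proof (rule AE_I2)
      fix \<tau> :: real
      show "0 \<le> indicator {0<..} \<tau> * ((1 / u0) ^ N / real N * (exp (- real N * \<tau>) *
        (u0 * exp \<tau> * angle_deriv slope offset u0 u1 (u0 * exp \<tau>))))"
        using u0_gt_1 angle_deriv_nonneg[of "u0 * exp \<tau>"] by (cases "0 < \<tau>") (auto intro!: mult_nonneg_nonneg)
    qed
  qed measurable
  also have "(LINT \<tau>|lborel. indicator {0<..} \<tau> * ((1 / u0) ^ N / real N * (exp (- real N * \<tau>) *
      (u0 * exp \<tau> * angle_deriv slope offset u0 u1 (u0 * exp \<tau>))))) =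
    (1 / u0) ^ N / real N * (LINT \<tau>|lborel. indicator {0<..} \<tau> * (exp (- real N * \<tau>) *
      (u0 * exp \<tau> * angle_deriv slope offset u0 u1 (u0 * exp \<tau>))))"
    by (subst Bochner_Integration.integral_mult_right_zero[symmetric]) (simp add: mult.left_commute)
  finally show ?thesis using N(1) by (simp add: tail_prob_def N_def[symmetric])
qed

end

section \<open>Bivariate Gaussian laws as images of independent normal pairs\<close>

lemma std_normal_pair_orthogonal:
  fixes F :: "real \<times> real \<Rightarrow> ennreal" and \<alpha> \<beta> \<gamma> \<delta> :: real
  assumes F[measurable]: "F \<in> borel_measurable (borel \<Otimes>\<^sub>M borel)"
    and 1: "\<alpha>\<^sup>2 + \<beta>\<^sup>2 = 1" "\<gamma>\<^sup>2 + \<delta>\<^sup>2 = 1" "\<alpha> * \<gamma> + \<beta> * \<delta> = 0"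
  shows "(\<integral>\<^sup>+z. \<integral>\<^sup>+w. F (\<alpha> * z + \<beta> * w, \<gamma> * z + \<delta> * w) \<partial>std_normal \<partial>std_normal) =
    (\<integral>\<^sup>+z. \<integral>\<^sup>+w. F (z, w) \<partial>std_normal \<partial>std_normal)"
proof -
  \<comment> \<open>The determinant. Being 1 or -1, it shows that the map is a rotation followed by
    a possible sign change of the second coordinate.\<close>
  define \<epsilon> where "\<epsilon> = \<alpha> * \<delta> - \<beta> * \<gamma>"
  have "\<epsilon>\<^sup>2 = (\<alpha>\<^sup>2 + \<beta>\<^sup>2) * (\<gamma>\<^sup>2 + \<delta>\<^sup>2) - (\<alpha> * \<gamma> + \<beta> * \<delta>)\<^sup>2"
    by (simp add: \<epsilon>_def power2_eq_square algebra_simps)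
  then have \<epsilon>: "\<epsilon> = 1 \<or> \<epsilon> = - 1" unfolding 1 by (simp add: power2_eq_1_iff)
  have \<gamma>: "\<gamma> = - \<epsilon> * \<beta>"
  proof -
    have "\<gamma> = \<gamma> * (\<alpha>\<^sup>2 + \<beta>\<^sup>2) - \<alpha> * (\<alpha> * \<gamma> + \<beta> * \<delta>)" unfolding 1 by simp
    also have "\<dots> = - \<epsilon> * \<beta>" by (simp add: \<epsilon>_def power2_eq_square algebra_simps)
    finally show ?thesis .
  qed
  have \<delta>: "\<delta> = \<epsilon> * \<alpha>"
  proof -
    have "\<delta> = \<delta> * (\<alpha>\<^sup>2 + \<beta>\<^sup>2) - \<beta> * (\<alpha> * \<gamma> + \<beta> * \<delta>)" unfolding 1 by simp
    also have "\<dots> = \<epsilon> * \<alpha>" by (simp add: \<epsilon>_def power2_eq_square algebra_simps)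
    finally show ?thesis .
  qed
  have e: "\<gamma> * z + \<delta> * w = \<epsilon> * (\<alpha> * w - \<beta> * z)" for z w
    unfolding \<gamma> \<delta> by (simp add: algebra_simps)
  have "(\<integral>\<^sup>+z. \<integral>\<^sup>+w. F (\<alpha> * z + \<beta> * w, \<epsilon> * (\<alpha> * w - \<beta> * z)) \<partial>std_normal \<partial>std_normal) =
    (\<integral>\<^sup>+z. \<integral>\<^sup>+w. F (z, \<epsilon> * w) \<partial>std_normal \<partial>std_normal)"
    using std_normal_rotation[of "\<lambda>x. F (fst x, \<epsilon> * snd x)", OF _ 1(1)] by simp
  also have "\<dots> = (\<integral>\<^sup>+z. \<integral>\<^sup>+w. F (z, w) \<partial>std_normal \<partial>std_normal)"
    using \<epsilon> std_normal_minus[of "\<lambda>w. F (z, w)" for z] by auto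
  finally show ?thesis unfolding e .
qed

abbreviation std_normal2 :: "(real \<times> real) measure" where
  "std_normal2 \<equiv> std_normal \<Otimes>\<^sub>M std_normal"

lemma prob_space_std_normal2: "prob_space std_normal2"
  by unfold_locales

lemma nn_integral_std_normal2:
  assumes "F \<in> borel_measurable (borel \<Otimes>\<^sub>M borel)"
  shows "(\<integral>\<^sup>+x. F x \<partial>std_normal2) = (\<integral>\<^sup>+z. \<integral>\<^sup>+w. F (z, w) \<partial>std_normal \<partial>std_normal)"
proof -
  have "F \<in> borel_measurable std_normal2" using assms by (simp cong: measurable_cong_sets)
  then show ?thesis by (rule std_normal.nn_integral_fst[symmetric])
qed

lemma has_bochner_integral_std_normal_moments:
  "has_bochner_integral std_normal (\<lambda>x. 1) (1::real)"
  "has_bochner_integral std_normal (\<lambda>x. x) 0"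
  "has_bochner_integral std_normal (\<lambda>x. x\<^sup>2) 1"
proof -
  show "has_bochner_integral std_normal (\<lambda>x. 1) (1::real)"
    using std_normal.prob_space by (simp add: has_bochner_integral_iff)
  have "has_bochner_integral lborel (\<lambda>x. std_normal_density x *\<^sub>R x) 0"
    using std_normal_moment_odd[of 0] by simp
  then show "has_bochner_integral std_normal (\<lambda>x. x) 0"
    unfolding std_normal_def by (intro has_bochner_integral_density) (auto simp: normal_density_nonneg)
  have "has_bochner_integral lborel (\<lambda>x. std_normal_density x *\<^sub>R x\<^sup>2) 1"
    using std_normal_moment_even[of 1] by simp
  then show "has_bochner_integral std_normal (\<lambda>x. x\<^sup>2) 1"
    unfolding std_normal_def by (intro has_bochner_integral_density) (auto simp: normal_density_nonneg)
qed

lemma has_bochner_integral_pair_mult: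
  fixes f g :: "real \<Rightarrow> real"
  assumes f: "has_bochner_integral std_normal f a" and g: "has_bochner_integral std_normal g b"
  shows "has_bochner_integral std_normal2 (\<lambda>x. f (fst x) * g (snd x)) (a * b)"
proof -
  have fi: "integrable std_normal f" "integral\<^sup>L std_normal f = a"
    and gi: "integrable std_normal g" "integral\<^sup>L std_normal g = b"
    using f g by (auto simp: has_bochner_integral_iff)
  have [measurable]: "f \<in> borel_measurable borel" "g \<in> borel_measurable borel"
    using borel_measurable_integrable[OF fi(1)] borel_measurable_integrable[OF gi(1)]
    by (simp_all cong: measurable_cong_sets)
  have i: "integrable std_normal2 (\<lambda>x. f (fst x) * g (snd x))"
    by (rule std_normal_pair.Fubini_integrable) (use fi gi in \<open>auto simp: abs_mult\<close>)
  moreover have "integral\<^sup>L std_normal2 (\<lambda>x. f (fst x) * g (snd x)) = a * b"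
    using std_normal_pair.integral_fst'[OF i] fi gi by simp
  ultimately show ?thesis by (simp add: has_bochner_integral_iff)
qed

lemma std_normal2_linear:
  "has_bochner_integral std_normal2 (\<lambda>x. \<alpha> * fst x + \<beta> * snd x) 0"
proof -
  have "has_bochner_integral std_normal2 (\<lambda>x. \<alpha> * (fst x * 1) + \<beta> * (1 * snd x)) (\<alpha> * (0 * 1) + \<beta> * (1 * 0))"
    by (intro has_bochner_integral_add has_bochner_integral_mult_right
      has_bochner_integral_pair_mult[of "\<lambda>x. x" _ "\<lambda>x. 1"] has_bochner_integral_pair_mult[of "\<lambda>x. 1" _ "\<lambda>x. x"]
      has_bochner_integral_std_normal_moments)
  then show ?thesis by simp
qed

lemma std_normal2_bilinear:
  "has_bochner_integral std_normal2 (\<lambda>x. (\<alpha> * fst x + \<beta> * snd x) * (\<gamma> * fst x + \<delta> * snd x)) (\<alpha> * \<gamma> + \<beta> * \<delta>)"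
proof -
  have "has_bochner_integral std_normal2
    (\<lambda>x. (\<alpha> * \<gamma>) * ((fst x)\<^sup>2 * 1) + ((\<alpha> * \<delta> + \<beta> * \<gamma>) * (fst x * snd x) + (\<beta> * \<delta>) * (1 * (snd x)\<^sup>2)))
    ((\<alpha> * \<gamma>) * (1 * 1) + ((\<alpha> * \<delta> + \<beta> * \<gamma>) * (0 * 0) + (\<beta> * \<delta>) * (1 * 1)))"
    by (intro has_bochner_integral_add has_bochner_integral_mult_right
      has_bochner_integral_pair_mult[of "\<lambda>x. x\<^sup>2" _ "\<lambda>x. 1"] has_bochner_integral_pair_mult[of "\<lambda>x. 1" _ "\<lambda>x. x\<^sup>2"]
      has_bochner_integral_pair_mult[of "\<lambda>x. x" _ "\<lambda>x. x"]
      has_bochner_integral_std_normal_moments)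
  then show ?thesis by (simp add: power2_eq_square algebra_simps)
qed

lemma distr_std_normal2_orthogonal:
  fixes S :: "real \<times> real \<Rightarrow> real \<times> real"
  assumes S: "S \<in> (borel \<Otimes>\<^sub>M borel) \<rightarrow>\<^sub>M borel"
    and o: "\<alpha>\<^sup>2 + \<beta>\<^sup>2 = 1" "\<gamma>\<^sup>2 + \<delta>\<^sup>2 = 1" "\<alpha> * \<gamma> + \<beta> * \<delta> = 0"
  shows "distr std_normal2 borel (\<lambda>x. S (\<alpha> * fst x + \<beta> * snd x, \<gamma> * fst x + \<delta> * snd x)) =
    distr std_normal2 borel S"
proof (rule measure_eqI)
  define T where "T x = S (\<alpha> * fst x + \<beta> * snd x, \<gamma> * fst x + \<delta> * snd x)" for x
  note [measurable] = S
  have T[measurable]: "T \<in> (borel \<Otimes>\<^sub>M borel) \<rightarrow>\<^sub>M borel" unfolding T_def[abs_def] by measurable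
  fix X assume "X \<in> sets (distr std_normal2 borel (\<lambda>x. S (\<alpha> * fst x + \<beta> * snd x, \<gamma> * fst x + \<delta> * snd x)))"
  then have X[measurable]: "X \<in> sets borel" by simp
  have em: "emeasure (distr std_normal2 borel R) X = (\<integral>\<^sup>+x. indicator X (R x) \<partial>std_normal2)"
    if R: "R \<in> (borel \<Otimes>\<^sub>M borel) \<rightarrow>\<^sub>M borel" for R :: "real \<times> real \<Rightarrow> real \<times> real"
  proof -
    have "R \<in> std_normal2 \<rightarrow>\<^sub>M borel" using R by (simp cong: measurable_cong_sets)
    from nn_integral_distr[OF this, of "indicator X"] show ?thesis by simp
  qed
  have "(\<integral>\<^sup>+x. indicator X (T x) \<partial>std_normal2) = (\<integral>\<^sup>+z. \<integral>\<^sup>+w. indicator X (T (z, w)) \<partial>std_normal \<partial>std_normal)"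
    by (rule nn_integral_std_normal2) measurable
  also have "\<dots> = (\<integral>\<^sup>+z. \<integral>\<^sup>+w. indicator X (S (z, w)) \<partial>std_normal \<partial>std_normal)"
    unfolding T_def fst_conv snd_conv by (rule std_normal_pair_orthogonal[OF _ o]) measurable
  also have "\<dots> = (\<integral>\<^sup>+x. indicator X (S x) \<partial>std_normal2)"
    by (rule nn_integral_std_normal2[symmetric]) measurable
  finally have "emeasure (distr std_normal2 borel T) X = emeasure (distr std_normal2 borel S) X"
    unfolding em[OF T] em[OF S] .
  then show "emeasure (distr std_normal2 borel (\<lambda>x. S (\<alpha> * fst x + \<beta> * snd x, \<gamma> * fst x + \<delta> * snd x))) X =
    emeasure (distr std_normal2 borel S) X"
    unfolding T_def[abs_def] .
qed simp

text \<open>An arbitrary linear representation is brought to the sum and difference form by an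
  orthogonal change of the two normal variables, under which their joint law is invariant. Positive
  variances allow the two coefficient rows to be normalised.\<close>

lemma gaussian_law_representation:
  assumes N: "gaussian_law \<rho> N" and \<rho>: "- 1 < \<rho>" "\<rho> < 1"
  obtains m1 m2 s1 s2 where "0 < s1" "0 < s2"
    "N = distr std_normal2 borel (\<lambda>x. (m1 + s1 * (sqrt ((1 + \<rho>) / 2) * fst x + sqrt ((1 - \<rho>) / 2) * snd x),
      m2 + s2 * (sqrt ((1 + \<rho>) / 2) * fst x - sqrt ((1 - \<rho>) / 2) * snd x)))"
proof -
  obtain m1 m2 a11 a12 a21 a22 where N_eq: "N = distr std_normal2 borel
      (\<lambda>(z, w). (m1 + a11 * z + a12 * w, m2 + a21 * z + a22 * w))"
    using N by (auto simp: gaussian_law_def gaussian2_def)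
  define T where "T x = (m1 + (a11 * fst x + a12 * snd x), m2 + (a21 * fst x + a22 * snd x))" for x :: "real \<times> real"
  have T_m: "T \<in> borel_measurable (borel \<Otimes>\<^sub>M borel)" unfolding T_def[abs_def] by measurable
  have T_m'[measurable]: "T \<in> std_normal2 \<rightarrow>\<^sub>M borel" using T_m by (simp cong: measurable_cong_sets)
  have N_T: "N = distr std_normal2 borel T"
    unfolding N_eq by (rule arg_cong[where f = "distr std_normal2 borel"]) (auto simp: T_def fun_eq_iff)
  have E: "integral\<^sup>L N f = integral\<^sup>L std_normal2 (\<lambda>x. f (T x))"
    if "f \<in> borel_measurable borel" for f :: "real \<times> real \<Rightarrow> real"
    unfolding N_T using that by (intro integral_distr) auto
  have one: "integral\<^sup>L std_normal2 (\<lambda>x. m + (\<alpha> * fst x + \<beta> * snd x)) = m" for m \<alpha> \<beta> :: real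
    using std_normal2_linear[of \<alpha> \<beta>] using prob_space.prob_space[OF prob_space_std_normal2]
    by (simp add: has_bochner_integral_iff)
  have fs[measurable]: "(fst :: real \<times> real \<Rightarrow> real) \<in> borel_measurable borel" "(snd :: real \<times> real \<Rightarrow> real) \<in> borel_measurable borel"
    unfolding borel_prod[symmetric] by measurable
  have mean1: "integral\<^sup>L N fst = m1" using E[OF fs(1)] one by (simp add: T_def)
  have mean2: "integral\<^sup>L N snd = m2" using E[OF fs(2)] one by (simp add: T_def)
  have cov: "covariance N fst snd = a11 * a21 + a12 * a22"
    unfolding covariance_def mean1 mean2
    by (subst E) (auto simp: T_def intro: has_bochner_integral_integral_eq[OF std_normal2_bilinear])
  have var1: "integral\<^sup>L N (\<lambda>x. (fst x - m1)\<^sup>2) = a11\<^sup>2 + a12\<^sup>2"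
    by (subst E) (auto simp: T_def power2_eq_square intro: has_bochner_integral_integral_eq[OF std_normal2_bilinear])
  have var2: "integral\<^sup>L N (\<lambda>x. (snd x - m2)\<^sup>2) = a21\<^sup>2 + a22\<^sup>2"
    by (subst E) (auto simp: T_def power2_eq_square intro: has_bochner_integral_integral_eq[OF std_normal2_bilinear])
  define s1 s2 where "s1 = sqrt (a11\<^sup>2 + a12\<^sup>2)" and "s2 = sqrt (a21\<^sup>2 + a22\<^sup>2)"
  have pos: "0 < s1" "0 < s2"
    using N by (auto simp: gaussian_law_def mean1 mean2 var1 var2 s1_def s2_def)
  have s2: "s1\<^sup>2 = a11\<^sup>2 + a12\<^sup>2" "s2\<^sup>2 = a21\<^sup>2 + a22\<^sup>2" by (auto simp: s1_def s2_def)
  have rho: "a11 * a21 + a12 * a22 = \<rho> * (s1 * s2)"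
  proof -
    have "correlation N fst snd = \<rho>" using N by (simp add: gaussian_law_def)
    then have "(a11 * a21 + a12 * a22) / (s1 * s2) = \<rho>"
      by (simp add: correlation_def cov mean1 mean2 var1 var2 s1_def s2_def real_sqrt_mult)
    then show ?thesis using pos by (simp add: field_simps)
  qed
  define p q where "p = sqrt ((1 + \<rho>) / 2)" and "q = sqrt ((1 - \<rho>) / 2)"
  have pq: "0 < p" "0 < q" "p\<^sup>2 = (1 + \<rho>) / 2" "q\<^sup>2 = (1 - \<rho>) / 2"
    using \<rho> by (auto simp: p_def q_def)
  define e1 e2 f1 f2 where "e1 = a11 / s1" and "e2 = a12 / s1" and "f1 = a21 / s2" and "f2 = a22 / s2"
  have a: "a11 = s1 * e1" "a12 = s1 * e2" "a21 = s2 * f1" "a22 = s2 * f2"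
    using pos by (auto simp: e1_def e2_def f1_def f2_def)
  have ee: "e1\<^sup>2 + e2\<^sup>2 = 1" "f1\<^sup>2 + f2\<^sup>2 = 1"
    using s2 pos by (auto simp: a power_mult_distrib distrib_left[symmetric])
  have ef: "e1 * f1 + e2 * f2 = \<rho>"
  proof -
    have "(s1 * s2) * (e1 * f1 + e2 * f2) = (s1 * s2) * \<rho>" using rho by (simp add: a algebra_simps)
    then show ?thesis using pos by simp
  qed
  \<comment> \<open>The rows e and f are unit vectors with inner product \<rho>. As diagonals of a
    rhombus, e + f and e - f are orthogonal, and their lengths are 2 p and 2 q.\<close>
  define \<alpha> \<beta> \<gamma> \<delta> where "\<alpha> = (e1 + f1) / (2 * p)" and "\<beta> = (e2 + f2) / (2 * p)"
    and "\<gamma> = (e1 - f1) / (2 * q)" and "\<delta> = (e2 - f2) / (2 * q)"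
  have o1: "\<alpha>\<^sup>2 + \<beta>\<^sup>2 = 1"
  proof -
    have "\<alpha>\<^sup>2 + \<beta>\<^sup>2 = ((e1\<^sup>2 + e2\<^sup>2) + (f1\<^sup>2 + f2\<^sup>2) + 2 * (e1 * f1 + e2 * f2)) / (4 * p\<^sup>2)"
      unfolding \<alpha>_def \<beta>_def power_divide power_mult_distrib add_divide_distrib[symmetric]
      by (simp add: power2_eq_square algebra_simps)
    then show ?thesis unfolding ee ef pq using \<rho> by simp
  qed
  have o2: "\<gamma>\<^sup>2 + \<delta>\<^sup>2 = 1"
  proof -
    have "\<gamma>\<^sup>2 + \<delta>\<^sup>2 = ((e1\<^sup>2 + e2\<^sup>2) + (f1\<^sup>2 + f2\<^sup>2) - 2 * (e1 * f1 + e2 * f2)) / (4 * q\<^sup>2)"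
      unfolding \<gamma>_def \<delta>_def power_divide power_mult_distrib add_divide_distrib[symmetric]
      by (simp add: power2_eq_square algebra_simps)
    then show ?thesis unfolding ee ef pq using \<rho> by simp
  qed
  have o3: "\<alpha> * \<gamma> + \<beta> * \<delta> = 0"
  proof -
    have "\<alpha> * \<gamma> + \<beta> * \<delta> = ((e1\<^sup>2 + e2\<^sup>2) - (f1\<^sup>2 + f2\<^sup>2)) / (4 * p * q)"
      unfolding \<alpha>_def \<beta>_def \<gamma>_def \<delta>_def times_divide_times_eq
      by (simp add: add_divide_distrib[symmetric] power2_eq_square algebra_simps)
    then show ?thesis unfolding ee by simp
  qed
  define S where "S x = (m1 + s1 * (p * fst x + q * snd x), m2 + s2 * (p * fst x - q * snd x))" for x :: "real \<times> real"
  have S_m: "S \<in> (borel \<Otimes>\<^sub>M borel) \<rightarrow>\<^sub>M borel" unfolding S_def[abs_def] by measurable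
  have ST: "S (\<alpha> * z + \<beta> * w, \<gamma> * z + \<delta> * w) = T (z, w)" for z w
  proof -
    have "p * (\<alpha> * z + \<beta> * w) = ((e1 + f1) * z + (e2 + f2) * w) / 2"
      using pq by (simp add: \<alpha>_def \<beta>_def field_simps)
    moreover have "q * (\<gamma> * z + \<delta> * w) = ((e1 - f1) * z + (e2 - f2) * w) / 2"
      using pq by (simp add: \<gamma>_def \<delta>_def field_simps)
    ultimately have pq': "p * (\<alpha> * z + \<beta> * w) + q * (\<gamma> * z + \<delta> * w) = e1 * z + e2 * w"
      "p * (\<alpha> * z + \<beta> * w) - q * (\<gamma> * z + \<delta> * w) = f1 * z + f2 * w"
      by (simp_all add: field_simps)
    show ?thesis
      unfolding S_def T_def fst_conv snd_conv pq' a by (simp add: algebra_simps)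
  qed
  have "N = distr std_normal2 borel S"
    unfolding distr_std_normal2_orthogonal[OF S_m o1 o2 o3, symmetric] ST N_T by simp
  then show ?thesis using that[OF pos] unfolding S_def[abs_def] p_def q_def by blast
qed

text \<open>This regroups n independent pairs into two independent vectors. The induction peels off
  the last pair (z, w); Tonelli moves w past u, so that w can join v and z can join u.\<close>

lemma nn_integral_PiM_pair_image:
  fixes T :: "real \<times> real \<Rightarrow> real \<times> real"
  assumes T[measurable]: "T \<in> (borel \<Otimes>\<^sub>M borel) \<rightarrow>\<^sub>M borel"
    and N: "N = distr std_normal2 borel T"
    and f: "f \<in> borel_measurable (Pi\<^sub>M {1..n} (\<lambda>_. borel))"
  shows "(\<integral>\<^sup>+x. f x \<partial>Pi\<^sub>M {1..n} (\<lambda>_. N)) =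
    (\<integral>\<^sup>+u. \<integral>\<^sup>+v. f (\<lambda>i\<in>{1..n}. T (u i, v i)) \<partial>gauss_n n \<partial>gauss_n n)"
  using f
proof (induction n arbitrary: f)
  case 0
  have "emeasure (Pi\<^sub>M {} (\<lambda>_::nat. std_normal)) (space (Pi\<^sub>M {} (\<lambda>_::nat. std_normal))) = 1"
    by (intro prob_space.emeasure_space_1 prob_space_PiM prob_space_std_normal)
  moreover have "(\<integral>\<^sup>+x. f x \<partial>Pi\<^sub>M {} (\<lambda>_. N)) = f (\<lambda>_. undefined)"
    by (simp add: PiM_empty nn_integral_count_space_finite)
  ultimately show ?case by simp
next
  case (Suc n)
  have T'[measurable]: "T \<in> std_normal2 \<rightarrow>\<^sub>M borel" using T by (simp cong: measurable_cong_sets)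
  have sets_N[measurable_cong]: "sets N = sets borel" by (simp add: N)
  have prob_N: "prob_space N" unfolding N using prob_space_std_normal2 T' by (rule prob_space.prob_space_distr)
  interpret NN: prob_space N by (rule prob_N)
  interpret NP: product_prob_space "\<lambda>_::nat. N" UNIV ..
  note [measurable] = Suc.prems
  have e: "{1..Suc n} = insert (Suc n) {1..n}" by auto
  have f'[measurable]: "f \<in> borel_measurable (Pi\<^sub>M (insert (Suc n) {1..n}) (\<lambda>_. borel))"
    using Suc.prems unfolding e .
  have upd: "(\<lambda>i\<in>{1..Suc n}. T ((u(Suc n := z)) i, (v(Suc n := w)) i)) = (\<lambda>i\<in>{1..n}. T (u i, v i))(Suc n := T (z, w))" for u v z w
    by (auto simp: fun_eq_iff restrict_def)
  have m[measurable]: "(\<lambda>x. (\<lambda>i\<in>{1..n}. T (g x i, h x i))(Suc n := k x)) \<in> M \<rightarrow>\<^sub>M Pi\<^sub>M {1..Suc n} (\<lambda>_. borel)"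
    if [measurable]: "g \<in> M \<rightarrow>\<^sub>M gauss_n n" "h \<in> M \<rightarrow>\<^sub>M gauss_n n" "k \<in> M \<rightarrow>\<^sub>M borel" for g h k and M :: "'x measure"
    unfolding e
  proof (rule measurable_fun_upd[where J = "{1..n}"])
    show "(\<lambda>x. \<lambda>i\<in>{1..n}. T (g x i, h x i)) \<in> M \<rightarrow>\<^sub>M Pi\<^sub>M {1..n} (\<lambda>_. borel)"
    proof (rule measurable_restrict)
      fix i assume i: "i \<in> {1..n}"
      have [measurable]: "(\<lambda>x. g x i) \<in> borel_measurable M" "(\<lambda>x. h x i) \<in> borel_measurable M"
        using measurable_compose[OF that(1) measurable_component_singleton[OF i]]
          measurable_compose[OF that(2) measurable_component_singleton[OF i]] by (simp_all cong: measurable_cong_sets)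
      show "(\<lambda>x. T (g x i, h x i)) \<in> M \<rightarrow>\<^sub>M borel" by measurable
    qed
  qed auto
  interpret g1: sigma_finite_measure "gauss_n n" by (rule sigma_finite_gauss_n)
  interpret g2: pair_sigma_finite "gauss_n n" std_normal
    by (intro pair_sigma_finite.intro sigma_finite_gauss_n sigma_finite_std_normal)
  have [measurable]: "(\<lambda>u. \<lambda>i\<in>{1..Suc n}. T (g u i, h u i)) \<in> M \<rightarrow>\<^sub>M Pi\<^sub>M {1..Suc n} (\<lambda>_. borel)"
    if gh: "g \<in> M \<rightarrow>\<^sub>M gauss_n (Suc n)" "h \<in> M \<rightarrow>\<^sub>M gauss_n (Suc n)" for g h and M :: "'x measure"
  proof (rule measurable_restrict)
    fix i assume i: "i \<in> {1..Suc n}"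
    have [measurable]: "(\<lambda>x. g x i) \<in> borel_measurable M" "(\<lambda>x. h x i) \<in> borel_measurable M"
      using measurable_compose[OF gh(1) measurable_component_singleton[OF i]]
        measurable_compose[OF gh(2) measurable_component_singleton[OF i]] by (simp_all cong: measurable_cong_sets)
    show "(\<lambda>x. T (g x i, h x i)) \<in> M \<rightarrow>\<^sub>M borel" by measurable
  qed
  interpret gS: sigma_finite_measure "gauss_n (Suc n)" by (rule sigma_finite_gauss_n)
  have "(\<integral>\<^sup>+x. f x \<partial>Pi\<^sub>M {1..Suc n} (\<lambda>_. N)) = (\<integral>\<^sup>+y. \<integral>\<^sup>+x. f (x(Suc n := y)) \<partial>Pi\<^sub>M {1..n} (\<lambda>_. N) \<partial>N)"
  proof -
    have "f \<in> borel_measurable (Pi\<^sub>M (insert (Suc n) {1..n}) (\<lambda>_. N))"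
      using f' sets_PiM_cong[OF refl, of "insert (Suc n) {1..n}" "\<lambda>_. N" "\<lambda>_. borel"] sets_N
      by (simp cong: measurable_cong_sets)
    then show ?thesis
      unfolding e by (intro NP.product_nn_integral_insert_rev) auto
  qed
  also have "\<dots> = (\<integral>\<^sup>+y. \<integral>\<^sup>+u. \<integral>\<^sup>+v. f ((\<lambda>i\<in>{1..n}. T (u i, v i))(Suc n := y)) \<partial>gauss_n n \<partial>gauss_n n \<partial>N)"
  proof (rule nn_integral_cong)
    fix y :: "real \<times> real"
    have "(\<lambda>x. f (x(Suc n := y))) \<in> borel_measurable (Pi\<^sub>M {1..n} (\<lambda>_. borel))"
      by (rule measurable_compose[OF _ f'], rule measurable_fun_upd[where J = "{1..n}"]) auto
    then show "(\<integral>\<^sup>+x. f (x(Suc n := y)) \<partial>Pi\<^sub>M {1..n} (\<lambda>_. N)) =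
      (\<integral>\<^sup>+u. \<integral>\<^sup>+v. f ((\<lambda>i\<in>{1..n}. T (u i, v i))(Suc n := y)) \<partial>gauss_n n \<partial>gauss_n n)"
      by (rule Suc.IH)
  qed
  also have "\<dots> = (\<integral>\<^sup>+x. \<integral>\<^sup>+u. \<integral>\<^sup>+v. f ((\<lambda>i\<in>{1..n}. T (u i, v i))(Suc n := T x)) \<partial>gauss_n n \<partial>gauss_n n \<partial>std_normal2)"
    unfolding N by (rule nn_integral_distr) measurable
  also have "\<dots> = (\<integral>\<^sup>+z. \<integral>\<^sup>+w. \<integral>\<^sup>+u. \<integral>\<^sup>+v. f ((\<lambda>i\<in>{1..n}. T (u i, v i))(Suc n := T (z, w))) \<partial>gauss_n n \<partial>gauss_n n \<partial>std_normal \<partial>std_normal)"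
    by (rule nn_integral_std_normal2) measurable
  also have "\<dots> = (\<integral>\<^sup>+z. \<integral>\<^sup>+u. \<integral>\<^sup>+w. \<integral>\<^sup>+v. f ((\<lambda>i\<in>{1..n}. T (u i, v i))(Suc n := T (z, w))) \<partial>gauss_n n \<partial>std_normal \<partial>gauss_n n \<partial>std_normal)"
    by (rule nn_integral_cong, rule g2.Fubini') measurable
  also have "\<dots> = (\<integral>\<^sup>+z. \<integral>\<^sup>+u. \<integral>\<^sup>+v. f (\<lambda>i\<in>{1..Suc n}. T ((u(Suc n := z)) i, v i)) \<partial>gauss_n (Suc n) \<partial>gauss_n n \<partial>std_normal)"
  proof (rule nn_integral_cong, rule nn_integral_cong)
    fix z and u assume u: "u \<in> space (gauss_n n)"
    have u': "u(Suc n := z) \<in> space (gauss_n (Suc n))"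
      using u by (auto simp: space_PiM PiE_def extensional_def)
    have "(\<lambda>v. f (\<lambda>i\<in>{1..Suc n}. T ((u(Suc n := z)) i, v i))) \<in> borel_measurable (gauss_n (Suc n))"
      using u' by measurable
    from gauss_n_Suc_integral[OF this]
    show "(\<integral>\<^sup>+w. \<integral>\<^sup>+v. f ((\<lambda>i\<in>{1..n}. T (u i, v i))(Suc n := T (z, w))) \<partial>gauss_n n \<partial>std_normal) =
      (\<integral>\<^sup>+v. f (\<lambda>i\<in>{1..Suc n}. T ((u(Suc n := z)) i, v i)) \<partial>gauss_n (Suc n))"
      unfolding upd by simp
  qed
  also have "\<dots> = (\<integral>\<^sup>+u. \<integral>\<^sup>+v. f (\<lambda>i\<in>{1..Suc n}. T (u i, v i)) \<partial>gauss_n (Suc n) \<partial>gauss_n (Suc n))"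
    by (rule gauss_n_Suc_integral[symmetric]) measurable
  finally show ?case .
qed

section \<open>Spherical vectors\<close>

lemma centered_norm_eq_0_iff:
  assumes "0 < n"
  shows "centered_norm n x = 0 \<longleftrightarrow> (\<exists>k. \<forall>i\<in>{1..n}. x i = k)"
proof
  assume "centered_norm n x = 0"
  then have "\<forall>i\<in>{1..n}. (x i - sample_mean n x)\<^sup>2 = 0"
    by (subst (asm) centered_norm_def) (simp add: sum_nonneg_eq_0_iff)
  then show "\<exists>k. \<forall>i\<in>{1..n}. x i = k" by auto
next
  assume "\<exists>k. \<forall>i\<in>{1..n}. x i = k"
  then obtain k where k: "\<And>i. i \<in> {1..n} \<Longrightarrow> x i = k" by auto
  then have "sample_mean n x = k" using assms by (simp add: sample_mean_def)
  then show "centered_norm n x = 0" using k by (simp add: centered_norm_def)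
qed

lemma centered_norm_measurable[measurable]:
  assumes [measurable]: "\<And>i. i \<in> {1..n} \<Longrightarrow> (\<lambda>\<omega>. f \<omega> i) \<in> borel_measurable M"
  shows "(\<lambda>\<omega>. centered_norm n (f \<omega>)) \<in> borel_measurable M"
  unfolding centered_norm_def sample_mean_def by measurable

lemma mat_apply_measurable[measurable]: "mat_apply n A \<in> Rn n \<rightarrow>\<^sub>M Rn n"
  unfolding mat_apply_def[abs_def] by (rule measurable_restrict) measurable

text \<open>The centred y sums to zero, so x need not be centred in the numerator. It follows that y
  acts only through its centred unit direction.\<close>

lemma pearson_eq_inner:
  assumes "0 < n" "centered_norm n y \<noteq> 0"
  shows "pearson n x y = (\<Sum>i=1..n. x i * ((y i - sample_mean n y) / centered_norm n y)) / centered_norm n x"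
proof -
  have z: "(\<Sum>i=1..n. y i - sample_mean n y) = 0"
    using sum_eq_sample_mean[OF assms(1), of y] by (simp add: sum_subtractf)
  have "(\<Sum>i=1..n. (x i - sample_mean n x) * (y i - sample_mean n y)) =
    (\<Sum>i=1..n. x i * (y i - sample_mean n y)) - sample_mean n x * (\<Sum>i=1..n. y i - sample_mean n y)"
    by (simp add: left_diff_distrib sum_subtractf sum_distrib_left[symmetric])
  then have "pearson n x y = (\<Sum>i=1..n. x i * (y i - sample_mean n y)) / (centered_norm n x * centered_norm n y)"
    unfolding z by (simp add: pearson_def centered_norm_def real_sqrt_mult)
  then show ?thesis using assms(2) by (simp add: sum_divide_distrib[symmetric] mult.commute)
qed

text \<open>The matrix of the Householder reflection along d when E is half the squared length of
  d.\<close>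

definition reflection :: "(nat \<Rightarrow> real) \<Rightarrow> real \<Rightarrow> nat \<Rightarrow> nat \<Rightarrow> real" where
  "reflection d E i j = (if i = j then 1 else 0) - d i * d j / E"

lemma reflection_orthogonal:
  assumes d: "(\<Sum>i=1..n. (d i)\<^sup>2) = 2 * E" and E: "E \<noteq> 0"
  shows "orthogonal_mat n (reflection d E)"
  unfolding orthogonal_mat_def
proof (intro ballI)
  fix i j assume ij: "i \<in> {1..n}" "j \<in> {1..n}"
  have "(\<Sum>k=1..n. reflection d E k i * reflection d E k j) =
    (\<Sum>k=1..n. (if k = i then (if k = j then 1 else 0) else 0) - (if k = i then d k * d j / E else 0)
      - (if k = j then d k * d i / E else 0) + (d k)\<^sup>2 * (d i * d j / E\<^sup>2))"
    by (intro sum.cong) (auto simp: reflection_def power2_eq_square algebra_simps)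
  also have "\<dots> = (if i = j then 1 else 0) - d i * d j / E - d j * d i / E + (2 * E) * (d i * d j / E\<^sup>2)"
    unfolding sum.distrib sum_subtractf sum_distrib_right[symmetric] d using ij by simp
  also have "\<dots> = (if i = j then 1 else 0)"
    using E by (simp add: power2_eq_square)
  finally show "(\<Sum>k=1..n. reflection d E k i * reflection d E k j) = (if i = j then 1 else 0)" .
qed

lemma mat_apply_reflection:
  assumes "i \<in> {1..n}"
  shows "mat_apply n (reflection d E) x i = x i - d i * ((\<Sum>j=1..n. d j * x j) / E)"
proof -
  have "mat_apply n (reflection d E) x i = (\<Sum>j=1..n. (if j = i then x j else 0) - d i * (d j * x j / E))"
    using assms by (auto simp: mat_apply_def reflection_def algebra_simps intro!: sum.cong)
  then show ?thesis
    using assms by (simp add: sum_subtractf sum_distrib_left[symmetric] sum_divide_distrib[symmetric])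
qed

text \<open>The sigma-algebra of \<mu> is forced by applying the invariance to the identity
  matrix.\<close>

lemma spherical_sets:
  assumes "spherical n \<mu>"
  shows "sets \<mu> = sets (Rn n)"
proof -
  have "orthogonal_mat n (\<lambda>i j. if i = j then 1 else 0)"
    unfolding orthogonal_mat_def
  proof (intro ballI)
    fix i j assume "i \<in> {1..n}" "j \<in> {1..n}"
    moreover have "(\<Sum>k=1..n. (if k = i then 1 else 0) * (if k = j then 1 else 0 :: real)) =
      (\<Sum>k=1..n. if k = i then (if i = j then 1 else 0) else 0)"
      by (intro sum.cong) auto
    ultimately show "(\<Sum>k=1..n. (if k = i then 1 else 0) * (if k = j then 1 else 0 :: real)) = (if i = j then 1 else 0)"
      by simp
  qed
  then have "distr \<mu> (Rn n) (mat_apply n (\<lambda>i j. if i = j then 1 else 0)) = \<mu>"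
    using assms by (simp add: spherical_def)
  then show ?thesis by (metis sets_distr)
qed

lemma spherical_emeasure:
  assumes \<mu>: "spherical n \<mu>" and A: "orthogonal_mat n A" and P: "{x \<in> space (Rn n). P x} \<in> sets (Rn n)"
  shows "emeasure \<mu> {x \<in> space (Rn n). P x} = emeasure \<mu> {x \<in> space (Rn n). P (mat_apply n A x)}"
proof -
  have sets[measurable_cong]: "sets \<mu> = sets (Rn n)" by (rule spherical_sets[OF \<mu>])
  have sp: "space \<mu> = space (Rn n)" by (rule sets_eq_imp_space_eq[OF sets])
  have "emeasure \<mu> {x \<in> space (Rn n). P x} = emeasure (distr \<mu> (Rn n) (mat_apply n A)) {x \<in> space (Rn n). P x}"
    using \<mu> A by (simp add: spherical_def)
  also have "\<dots> = emeasure \<mu> (mat_apply n A -` {x \<in> space (Rn n). P x} \<inter> space \<mu>)"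
    by (rule emeasure_distr[OF _ P]) measurable
  also have "mat_apply n A -` {x \<in> space (Rn n). P x} \<inter> space \<mu> = {x \<in> space (Rn n). P (mat_apply n A x)}"
    using measurable_space[OF mat_apply_measurable[of n A]] by (auto simp: sp)
  finally show ?thesis .
qed

text \<open>The reflection that exchanges the normalised centred directions of \<open>y\<close> and \<open>y'\<close> fixes the
  constant vectors, hence preserves the centred norm.\<close>

lemma spherical_pearson_direction:
  assumes n: "0 < n" and \<mu>: "spherical n \<mu>"
    and y: "centered_norm n y \<noteq> 0" "centered_norm n y' \<noteq> 0"
  shows "emeasure \<mu> {x \<in> space (Rn n). c \<le> pearson n x y} = emeasure \<mu> {x \<in> space (Rn n). c \<le> pearson n x y'}"
proof -
  define u w where "u i = (y i - sample_mean n y) / centered_norm n y"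
    and "w i = (y' i - sample_mean n y') / centered_norm n y'" for i
  have pu: "pearson n x y = (\<Sum>i=1..n. x i * u i) / centered_norm n x"
    and pw: "pearson n x y' = (\<Sum>i=1..n. x i * w i) / centered_norm n x" for x
    unfolding u_def w_def by (rule pearson_eq_inner[OF n y(1)], rule pearson_eq_inner[OF n y(2)])
  have unit: "(\<Sum>i=1..n. (u i)\<^sup>2) = 1" "(\<Sum>i=1..n. (w i)\<^sup>2) = 1"
    using y unfolding u_def w_def power_divide sum_divide_distrib[symmetric] centered_norm_square[symmetric] by simp_all
  have zero: "(\<Sum>i=1..n. u i) = 0" "(\<Sum>i=1..n. w i) = 0"
    using sum_eq_sample_mean[OF n, of y] sum_eq_sample_mean[OF n, of y']
    unfolding u_def w_def sum_divide_distrib[symmetric] by (simp_all add: sum_subtractf)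
  \<comment> \<open>For unit vectors this is half the squared length of u - w, the normalisation a
    reflection needs. It vanishes only for equal directions, where there is nothing to
    reflect.\<close>
  define E where "E = 1 - (\<Sum>i=1..n. u i * w i)"
  define d where "d i = u i - w i" for i
  have dd: "(\<Sum>i=1..n. (d i)\<^sup>2) = 2 * E"
  proof -
    have "(\<Sum>i=1..n. (d i)\<^sup>2) = (\<Sum>i=1..n. (u i)\<^sup>2) + (\<Sum>i=1..n. (w i)\<^sup>2) - 2 * (\<Sum>i=1..n. u i * w i)"
      by (simp add: d_def power2_diff sum.distrib sum_subtractf sum_distrib_left mult.assoc)
    then show ?thesis unfolding unit by (simp add: E_def)
  qed
  show ?thesis
  proof (cases "E = 0")
    case True
    then have "\<forall>i\<in>{1..n}. (d i)\<^sup>2 = 0" using dd by (simp add: sum_nonneg_eq_0_iff)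
    then have "\<And>i. i \<in> {1..n} \<Longrightarrow> u i = w i" by (simp add: d_def)
    then have "(\<Sum>i=1..n. x i * u i) = (\<Sum>i=1..n. x i * w i)" for x :: "nat \<Rightarrow> real" by (auto intro: sum.cong)
    then show ?thesis by (simp add: pu pw)
  next
    case False
    define H where "H = mat_apply n (reflection d E)"
    have H: "H x i = x i - d i * ((\<Sum>j=1..n. d j * x j) / E)" if "i \<in> {1..n}" for x i
      unfolding H_def by (rule mat_apply_reflection[OF that])
    \<comment> \<open>H is symmetric and maps w to u, because the inner product of d with w is
      -E.\<close>
    have inner: "(\<Sum>i=1..n. H x i * w i) = (\<Sum>i=1..n. x i * u i)" for x
    proof -
      define t where "t = (\<Sum>j=1..n. d j * x j)"
      have "(\<Sum>i=1..n. H x i * w i) = (\<Sum>i=1..n. x i * w i - (d i * w i) * (t / E))"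
        by (intro sum.cong) (simp_all add: H t_def algebra_simps)
      also have "\<dots> = (\<Sum>i=1..n. x i * w i) - (\<Sum>i=1..n. d i * w i) * (t / E)"
        by (simp only: sum_subtractf sum_distrib_right)
      also have "(\<Sum>i=1..n. d i * w i) = - E"
        using unit(2) by (simp add: d_def E_def left_diff_distrib sum_subtractf power2_eq_square)
      also have "(\<Sum>i=1..n. x i * w i) - (- E) * (t / E) = (\<Sum>i=1..n. x i * w i) + t" using False by simp
      also have "\<dots> = (\<Sum>i=1..n. x i * u i)"
        by (simp add: t_def d_def sum.distrib[symmetric] algebra_simps)
      finally show ?thesis .
    qed
    have sum_H: "(\<Sum>i=1..n. H x i) = (\<Sum>i=1..n. x i)" for x
    proof -
      have "(\<Sum>i=1..n. H x i) = (\<Sum>i=1..n. x i - d i * ((\<Sum>j=1..n. d j * x j) / E))"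
        by (intro sum.cong) (simp_all add: H)
      also have "\<dots> = (\<Sum>i=1..n. x i) - (\<Sum>i=1..n. d i) * ((\<Sum>j=1..n. d j * x j) / E)"
        by (simp only: sum_subtractf sum_distrib_right)
      also have "(\<Sum>i=1..n. d i) = 0" using zero by (simp add: d_def sum_subtractf)
      finally show ?thesis by simp
    qed
    have squares: "(\<Sum>i=1..n. (H x i)\<^sup>2) = (\<Sum>i=1..n. (x i)\<^sup>2)" for x
    proof -
      define t where "t = (\<Sum>j=1..n. d j * x j)"
      have "(\<Sum>i=1..n. (H x i)\<^sup>2) = (\<Sum>i=1..n. (x i)\<^sup>2 - (d i * x i) * (2 * t / E) + (d i)\<^sup>2 * (t / E)\<^sup>2)"
        by (intro sum.cong) (simp_all add: H t_def power2_eq_square algebra_simps)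
      also have "\<dots> = (\<Sum>i=1..n. (x i)\<^sup>2) - t * (2 * t / E) + (2 * E) * (t / E)\<^sup>2"
        unfolding sum.distrib sum_subtractf sum_distrib_right[symmetric] dd t_def ..
      also have "\<dots> = (\<Sum>i=1..n. (x i)\<^sup>2)" using False by (simp add: power2_eq_square)
      finally show ?thesis .
    qed
    have norm_H: "centered_norm n (H x) = centered_norm n x" for x
    proof -
      have "sample_mean n (H x) = sample_mean n x" using sum_H[of x] by (simp add: sample_mean_def)
      then show ?thesis unfolding centered_norm_def centered_sum_squares[OF n] squares by simp
    qed
    have "emeasure \<mu> {x \<in> space (Rn n). c \<le> pearson n x y'} = emeasure \<mu> {x \<in> space (Rn n). c \<le> pearson n (H x) y'}"
      unfolding H_def by (rule spherical_emeasure[OF \<mu> reflection_orthogonal[OF dd False]]) measurable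
    also have "\<dots> = emeasure \<mu> {x \<in> space (Rn n). c \<le> pearson n x y}"
      unfolding pu pw inner norm_H ..
    finally show ?thesis ..
  qed
qed

text \<open>The line of constant vectors has infinitely many images under reflections that meet only at
  the origin and have the same mass.\<close>

lemma spherical_constant_null:
  assumes n: "2 < n" and \<mu>: "spherical n \<mu>" and prob: "prob_space \<mu>"
    and zero: "measure \<mu> {x \<in> space (Rn n). \<forall>i\<in>{1..n}. x i = 0} = 0"
  shows "measure \<mu> {x \<in> space (Rn n). centered_norm n x = 0} = 0"
proof -
  interpret prob_space \<mu> by (rule prob)
  have sets[measurable_cong]: "sets \<mu> = sets (Rn n)" by (rule spherical_sets[OF \<mu>])
  have n0: "0 < n" using n by simp
  define Z where "Z = {x \<in> space (Rn n). \<forall>i\<in>{1..n}. x i = 0}"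
  \<comment> \<open>Only the first two coordinates are reflected. The third, available since n > 2,
    then reveals the constant value k of the image.\<close>
  define d where "d m i = (if i = 1 then 1 else if i = 2 then 1 + real m else 0)" for m i :: nat
  define E where "E m = (1 + (1 + real m)\<^sup>2) / 2" for m
  define H where "H m = mat_apply n (reflection (d m) (E m))" for m
  have E0: "0 < E m" for m by (simp add: E_def add_pos_nonneg)
  have split: "(\<Sum>i=1..n. d m i * f i) = f 1 + (1 + real m) * f 2" for m and f :: "nat \<Rightarrow> real"
  proof -
    have "(\<Sum>i=1..n. d m i * f i) = (\<Sum>i\<in>{1, 2}. d m i * f i)"
      using n by (intro sum.mono_neutral_right) (auto simp: d_def)
    then show ?thesis by (simp add: d_def)
  qed
  have dd: "(\<Sum>i=1..n. (d m i)\<^sup>2) = 2 * E m" for m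
    using split[of m "d m"] by (simp add: power2_eq_square d_def E_def)
  define A where "A m = {x \<in> space (Rn n). centered_norm n (H m x) = 0}" for m
  have H_m[measurable]: "H m \<in> Rn n \<rightarrow>\<^sub>M Rn n" for m unfolding H_def by measurable
  have A_sets[measurable]: "A m \<in> sets (Rn n)" for m
  proof -
    have "(\<lambda>x. H m x i) \<in> borel_measurable (Rn n)" if "i \<in> {1..n}" for i
      using measurable_compose[OF H_m measurable_component_singleton[OF that]] .
    then have [measurable]: "(\<lambda>x. centered_norm n (H m x)) \<in> borel_measurable (Rn n)" by measurable
    show ?thesis unfolding A_def by measurable
  qed
  have Z_sets[measurable]: "Z \<in> sets (Rn n)" unfolding Z_def by measurable
  have A_meas: "measure \<mu> (A m) = measure \<mu> {x \<in> space (Rn n). centered_norm n x = 0}" for m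
  proof -
    have "{x \<in> space (Rn n). centered_norm n x = 0} \<in> sets (Rn n)" by measurable
    from spherical_emeasure[OF \<mu> reflection_orthogonal[OF dd, of m] this] E0[of m]
    show ?thesis by (simp add: measure_def A_def H_def)
  qed
  \<comment> \<open>Elimination of k and S. With M = 1 + m the points of \<open>A m\<close> satisfy
    x 1 + x 2 = - 4 M / (1 + M^2) x 3, a ratio that depends on m.\<close>
  have A_eq: "(x 1 + x 2) * (1 + (1 + real m)\<^sup>2) = - 4 * (1 + real m) * x 3 \<and>
      (x 3 = 0 \<longrightarrow> x \<in> Z)" if x: "x \<in> A m" for x m
  proof -
    define S where "S = (x 1 + (1 + real m) * x 2) / E m"
    obtain k where k: "\<And>i. i \<in> {1..n} \<Longrightarrow> H m x i = k"
      using x n0 by (auto simp: A_def centered_norm_eq_0_iff)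
    have Hx: "x i - d m i * S = k" if "i \<in> {1..n}" for i
      using k[OF that] unfolding H_def mat_apply_reflection[OF that] split S_def .
    have x1: "x 1 = k + S" using Hx[of 1] n by (simp add: d_def)
    have x2: "x 2 = k + (1 + real m) * S" using Hx[of 2] n by (simp add: d_def)
    have x3: "x 3 = k" using Hx[of 3] n by (simp add: d_def)
    have "S * E m = x 1 + (1 + real m) * x 2" using E0[of m] by (simp add: S_def)
    then have SE: "S * (1 + (1 + real m)\<^sup>2) = - 2 * k * (2 + real m)"
      unfolding x1 x2 E_def by (simp add: power2_eq_square algebra_simps)
    have "(x 1 + x 2) * (1 + (1 + real m)\<^sup>2) = 2 * k * (1 + (1 + real m)\<^sup>2) + (2 + real m) * (S * (1 + (1 + real m)\<^sup>2))"
      unfolding x1 x2 by (simp add: algebra_simps)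
    also have "\<dots> = - 4 * (1 + real m) * k"
      unfolding SE by (simp add: power2_eq_square algebra_simps)
    finally have 1: "(x 1 + x 2) * (1 + (1 + real m)\<^sup>2) = - 4 * (1 + real m) * x 3" unfolding x3 .
    have "x \<in> Z" if "x 3 = 0"
    proof -
      have "0 < 1 + (1 + real m)\<^sup>2" by (simp add: add_pos_nonneg)
      then have "S = 0" using SE that x3 by simp
      then have "\<forall>i\<in>{1..n}. x i = 0" using Hx that x3 by simp
      then show ?thesis using x by (simp add: Z_def A_def)
    qed
    then show ?thesis using 1 by blast
  qed
  have disj: "disjoint_family (\<lambda>m. A m - Z)"
    unfolding disjoint_family_on_def
  proof (intro ballI impI)
    fix m l :: nat assume ml: "m \<noteq> l"
    \<comment> \<open>M / (1 + M^2) is injective on M \<ge> 1, since equal values at distinct points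
      would need M L = 1. This is why \<open>d\<close> uses 1 + m.\<close>
    have False if x: "x \<in> A m" "x \<in> A l" "x \<notin> Z" for x
    proof -
      define M L where "M = 1 + real m" and "L = 1 + real l"
      have ge1: "1 \<le> M" "1 \<le> L" "M \<noteq> L" using ml by (auto simp: M_def L_def)
      have eqs: "(x 1 + x 2) * (1 + M\<^sup>2) = - 4 * M * x 3" "(x 1 + x 2) * (1 + L\<^sup>2) = - 4 * L * x 3"
        using A_eq[OF x(1)] A_eq[OF x(2)] by (auto simp: M_def L_def)
      have "(4 * M * x 3) * (1 + L\<^sup>2) = (4 * L * x 3) * (1 + M\<^sup>2)"
      proof -
        have "(4 * M * x 3) * (1 + L\<^sup>2) = - ((x 1 + x 2) * (1 + M\<^sup>2)) * (1 + L\<^sup>2)" unfolding eqs by simp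
        also have "\<dots> = - ((x 1 + x 2) * (1 + L\<^sup>2)) * (1 + M\<^sup>2)" by algebra
        also have "\<dots> = (4 * L * x 3) * (1 + M\<^sup>2)" unfolding eqs by simp
        finally show ?thesis .
      qed
      then have "x 3 * ((M - L) * (1 - M * L)) = 0" by (simp add: power2_eq_square algebra_simps)
      moreover have "1 - M * L \<noteq> 0"
      proof
        assume "1 - M * L = 0"
        then have "M * L = 1" by simp
        moreover have "M \<le> M * L" "L \<le> M * L" using ge1 by (auto simp: mult_le_cancel_left1 mult_le_cancel_right1)
        ultimately show False using ge1 by linarith
      qed
      ultimately have "x 3 = 0" using ge1 by simp
      then show False using A_eq[OF x(1)] x(3) by blast
    qed
    then show "(A m - Z) \<inter> (A l - Z) = {}" by blast
  qed
  have "(\<lambda>m. measure \<mu> (A m - Z)) sums measure \<mu> (\<Union>m. A m - Z)"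
    by (rule finite_measure_UNION[OF _ disj], rule image_subsetI, unfold sets, rule sets.Diff[OF A_sets Z_sets])
  moreover have "measure \<mu> (A m - Z) = measure \<mu> {x \<in> space (Rn n). centered_norm n x = 0}" for m
  proof -
    have "measure \<mu> (A m - Z) = measure \<mu> (A m) - measure \<mu> (A m \<inter> Z)"
      by (rule finite_measure_Diff') (simp_all only: sets A_sets Z_sets)
    moreover have "measure \<mu> (A m \<inter> Z) \<le> measure \<mu> Z"
      by (rule finite_measure_mono[OF Int_lower2]) (simp only: sets Z_sets)
    ultimately show ?thesis using zero A_meas[of m] measure_nonneg[of \<mu> "A m \<inter> Z"] unfolding Z_def by linarith
  qed
  \<comment> \<open>Disjoint sets of equal mass in a finite measure: the constant series converges,
    so its term is 0.\<close>
  ultimately have "summable (\<lambda>m::nat. measure \<mu> {x \<in> space (Rn n). centered_norm n x = 0})"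
    by (simp add: sums_iff)
  then show ?thesis by (simp add: summable_const_iff)
qed

section \<open>Tail probabilities\<close>

lemma iid_sample_pearson:
  fixes T :: "real \<times> real \<Rightarrow> real \<times> real"
  assumes T: "T \<in> (borel \<Otimes>\<^sub>M borel) \<rightarrow>\<^sub>M borel" and N: "N = distr std_normal2 borel T"
    and sample: "iid_sample N n M X Y" and n: "0 < n"
  shows "measure M {\<omega> \<in> space M. c \<le> pearson n (X \<omega>) (Y \<omega>)} =
    enn2real (\<integral>\<^sup>+u. \<integral>\<^sup>+v. indicator {r. c \<le> r}
      (pearson n (\<lambda>i. fst (T (u i, v i))) (\<lambda>i. snd (T (u i, v i)))) \<partial>gauss_n n \<partial>gauss_n n)"
proof -
  interpret prob_space M using sample by (simp add: iid_sample_def)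
  define Z where "Z i \<omega> = (X \<omega> i, Y \<omega> i)" for i \<omega>
  have indep: "indep_vars (\<lambda>_. borel) Z {1..n}" and law: "\<And>i. i \<in> {1..n} \<Longrightarrow> distr M borel (Z i) = N"
    using sample unfolding iid_sample_def Z_def[abs_def] by auto
  have rv: "\<And>i. i \<in> {1..n} \<Longrightarrow> random_variable borel (Z i)" using indep by (simp add: indep_vars_def)
  have ne: "{1..n} \<noteq> {}" using n by simp
  have "distr M (Pi\<^sub>M {1..n} (\<lambda>_. borel)) (\<lambda>\<omega>. \<lambda>i\<in>{1..n}. Z i \<omega>) = Pi\<^sub>M {1..n} (\<lambda>i. distr M borel (Z i))"
    using indep_vars_iff_distr_eq_PiM'[OF ne rv] indep by simp
  also have "\<dots> = Pi\<^sub>M {1..n} (\<lambda>_. N)" by (rule PiM_cong) (auto simp: law)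
  finally have joint: "distr M (Pi\<^sub>M {1..n} (\<lambda>_. borel)) (\<lambda>\<omega>. \<lambda>i\<in>{1..n}. Z i \<omega>) = Pi\<^sub>M {1..n} (\<lambda>_. N)" .
  have Z_m[measurable]: "(\<lambda>\<omega>. \<lambda>i\<in>{1..n}. Z i \<omega>) \<in> M \<rightarrow>\<^sub>M Pi\<^sub>M {1..n} (\<lambda>_. borel)"
    by (rule measurable_restrict) (rule rv)
  have fs[measurable]: "(fst :: real \<times> real \<Rightarrow> real) \<in> borel_measurable borel" "(snd :: real \<times> real \<Rightarrow> real) \<in> borel_measurable borel"
    unfolding borel_prod[symmetric] by measurable
  define f where "f z = (indicator {r. c \<le> r} (pearson n (\<lambda>i. fst (z i)) (\<lambda>i. snd (z i))) :: ennreal)"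
    for z :: "nat \<Rightarrow> real \<times> real"
  have p[measurable]: "(\<lambda>z. pearson n (\<lambda>i. fst (z i)) (\<lambda>i. snd (z i))) \<in> borel_measurable (Pi\<^sub>M {1..n} (\<lambda>_. borel))"
    by measurable
  have f[measurable]: "f \<in> borel_measurable (Pi\<^sub>M {1..n} (\<lambda>_. borel))" unfolding f_def[abs_def] by measurable
  have f_Z: "f (\<lambda>i\<in>{1..n}. Z i \<omega>) = indicator {\<omega> \<in> space M. c \<le> pearson n (X \<omega>) (Y \<omega>)} \<omega>" if "\<omega> \<in> space M" for \<omega>
  proof -
    have "pearson n (\<lambda>i. fst ((\<lambda>i\<in>{1..n}. Z i \<omega>) i)) (\<lambda>i. snd ((\<lambda>i\<in>{1..n}. Z i \<omega>) i)) = pearson n (X \<omega>) (Y \<omega>)"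
      by (rule pearson_cong) (simp_all add: Z_def)
    then show ?thesis using that by (simp add: f_def indicator_def)
  qed
  have XY[measurable]: "\<And>i. i \<in> {1..n} \<Longrightarrow> (\<lambda>\<omega>. X \<omega> i) \<in> borel_measurable M" "\<And>i. i \<in> {1..n} \<Longrightarrow> (\<lambda>\<omega>. Y \<omega> i) \<in> borel_measurable M"
    using measurable_compose[OF rv fs(1)] measurable_compose[OF rv fs(2)] by (simp_all add: Z_def)
  have [measurable]: "{\<omega> \<in> space M. c \<le> pearson n (X \<omega>) (Y \<omega>)} \<in> sets M" by measurable
  have "emeasure M {\<omega> \<in> space M. c \<le> pearson n (X \<omega>) (Y \<omega>)} =
    (\<integral>\<^sup>+\<omega>. indicator {\<omega> \<in> space M. c \<le> pearson n (X \<omega>) (Y \<omega>)} \<omega> \<partial>M)"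
    by (rule nn_integral_indicator[symmetric]) measurable
  also have "\<dots> = (\<integral>\<^sup>+\<omega>. f (\<lambda>i\<in>{1..n}. Z i \<omega>) \<partial>M)"
    by (rule nn_integral_cong) (simp only: f_Z)
  also have "\<dots> = (\<integral>\<^sup>+z. f z \<partial>Pi\<^sub>M {1..n} (\<lambda>_. N))"
    unfolding joint[symmetric] by (rule nn_integral_distr[symmetric]) measurable
  also have "\<dots> = (\<integral>\<^sup>+u. \<integral>\<^sup>+v. f (\<lambda>i\<in>{1..n}. T (u i, v i)) \<partial>gauss_n n \<partial>gauss_n n)"
    by (rule nn_integral_PiM_pair_image[OF T N f])
  also have "\<dots> = (\<integral>\<^sup>+u. \<integral>\<^sup>+v. indicator {r. c \<le> r}
      (pearson n (\<lambda>i. fst (T (u i, v i))) (\<lambda>i. snd (T (u i, v i)))) \<partial>gauss_n n \<partial>gauss_n n)"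
  proof -
    have "pearson n (\<lambda>i. fst ((\<lambda>i\<in>{1..n}. T (u i, v i)) i)) (\<lambda>i. snd ((\<lambda>i\<in>{1..n}. T (u i, v i)) i)) =
      pearson n (\<lambda>i. fst (T (u i, v i))) (\<lambda>i. snd (T (u i, v i)))" for u v :: "nat \<Rightarrow> real"
      by (rule pearson_cong) simp_all
    then show ?thesis by (simp add: f_def)
  qed
  finally show ?thesis by (simp add: measure_def)
qed

context corr_level
begin

lemma gaussian_tail_prob:
  assumes N: "gaussian_law \<rho> N" and sample: "iid_sample N n M X Y" and n: "2 < n"
  shows "measure M {\<omega> \<in> space M. c \<le> pearson n (X \<omega>) (Y \<omega>)} = tail_prob n"
proof -
  have \<rho>: "- 1 < \<rho>" "\<rho> < 1" using rho_c by auto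
  obtain m1 m2 s1 s2 where s: "0 < s1" "0 < s2"
    and N_eq: "N = distr std_normal2 borel (\<lambda>x. (m1 + s1 * (sqrt ((1 + \<rho>) / 2) * fst x + sqrt ((1 - \<rho>) / 2) * snd x),
      m2 + s2 * (sqrt ((1 + \<rho>) / 2) * fst x - sqrt ((1 - \<rho>) / 2) * snd x)))"
    by (rule gaussian_law_representation[OF N \<rho>]) blast
  show ?thesis
    using iid_sample_pearson[OF _ N_eq sample, of c] gauss_pearson_tail[OF n s, of m1 m2] n
    by (simp add: p_rho_def q_rho_def)
qed

end

text \<open>For \<rho> = 0 both weights are 1 / sqrt 2, so the sum and difference map is orthogonal
  and the pairs (u i, v i) already have the law of the pairs in
  \<open>gauss_pearson_tail\<close>.\<close>

lemma gauss_pearson_tail_uncorrelated: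
  assumes c: "0 < c" "c < 1" and n: "2 < n"
  shows "enn2real (\<integral>\<^sup>+u. \<integral>\<^sup>+v. indicator {r. c \<le> r} (pearson n u v) \<partial>gauss_n n \<partial>gauss_n n) =
    corr_level.tail_prob 0 c n"
proof -
  interpret corr_level 0 c by standard (use c in auto)
  define S T where "S x = x" and "T x = (0 + 1 * (p_rho * fst x + q_rho * snd x), 0 + 1 * (p_rho * fst x - q_rho * snd x))"
    for x :: "real \<times> real"
  have S: "S \<in> (borel \<Otimes>\<^sub>M borel) \<rightarrow>\<^sub>M borel" unfolding S_def[abs_def] borel_prod by measurable
  have T: "T \<in> (borel \<Otimes>\<^sub>M borel) \<rightarrow>\<^sub>M borel" unfolding T_def[abs_def] by measurable
  have pq: "p_rho\<^sup>2 = 1 / 2" "q_rho\<^sup>2 = 1 / 2" "p_rho = q_rho" by (simp_all add: p_rho_def q_rho_def power_divide)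
  have law: "distr std_normal2 borel S = distr std_normal2 borel T"
    using distr_std_normal2_orthogonal[OF S, of p_rho q_rho p_rho "- q_rho"] pq
    by (simp add: S_def T_def[abs_def] power2_eq_square)
  have fs[measurable]: "(fst :: real \<times> real \<Rightarrow> real) \<in> borel_measurable borel" "(snd :: real \<times> real \<Rightarrow> real) \<in> borel_measurable borel"
    unfolding borel_prod[symmetric] by measurable
  define f where "f z = (indicator {r. c \<le> r} (pearson n (\<lambda>i. fst (z i)) (\<lambda>i. snd (z i))) :: ennreal)"
    for z :: "nat \<Rightarrow> real \<times> real"
  have p[measurable]: "(\<lambda>z. pearson n (\<lambda>i. fst (z i)) (\<lambda>i. snd (z i))) \<in> borel_measurable (Pi\<^sub>M {1..n} (\<lambda>_. borel))"
    by measurable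
  have f[measurable]: "f \<in> borel_measurable (Pi\<^sub>M {1..n} (\<lambda>_. borel))" unfolding f_def[abs_def] by measurable
  have f_R: "f (\<lambda>i\<in>{1..n}. R (u i, v i)) = indicator {r. c \<le> r} (pearson n (\<lambda>i. fst (R (u i, v i))) (\<lambda>i. snd (R (u i, v i))))"
    for R and u v :: "nat \<Rightarrow> real"
  proof -
    have "pearson n (\<lambda>i. fst ((\<lambda>i\<in>{1..n}. R (u i, v i)) i)) (\<lambda>i. snd ((\<lambda>i\<in>{1..n}. R (u i, v i)) i)) =
      pearson n (\<lambda>i. fst (R (u i, v i))) (\<lambda>i. snd (R (u i, v i)))"
      by (rule pearson_cong) simp_all
    then show ?thesis by (simp add: f_def)
  qed
  have "(\<integral>\<^sup>+u. \<integral>\<^sup>+v. f (\<lambda>i\<in>{1..n}. S (u i, v i)) \<partial>gauss_n n \<partial>gauss_n n) =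
    (\<integral>\<^sup>+u. \<integral>\<^sup>+v. f (\<lambda>i\<in>{1..n}. T (u i, v i)) \<partial>gauss_n n \<partial>gauss_n n)"
    using nn_integral_PiM_pair_image[OF S refl f] nn_integral_PiM_pair_image[OF T refl f] law by simp
  then show ?thesis
    using gauss_pearson_tail[OF n zero_less_one zero_less_one, of 0 0]
    unfolding f_R by (simp add: S_def T_def)
qed

section \<open>Replacing the spherical vector by a normal one\<close>

lemma sets_gauss_n: "sets (gauss_n n) = sets (Rn n)"
  by (rule sets_PiM_cong) auto

text \<open>The squared centred norm has a law with a density on the positive half-line, hence no
  atom at 0.\<close>

lemma gauss_n_constant_null:
  assumes n: "2 \<le> n"
  shows "AE V in gauss_n n. centered_norm n V \<noteq> 0"
proof -
  obtain k where k: "n = k + 2" using n by (metis add.commute le_Suc_ex)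
  obtain C where C: "\<And>G. G \<in> borel_measurable borel \<Longrightarrow> (\<integral>\<^sup>+\<sigma>. G \<sigma> \<partial>chi_sq (Suc k)) =
    C * (\<integral>\<^sup>+s. ennreal (indicator {0<..} s * (s ^ (Suc k - 1) * exp (- s\<^sup>2 / 2))) * G (s\<^sup>2) \<partial>lborel)"
    using nn_integral_chi_sq[of "Suc k"] by auto
  have "(\<integral>\<^sup>+V. indicator {0} ((centered_norm n V)\<^sup>2) \<partial>gauss_n n) = (\<integral>\<^sup>+\<sigma>. indicator {0} \<sigma> \<partial>chi_sq (Suc k))"
    unfolding k by (rule gauss_n_centered_norm) measurable
  also have "\<dots> = C * (\<integral>\<^sup>+s. ennreal (indicator {0<..} s * (s ^ (Suc k - 1) * exp (- s\<^sup>2 / 2))) * indicator {0} (s\<^sup>2) \<partial>lborel)"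
    by (rule C) measurable
  also have "\<dots> = 0"
  proof -
    have "(\<integral>\<^sup>+s. ennreal (indicator {0<..} s * (s ^ (Suc k - 1) * exp (- s\<^sup>2 / 2))) * indicator {0} (s\<^sup>2) \<partial>lborel) =
      (\<integral>\<^sup>+s. 0 \<partial>(lborel :: real measure))"
      by (intro nn_integral_cong) (auto simp: indicator_def)
    then show ?thesis by simp
  qed
  finally have "AE V in gauss_n n. (indicator {0} ((centered_norm n V)\<^sup>2) :: ennreal) = 0"
    by (subst (asm) nn_integral_0_iff_AE) auto
  then show ?thesis by eventually_elim (auto simp: indicator_def split: if_splits)
qed

text \<open>The centred norm of x cancels, so the right side does not depend on x: against a normal
  vector the coefficient has the same law for every nonconstant x.\<close>

lemma gauss_n_pearson_direction:
  assumes n: "2 \<le> n" and x: "centered_norm n x \<noteq> 0"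
  shows "(\<integral>\<^sup>+V. indicator {r. c \<le> r} (pearson n x V) \<partial>gauss_n n) =
    (\<integral>\<^sup>+t. \<integral>\<^sup>+z. indicator {r. c \<le> r} (z / sqrt (z\<^sup>2 + t)) \<partial>std_normal \<partial>chi_sq (n - 2))"
proof -
  obtain k where k: "n = k + 2" using n by (metis add.commute le_Suc_ex)
  define f where "f y = (indicator {r. c \<le> r} (fst y / (centered_norm n x * sqrt (snd y))) :: ennreal)" for y :: "real \<times> real"
  have f: "f \<in> borel_measurable (borel \<Otimes>\<^sub>M borel)" unfolding f_def[abs_def] by measurable
  have 1: "indicator {r. c \<le> r} (pearson n x V) = f (\<Sum>i=1..n. (x i - sample_mean n x) * (V i - sample_mean n V),
      \<Sum>i=1..n. (V i - sample_mean n V)\<^sup>2)" for V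
    by (simp add: f_def pearson_def centered_norm_def real_sqrt_mult)
  have 2: "f (centered_norm n x * z, z\<^sup>2 + t) = indicator {r. c \<le> r} (z / sqrt (z\<^sup>2 + t))" for z t
    using x by (simp add: f_def)
  show ?thesis
    unfolding 1 2[symmetric] unfolding k by (simp only: gauss_n_centered_statistics[OF f] add_diff_cancel_right')
qed

text \<open>An auxiliary normal vector V is paired with x of law \<mu>. Integrating over x first
  gives \<pi>, the tail probability for any fixed nonconstant second argument; integrating over V
  first gives \<kappa>, that for any fixed nonconstant first argument. Tonelli yields \<pi> =
  \<kappa>, and \<kappa> is also the purely Gaussian value.\<close>

lemma spherical_tail_prob:
  assumes c: "0 < c" "c < 1" and n: "2 < n" and model: "spherical_model n M X Y"
  shows "measure M {\<omega> \<in> space M. c \<le> pearson n (X \<omega>) (Y \<omega>)} = corr_level.tail_prob 0 c n"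
proof -
  interpret prob_space M using model by (simp add: spherical_model_def)
  define \<mu> \<nu> where "\<mu> = distr M (Rn n) X" and "\<nu> = distr M (Rn n) Y"
  have indep: "indep_var (Rn n) X (Rn n) Y" and \<mu>: "spherical n \<mu>"
    and X0: "measure M {\<omega> \<in> space M. \<forall>i\<in>{1..n}. X \<omega> i = 0} = 0"
    and Yk: "measure M {\<omega> \<in> space M. \<exists>k. \<forall>i\<in>{1..n}. Y \<omega> i = k} = 0"
    using model by (auto simp: spherical_model_def \<mu>_def)
  have X[measurable]: "X \<in> M \<rightarrow>\<^sub>M Rn n" and Y[measurable]: "Y \<in> M \<rightarrow>\<^sub>M Rn n"
    using indep indep_var_rv1 indep_var_rv2 by auto
  have n0: "0 < n" using n by simp
  interpret \<mu>: prob_space \<mu> unfolding \<mu>_def by (rule prob_space_distr) measurable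
  interpret \<nu>: prob_space \<nu> unfolding \<nu>_def by (rule prob_space_distr) measurable
  interpret g: prob_space "gauss_n n" by (rule prob_space_gauss_n)
  interpret \<mu>\<nu>: pair_sigma_finite \<mu> \<nu> ..
  interpret g\<mu>: pair_sigma_finite "gauss_n n" \<mu> ..
  have s[measurable_cong]: "sets \<mu> = sets (Rn n)" "sets \<nu> = sets (Rn n)" by (simp_all add: \<mu>_def \<nu>_def)
  note sets_gauss_n[measurable_cong]
  have sp: "space \<mu> = space (Rn n)" by (simp add: \<mu>_def)
  have p[measurable]: "(\<lambda>z. pearson n (fst z) (snd z)) \<in> borel_measurable (Rn n \<Otimes>\<^sub>M Rn n)"
    by measurable
  define I where "I x y = (indicator {r. c \<le> r} (pearson n x y) :: ennreal)" for x y
  have I_m[measurable]: "(\<lambda>z. I (fst z) (snd z)) \<in> borel_measurable (Rn n \<Otimes>\<^sub>M Rn n)"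
    unfolding I_def by measurable
  have I'[measurable]: "(\<lambda>\<omega>. I (f \<omega>) (g \<omega>)) \<in> borel_measurable L" if "f \<in> L \<rightarrow>\<^sub>M Rn n" "g \<in> L \<rightarrow>\<^sub>M Rn n" for f g and L :: "'x measure"
    using measurable_compose[OF measurable_Pair[OF that] I_m] by simp
  have "measure \<mu> {x \<in> space (Rn n). \<forall>i\<in>{1..n}. x i = 0} = 0"
  proof -
    have "measure \<mu> {x \<in> space (Rn n). \<forall>i\<in>{1..n}. x i = 0} = measure M (X -` {x \<in> space (Rn n). \<forall>i\<in>{1..n}. x i = 0} \<inter> space M)"
      unfolding \<mu>_def by (rule measure_distr) measurable
    also have "X -` {x \<in> space (Rn n). \<forall>i\<in>{1..n}. x i = 0} \<inter> space M = {\<omega> \<in> space M. \<forall>i\<in>{1..n}. X \<omega> i = 0}"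
      using measurable_space[OF X] by auto
    finally show ?thesis using X0 by simp
  qed
  then have "measure \<mu> {x \<in> space (Rn n). centered_norm n x = 0} = 0"
    using spherical_constant_null[OF n \<mu> \<mu>.prob_space_axioms] by simp
  then have \<mu>_ne: "AE x in \<mu>. centered_norm n x \<noteq> 0"
  proof (intro AE_I[of _ _ "{x \<in> space (Rn n). centered_norm n x = 0}"])
    show "{x \<in> space (Rn n). centered_norm n x = 0} \<in> sets \<mu>" unfolding s by measurable
  qed (auto simp: sp \<mu>.emeasure_eq_measure)
  have "AE \<omega> in M. centered_norm n (Y \<omega>) \<noteq> 0"
  proof (rule AE_I[of _ _ "{\<omega> \<in> space M. centered_norm n (Y \<omega>) = 0}"])
    show "emeasure M {\<omega> \<in> space M. centered_norm n (Y \<omega>) = 0} = 0"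
      using Yk unfolding centered_norm_eq_0_iff[OF n0] by (simp add: emeasure_eq_measure)
    have [measurable]: "(\<lambda>\<omega>. Y \<omega> i) \<in> borel_measurable M" if "i \<in> {1..n}" for i
      using measurable_compose[OF Y measurable_component_singleton[OF that]] .
    show "{\<omega> \<in> space M. centered_norm n (Y \<omega>) = 0} \<in> sets M" by measurable
  qed auto
  moreover have "{y \<in> space (Rn n). centered_norm n y \<noteq> 0} \<in> sets (Rn n)" by measurable
  ultimately have \<nu>_ne: "AE y in \<nu>. centered_norm n y \<noteq> 0"
    unfolding \<nu>_def by (simp only: AE_distr_iff[OF Y])
  have g_ne: "AE V in gauss_n n. centered_norm n V \<noteq> 0" using gauss_n_constant_null n by simp
  \<comment> \<open>A reference direction, so that \<pi> can be defined without choosing among the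
    values of Y.\<close>
  obtain y0 :: "nat \<Rightarrow> real" where y0: "centered_norm n y0 \<noteq> 0"
  proof
    show "centered_norm n (\<lambda>i. if i = 1 then 1 else 0) \<noteq> 0"
    proof
      assume "centered_norm n (\<lambda>i. if i = 1 then 1 else 0) = 0"
      then obtain k :: real where "\<forall>i\<in>{1..n}. (if i = 1 then 1 else 0) = k"
        unfolding centered_norm_eq_0_iff[OF n0] by blast
      from bspec[OF this, of 1] bspec[OF this, of 2] n show False by simp
    qed
  qed
  define \<kappa> where "\<kappa> = (\<integral>\<^sup>+t. \<integral>\<^sup>+z. indicator {r. c \<le> r} (z / sqrt (z\<^sup>2 + t)) \<partial>std_normal \<partial>chi_sq (n - 2) :: ennreal)"
  have \<kappa>: "(\<integral>\<^sup>+V. I x V \<partial>gauss_n n) = \<kappa>" if "centered_norm n x \<noteq> 0" for x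
    using gauss_n_pearson_direction[OF _ that, of c] n by (simp add: I_def \<kappa>_def)
  define \<pi> where "\<pi> = (\<integral>\<^sup>+x. I x y0 \<partial>\<mu>)"
  have \<pi>: "(\<integral>\<^sup>+x. I x y \<partial>\<mu>) = \<pi>" if "centered_norm n y \<noteq> 0" for y
  proof -
    have e: "(\<integral>\<^sup>+x. I x y \<partial>\<mu>) = emeasure \<mu> {x \<in> space (Rn n). c \<le> pearson n x y}" for y
    proof -
      have "(\<integral>\<^sup>+x. I x y \<partial>\<mu>) = (\<integral>\<^sup>+x. indicator {x \<in> space (Rn n). c \<le> pearson n x y} x \<partial>\<mu>)"
        by (intro nn_integral_cong) (auto simp: I_def indicator_def sp)
      also have "\<dots> = emeasure \<mu> {x \<in> space (Rn n). c \<le> pearson n x y}"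
        by (rule nn_integral_indicator) measurable
      finally show ?thesis .
    qed
    show ?thesis unfolding \<pi>_def e by (rule spherical_pearson_direction[OF n0 \<mu> that y0])
  qed
  have "\<pi> = (\<integral>\<^sup>+V. \<integral>\<^sup>+x. I x V \<partial>\<mu> \<partial>gauss_n n)"
  proof -
    have "(\<integral>\<^sup>+V. \<integral>\<^sup>+x. I x V \<partial>\<mu> \<partial>gauss_n n) = (\<integral>\<^sup>+V. \<pi> \<partial>gauss_n n)"
      by (rule nn_integral_cong_AE) (use g_ne \<pi> in \<open>auto elim: eventually_mono\<close>)
    then show ?thesis by (simp only: nn_integral_const g.emeasure_space_1 mult_1_right)
  qed
  also have "\<dots> = (\<integral>\<^sup>+x. \<integral>\<^sup>+V. I x V \<partial>gauss_n n \<partial>\<mu>)"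
    by (rule g\<mu>.Fubini'[symmetric]) measurable
  also have "\<dots> = (\<integral>\<^sup>+x. \<kappa> \<partial>\<mu>)"
    by (rule nn_integral_cong_AE) (use \<mu>_ne \<kappa> in \<open>auto elim: eventually_mono\<close>)
  also have "\<dots> = \<kappa>" by (simp add: \<mu>.emeasure_space_1)
  finally have \<pi>\<kappa>: "\<pi> = \<kappa>" .
  have "(\<integral>\<^sup>+U. \<integral>\<^sup>+V. I U V \<partial>gauss_n n \<partial>gauss_n n) = (\<integral>\<^sup>+U. \<kappa> \<partial>gauss_n n)"
    by (rule nn_integral_cong_AE) (use g_ne \<kappa> in \<open>auto elim: eventually_mono\<close>)
  then have "(\<integral>\<^sup>+U. \<integral>\<^sup>+V. I U V \<partial>gauss_n n \<partial>gauss_n n) = \<kappa>"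
    by (simp only: nn_integral_const g.emeasure_space_1 mult_1_right)
  then have gauss: "enn2real \<kappa> = corr_level.tail_prob 0 c n"
    using gauss_pearson_tail_uncorrelated[OF c n] unfolding I_def by simp
  have XY: "distr M (Rn n \<Otimes>\<^sub>M Rn n) (\<lambda>\<omega>. (X \<omega>, Y \<omega>)) = \<mu> \<Otimes>\<^sub>M \<nu>"
    using indep unfolding indep_var_distribution_eq \<mu>_def \<nu>_def by simp
  have [measurable]: "(\<lambda>\<omega>. X \<omega> i) \<in> borel_measurable M" "(\<lambda>\<omega>. Y \<omega> i) \<in> borel_measurable M" if "i \<in> {1..n}" for i
    using measurable_compose[OF X measurable_component_singleton[OF that]]
      measurable_compose[OF Y measurable_component_singleton[OF that]] .
  have [measurable]: "{\<omega> \<in> space M. c \<le> pearson n (X \<omega>) (Y \<omega>)} \<in> sets M" by measurable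
  have "emeasure M {\<omega> \<in> space M. c \<le> pearson n (X \<omega>) (Y \<omega>)} = (\<integral>\<^sup>+\<omega>. indicator {\<omega> \<in> space M. c \<le> pearson n (X \<omega>) (Y \<omega>)} \<omega> \<partial>M)"
    by simp
  also have "\<dots> = (\<integral>\<^sup>+\<omega>. I (fst (X \<omega>, Y \<omega>)) (snd (X \<omega>, Y \<omega>)) \<partial>M)"
    by (intro nn_integral_cong) (simp add: I_def indicator_def)
  also have "\<dots> = (\<integral>\<^sup>+z. I (fst z) (snd z) \<partial>distr M (Rn n \<Otimes>\<^sub>M Rn n) (\<lambda>\<omega>. (X \<omega>, Y \<omega>)))"
    by (rule nn_integral_distr[symmetric]) measurable
  \<comment> \<open>Independence enters here, through the product form of the joint law; the inner
    integral is then constant for almost every y.\<close>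
  also have "\<dots> = (\<integral>\<^sup>+y. \<integral>\<^sup>+x. I x y \<partial>\<mu> \<partial>\<nu>)"
    unfolding XY by (subst \<mu>\<nu>.nn_integral_snd[symmetric]) auto
  also have "\<dots> = (\<integral>\<^sup>+y. \<pi> \<partial>\<nu>)"
    by (rule nn_integral_cong_AE) (use \<nu>_ne \<pi> in \<open>auto elim: eventually_mono\<close>)
  also have "\<dots> = \<kappa>" by (simp add: \<nu>.emeasure_space_1 \<pi>\<kappa>)
  finally show ?thesis by (simp add: measure_def gauss)
qed

theorem theorem5p1:
  fixes M :: "nat \<Rightarrow> 'a measure"
    and X Y :: "nat \<Rightarrow> 'a \<Rightarrow> nat \<Rightarrow> real"
    and N :: "(real \<times> real) measure"
    and c \<rho> :: real
  shows "(0 < c \<and> c < 1 \<and> (\<forall>n>2. spherical_model n (M n) (X n) (Y n)) \<longrightarrow>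
            (\<exists>\<delta>. sharp_expansion L_S Lstar_S R0_S c (pearson_tail M X Y c) \<delta>)) \<and>
         (0 \<le> \<rho> \<and> \<rho> < c \<and> c < 1 \<and> \<bar>\<rho>\<bar> \<le> sqrt (3 + 2 * sqrt 3) / 3 \<and>
          gaussian_law \<rho> N \<and> (\<forall>n\<ge>1. iid_sample N n (M n) (X n) (Y n)) \<longrightarrow>
            (\<exists>\<delta>. sharp_expansion (L_G \<rho>) (Lstar_G \<rho>) (R0_G \<rho>) c (pearson_tail M X Y c) \<delta>))"
proof (intro conjI impI)
  assume "0 < c \<and> c < 1 \<and> (\<forall>n>2. spherical_model n (M n) (X n) (Y n))"
  then have c: "0 < c" "c < 1" and model: "\<And>n. 2 < n \<Longrightarrow> spherical_model n (M n) (X n) (Y n)" by auto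
  interpret corr_level 0 c by standard (use c in auto)
  have "\<exists>\<delta>. sharp_expansion (L_G 0) (Lstar_G 0) (R0_G 0) c (pearson_tail M X Y c) \<delta>"
    by (rule sharp_expansion_from_integral)
      (simp_all add: pearson_tail_def spherical_tail_prob[OF c _ model] tail_prob_def)
  \<comment> \<open>The rate functions are compared at c only, where 1 - c^2 > 0 allows the
    logarithm to be split.\<close>
  moreover have "Lstar_S c = Lstar_G 0 c" using c by (intro Lstar_S_eq) auto
  ultimately show "\<exists>\<delta>. sharp_expansion L_S Lstar_S R0_S c (pearson_tail M X Y c) \<delta>"
    by (simp add: sharp_expansion_def L_S_eq R0_S_eq)
next
  assume a: "0 \<le> \<rho> \<and> \<rho> < c \<and> c < 1 \<and> \<bar>\<rho>\<bar> \<le> sqrt (3 + 2 * sqrt 3) / 3 \<and>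
    gaussian_law \<rho> N \<and> (\<forall>n\<ge>1. iid_sample N n (M n) (X n) (Y n))"
  interpret corr_level \<rho> c by standard (use a in auto)
  show "\<exists>\<delta>. sharp_expansion (L_G \<rho>) (Lstar_G \<rho>) (R0_G \<rho>) c (pearson_tail M X Y c) \<delta>"
  proof (rule sharp_expansion_from_integral)
    have "\<bar>\<rho>\<bar> \<le> sqrt (3 + 2 * sqrt 3) / 3" using a by blast
    then show "\<rho> \<le> sqrt (3 + 2 * sqrt 3) / 3" by linarith
    fix n :: nat assume n: "2 < n"
    have "gaussian_law \<rho> N" "iid_sample N n (M n) (X n) (Y n)" using a n by auto
    from gaussian_tail_prob[OF this n]
    show "pearson_tail M X Y c n = (1 / u0) ^ (n - 2) / pi *
      (LINT \<tau>|lborel. indicator {0<..} \<tau> * (exp (- real (n - 2) * \<tau>) *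
        (u0 * exp \<tau> * angle_deriv slope offset u0 u1 (u0 * exp \<tau>))))"
      by (simp add: pearson_tail_def tail_prob_def)
  qed
qed

end
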